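(* Let $\Omega\subset\mathbb R^2$ be simply connected. A vector field $\psi_h\in W_h$ satisfies $\psi_h=\operatorname{Curl}_h\varphi_h$ for some $\varphi_h\in V_h$ if and only if $\int_T\operatorname{div}\psi_h=0$ for all $T\in\mathcal T$.
   Context: $\Omega\subset\mathbb R^2$ is an open, bounded, connected Lipschitz polygon, $\mathcal T$ a regular triangulation of $\Omega$ into triangles, $\mathcal F$ the set of its edges, and $\nu_F$ a unit normal of the edge $F$. Bernardi--Raugel velocity space: $W_h:=\{v\in[H^1_0(\Omega)]^2:v|_T\text{ affine for every }T\in\mathcal T\}\oplus\operatorname{span}\{b_F\nu_F:F\in\mathcal F,F\not\subset\partial\Omega\}$, where $b_F$ is the quadratic edge bubble of the interior edge $F$ (a multiple of the product of the two nodal hat functions of the endpoints of $F$, supported on the two triangles sharing $F$). DKT space: for a triangle $T$ with vertices $z_1,z_2,z_3$ and centroid $a$, $P_3^-(T):=\{p\in P_3(T):6p(a)-\sum_{m=1}^3(2p(z_m)-\nabla p(z_m)\cdot(z_m-a))=0\}$ (a function in $P_3^-(T)$ is uniquely determined by its values and first derivatives at the vertices). $V_h:=\{v\in H^1_0(\Omega):v|_T\in P_3^-(T)\ \forall T\in\mathcal T$, $\nabla v$ is continuous at all vertices and $0$ at all boundary vertices$\}$. Discrete gradient: for $v_h\in V_h$, $\nabla_hv_h\in[H^1_0(\Omega)]^2$ is the piecewise quadratic vector field whose normal component is affine on each edge of each triangle, with $\nabla_hv_h(z)=\nabla v_h(z)$ at every vertex $z$ and $\nabla_hv_h(m_E)\cdot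 t_E=\nabla v_h(m_E)\cdot t_E$ at the midpoint $m_E$ of every edge $E$ with unit tangent $t_E$. The discrete Curl is $\operatorname{Curl}_h\varphi_h:=\begin{pmatrix}0&-1\\1&0\end{pmatrix}\nabla_h\varphi_h$. *)

theory Defs
  imports "HOL-Analysis.Analysis"
begin

section \<open>Polygons and triangulations\<close>

definition rot90 :: "real^2^2" where
  "rot90 = vector [vector [0, -1], vector [1, 0]]"

text \<open>Near every boundary point, in suitable orthonormal coordinates \<open>(s, t)\<close>, the domain is the
  strict subgraph and the boundary is the graph of a Lipschitz function.\<close>

definition lipschitz_boundary :: "(real^2) set \<Rightarrow> bool" where
  "lipschitz_boundary \<Omega> \<longleftrightarrow>
    (\<forall>x\<in>frontier \<Omega>. \<exists>(e::real^2) (r::real) (h::real) (L::real) (\<gamma>::real \<Rightarrow> real).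
       norm e = 1 \<and> r > 0 \<and> h > 0 \<and> L-lipschitz_on {-r<..<r} \<gamma> \<and>
       (\<forall>s\<in>{-r<..<r}. \<bar>\<gamma> s\<bar> < h) \<and>
       (\<forall>s\<in>{-r<..<r}. \<forall>t\<in>{-h<..<h}.
          (x + s *\<^sub>R e + t *\<^sub>R (rot90 *v e) \<in> \<Omega> \<longleftrightarrow> t < \<gamma> s) \<and>
          (x + s *\<^sub>R e + t *\<^sub>R (rot90 *v e) \<in> frontier \<Omega> \<longleftrightarrow> t = \<gamma> s)))"

definition lipschitz_polygon :: "(real^2) set \<Rightarrow> bool" where
  "lipschitz_polygon \<Omega> \<longleftrightarrow>
    open \<Omega> \<and> bounded \<Omega> \<and> connected \<Omega> \<and> lipschitz_boundary \<Omega> \<and>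
    (\<exists>S. finite S \<and> frontier \<Omega> = (\<Union>(a, b)\<in>S. closed_segment a b))"

text \<open>Triangles are closed. The library notion \<^const>\<open>triangulation\<close> requires any two members to
  meet in a common face (possibly empty), so there are no hanging nodes.\<close>

definition regular_triangulation :: "(real^2) set set \<Rightarrow> (real^2) set \<Rightarrow> bool" where
  "regular_triangulation \<T> \<Omega> \<longleftrightarrow>
    triangulation \<T> \<and> (\<forall>T\<in>\<T>. 2 simplex T) \<and> \<Union>\<T> = closure \<Omega>"

definition verts :: "(real^2) set \<Rightarrow> (real^2) set" where
  "verts S = {z. z extreme_point_of S}"

definition vertices :: "(real^2) set set \<Rightarrow> (real^2) set" where
  "vertices \<T> = (\<Union>T\<in>\<T>. verts T)"

definition edges :: "(real^2) set set \<Rightarrow> (real^2) set set" where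
  "edges \<T> = {F. \<exists>T\<in>\<T>. F edge_of T}"

definition interior_edges :: "(real^2) set \<Rightarrow> (real^2) set set \<Rightarrow> (real^2) set set" where
  "interior_edges \<Omega> \<T> = {F\<in>edges \<T>. \<not> F \<subseteq> frontier \<Omega>}"

text \<open>The mean of the vertices: the centroid of a triangle and the midpoint of an edge.\<close>

definition barycentre :: "(real^2) set \<Rightarrow> real^2" where
  "barycentre S = (1 / real (card (verts S))) *\<^sub>R (\<Sum>z\<in>verts S. z)"

definition unit_normal :: "(real^2) set \<Rightarrow> real^2 \<Rightarrow> bool" where
  "unit_normal E n \<longleftrightarrow> norm n = 1 \<and> (\<forall>x\<in>E. \<forall>y\<in>E. n \<bullet> (x - y) = 0)"

definition unit_tangent :: "(real^2) set \<Rightarrow> real^2 \<Rightarrow> bool" where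
  "unit_tangent E t \<longleftrightarrow> norm t = 1 \<and> (\<exists>x\<in>E. \<exists>y\<in>E. \<exists>c. t = c *\<^sub>R (x - y))"


section \<open>Differentiation and Sobolev spaces\<close>

text \<open>The gradient of the restriction of a function to \<open>S\<close>. On a closed triangle \<open>S\<close> the derivative
  within \<open>S\<close> is unique at every point, vertices and edge points included, so for a piecewise
  polynomial \<open>v\<close> the vector \<open>grad_on T v z\<close> is the one-sided gradient of \<open>v\<close> from \<open>T\<close> at \<open>z\<close>.\<close>

definition grad_on :: "(real^2) set \<Rightarrow> (real^2 \<Rightarrow> real) \<Rightarrow> real^2 \<Rightarrow> real^2" where
  "grad_on S v x = (\<chi> i. frechet_derivative v (at x within S) (axis i 1))"

definition div_on :: "(real^2) set \<Rightarrow> (real^2 \<Rightarrow> real^2) \<Rightarrow> real^2 \<Rightarrow> real" where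
  "div_on S \<psi> x = (\<Sum>i\<in>UNIV. grad_on S (\<lambda>y. \<psi> y $ i) x $ i)"

primrec Ck :: "nat \<Rightarrow> (real^2 \<Rightarrow> real) \<Rightarrow> bool" where
  "Ck 0 f \<longleftrightarrow> continuous_on UNIV f"
| "Ck (Suc k) f \<longleftrightarrow> f differentiable_on UNIV \<and> (\<forall>i. Ck k (\<lambda>x. grad_on UNIV f x $ i))"

definition test_functions :: "(real^2) set \<Rightarrow> (real^2 \<Rightarrow> real) set" where
  "test_functions \<Omega> =
    {\<phi>. (\<forall>k. Ck k \<phi>) \<and> compact (closure {x. \<phi> x \<noteq> 0}) \<and> closure {x. \<phi> x \<noteq> 0} \<subseteq> \<Omega>}"

definition L2 :: "(real^2) set \<Rightarrow> (real^2 \<Rightarrow> real) set" where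
  "L2 \<Omega> = {f \<in> borel_measurable (lebesgue_on \<Omega>). integrable (lebesgue_on \<Omega>) (\<lambda>x. (f x)\<^sup>2)}"

definition has_weak_gradient ::
    "(real^2 \<Rightarrow> real) \<Rightarrow> (real^2 \<Rightarrow> real^2) \<Rightarrow> (real^2) set \<Rightarrow> bool" where
  "has_weak_gradient v g \<Omega> \<longleftrightarrow>
    (\<forall>\<phi>\<in>test_functions \<Omega>. \<forall>i.
       (\<integral>x. v x * (grad_on UNIV \<phi> x $ i) \<partial>lebesgue_on \<Omega>) = - (\<integral>x. g x $ i * \<phi> x \<partial>lebesgue_on \<Omega>))"

text \<open>The closure of the test functions in the \<open>H\<^sup>1(\<Omega>)\<close> norm. Membership depends only on the
  almost-everywhere class of \<open>v\<close> on \<open>\<Omega>\<close>.\<close>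

definition H10 :: "(real^2) set \<Rightarrow> (real^2 \<Rightarrow> real) set" where
  "H10 \<Omega> = {v \<in> L2 \<Omega>. \<exists>g. (\<forall>i. (\<lambda>x. g x $ i) \<in> L2 \<Omega>) \<and> has_weak_gradient v g \<Omega> \<and>
     (\<exists>\<phi>. (\<forall>n. \<phi> n \<in> test_functions \<Omega>) \<and>
       (\<lambda>n::nat. \<integral>x. (\<phi> n x - v x)\<^sup>2 + (norm (grad_on UNIV (\<phi> n) x - g x))\<^sup>2 \<partial>lebesgue_on \<Omega>)
         \<longlonglongrightarrow> 0)}"

definition H10_vec :: "(real^2) set \<Rightarrow> (real^2 \<Rightarrow> real^2) set" where
  "H10_vec \<Omega> = {v. \<forall>i. (\<lambda>x. v x $ i) \<in> H10 \<Omega>}"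


section \<open>Finite element spaces\<close>

text \<open>Functions whose restriction to \<open>S\<close> is a polynomial of total degree at most \<open>k\<close>.\<close>

definition P :: "nat \<Rightarrow> (real^2) set \<Rightarrow> (real^2 \<Rightarrow> real) set" where
  "P k S = {p. \<exists>c :: nat \<Rightarrow> nat \<Rightarrow> real.
     \<forall>x\<in>S. p x = (\<Sum>i\<le>k. \<Sum>j\<le>k - i. c i j * (x $ 1) ^ i * (x $ 2) ^ j)}"

definition P3_minus :: "(real^2) set \<Rightarrow> (real^2 \<Rightarrow> real) set" where
  "P3_minus T = {p \<in> P 3 T.
     6 * p (barycentre T)
       - (\<Sum>z\<in>verts T. 2 * p z - grad_on T p z \<bullet> (z - barycentre T)) = 0}"

text \<open>Finite element functions are total functions on the plane that belong to the given local space
  on every closed triangle and vanish off the union of the triangles. This selects one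
  representative per class, so that equality of functions is equality of fields on \<open>closure \<Omega>\<close>.\<close>

definition piecewise ::
    "(real^2) set set \<Rightarrow> ((real^2) set \<Rightarrow> (real^2 \<Rightarrow> real) set) \<Rightarrow> (real^2 \<Rightarrow> real) set" where
  "piecewise \<T> Q = {v. (\<forall>T\<in>\<T>. v \<in> Q T) \<and> (\<forall>x. x \<notin> \<Union>\<T> \<longrightarrow> v x = 0)}"

definition piecewise_vec ::
    "(real^2) set set \<Rightarrow> ((real^2) set \<Rightarrow> (real^2 \<Rightarrow> real) set) \<Rightarrow> (real^2 \<Rightarrow> real^2) set" where
  "piecewise_vec \<T> Q = {v. \<forall>i. (\<lambda>x. v x $ i) \<in> piecewise \<T> Q}"

definition hat :: "(real^2) set set \<Rightarrow> real^2 \<Rightarrow> real^2 \<Rightarrow> real" where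
  "hat \<T> z = (THE f. f \<in> piecewise \<T> (P 1) \<and> (\<forall>y\<in>vertices \<T>. f y = (if y = z then 1 else 0)))"

definition edge_bubble :: "(real^2) set set \<Rightarrow> (real^2) set \<Rightarrow> real^2 \<Rightarrow> real" where
  "edge_bubble \<T> F x = (\<Prod>z\<in>verts F. hat \<T> z x)"

definition BR_space ::
    "(real^2) set \<Rightarrow> (real^2) set set \<Rightarrow> ((real^2) set \<Rightarrow> real^2) \<Rightarrow> (real^2 \<Rightarrow> real^2) set" where
  "BR_space \<Omega> \<T> \<nu> =
    {\<lambda>x. v x + (\<Sum>F\<in>interior_edges \<Omega> \<T>. c F *\<^sub>R (edge_bubble \<T> F x *\<^sub>R \<nu> F)) | v c.
       v \<in> H10_vec \<Omega> \<and> v \<in> piecewise_vec \<T> (P 1)}"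

definition DKT_space :: "(real^2) set \<Rightarrow> (real^2) set set \<Rightarrow> (real^2 \<Rightarrow> real) set" where
  "DKT_space \<Omega> \<T> = {v \<in> H10 \<Omega>. v \<in> piecewise \<T> P3_minus \<and>
     (\<forall>z\<in>vertices \<T>. \<exists>g. (\<forall>T\<in>\<T>. z \<in> T \<longrightarrow> grad_on T v z = g) \<and> (z \<in> frontier \<Omega> \<longrightarrow> g = 0))}"

definition is_disc_grad ::
    "(real^2) set \<Rightarrow> (real^2) set set \<Rightarrow> (real^2 \<Rightarrow> real) \<Rightarrow> (real^2 \<Rightarrow> real^2) \<Rightarrow> bool" where
  "is_disc_grad \<Omega> \<T> v G \<longleftrightarrow>
    G \<in> H10_vec \<Omega> \<and> G \<in> piecewise_vec \<T> (P 2) \<and>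
    (\<forall>T\<in>\<T>.
       (\<forall>E n. E edge_of T \<and> unit_normal E n \<longrightarrow> (\<lambda>x. G x \<bullet> n) \<in> P 1 E) \<and>
       (\<forall>z\<in>verts T. G z = grad_on T v z) \<and>
       (\<forall>E t. E edge_of T \<and> unit_tangent E t \<longrightarrow>
          G (barycentre E) \<bullet> t = grad_on T v (barycentre E) \<bullet> t))"

definition disc_grad ::
    "(real^2) set \<Rightarrow> (real^2) set set \<Rightarrow> (real^2 \<Rightarrow> real) \<Rightarrow> real^2 \<Rightarrow> real^2" where
  "disc_grad \<Omega> \<T> v = (THE G. is_disc_grad \<Omega> \<T> v G)"

definition disc_Curl ::
    "(real^2) set \<Rightarrow> (real^2) set set \<Rightarrow> (real^2 \<Rightarrow> real) \<Rightarrow> real^2 \<Rightarrow> real^2" where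
  "disc_Curl \<Omega> \<T> \<phi> x = rot90 *v disc_grad \<Omega> \<T> \<phi> x"

end

theory Submission
  imports Defs "HOL-Complex_Analysis.Riemann_Mapping"
begin

text \<open>
  Rotated back by a quarter turn, a field of the Bernardi--Raugel space is a continuous piecewise
  quadratic field \<open>G\<close> that vanishes on the boundary and whose edge bubbles point along the edges.
  A discrete gradient has the same shape, so the question is which \<open>G\<close> have a potential.
  By the divergence theorem the integral of \<open>div \<psi>\<close> over a triangle is a nonzero multiple of the sum
  of the circulations of \<open>G\<close> along its three edges (\<open>integral_div_circulation\<close>).

  If \<open>G\<close> is the discrete gradient of \<open>\<phi>\<close>, then Simpson's rule, which is exact for the derivative of
  a cubic, identifies the circulation along \<open>[a, b]\<close> with \<open>\<phi> b - \<phi> a\<close>, and the three differences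
  cancel (\<open>disc_grad_circulation\<close>). Conversely, if the circulations cancel on every triangle, they
  are the differences of vertex values, and the vertex values together with the vertex gradients
  taken from \<open>G\<close> determine a cubic of the DKT space on each triangle up to a constant
  (\<open>hermite_P3_minus\<close>). Cubics of neighbouring triangles differ by a constant on the common face
  (\<open>hermite_compat\<close>), and they are constant on boundary edges. Hence the increments of these cubics,
  and zero increments outside \<open>\<Omega>\<close>, are consistent near every point of the plane. In the plane, locally
  consistent increments have a global primitive (\<open>primitive_on_rect\<close>). Simple connectedness of \<open>\<Omega>\<close>
  enters through the connectedness of its complement: the primitive is constant there, and
  subtracting this constant gives the boundary values zero (\<open>potential_exists\<close>).

  Members of the finite element spaces are continuous up to the boundary, and for them membership in
  \<open>H\<^sup>1\<^sub>0\<close> means to vanish on the boundary (\<open>piecewise_H10_iff\<close>). In one direction this is a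
  mollification argument (\<open>zero_trace_lipschitz.in_H10\<close>). In the other, a function of \<open>H\<^sup>1\<^sub>0\<close>, extended by zero, changes
  under a translation by \<open>h\<close> only by \<open>O(\<bar>h\<bar>)\<close> in the \<open>L\<^sup>2\<close> norm, whereas a jump across the boundary
  would cost \<open>\<bar>h\<bar>\<^sup>1\<^sup>/\<^sup>2\<close> (\<open>H10_zero_on_frontier\<close>).
\<close>

section \<open>Gradients and smooth functions\<close>

lemma grad_on_UNIV_eq:
  assumes "(f has_derivative (\<bullet>) g) (at x)"
  shows "grad_on UNIV f x = g"
  using frechet_derivative_at[OF assms, symmetric] by (simp add: grad_on_def vec_eq_iff inner_axis)

lemma has_derivative_grad_on:
  assumes "f differentiable (at x)"
  shows "(f has_derivative (\<bullet>) (grad_on UNIV f x)) (at x)"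
proof -
  have f: "(f has_derivative frechet_derivative f (at x)) (at x)"
    using assms by (simp add: frechet_derivative_works)
  then interpret linear "frechet_derivative f (at x)" by (rule has_derivative_linear)
  have "frechet_derivative f (at x) h = grad_on UNIV f x \<bullet> h" for h
  proof -
    have "h = (\<Sum>i\<in>UNIV. (h$i) *\<^sub>R axis i 1)"
      by (simp add: vec_eq_iff axis_def sum.delta if_distrib[where f="\<lambda>x. _ * x"] cong: if_cong)
    then have "frechet_derivative f (at x) h = frechet_derivative f (at x) (\<Sum>i\<in>UNIV. (h$i) *\<^sub>R axis i 1)"
      by simp
    also have "\<dots> = (\<Sum>i\<in>UNIV. (h$i) * frechet_derivative f (at x) (axis i 1))"
      by (simp only: sum scale real_scaleR_def)
    also have "\<dots> = grad_on UNIV f x \<bullet> h" by (simp add: grad_on_def inner_vec_def mult.commute)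
    finally show ?thesis .
  qed
  then have "frechet_derivative f (at x) = (\<bullet>) (grad_on UNIV f x)" by blast
  then show ?thesis using f by simp
qed

definition smooth :: "(real^2 \<Rightarrow> real) \<Rightarrow> bool" where
  "smooth f \<longleftrightarrow> (\<forall>k. Ck k f)"

lemma smooth_continuous: "smooth f \<Longrightarrow> continuous_on A f"
  unfolding smooth_def by (metis Ck.simps(1) continuous_on_subset subset_UNIV)

lemma smooth_grad_component: "smooth f \<Longrightarrow> smooth (\<lambda>x. grad_on UNIV f x $ i)"
  unfolding smooth_def by (metis Ck.simps(2))

lemma smooth_has_derivative: "smooth f \<Longrightarrow> (f has_derivative (\<bullet>) (grad_on UNIV f x)) (at x)"
  unfolding smooth_def by (metis Ck.simps(2) differentiable_on_def UNIV_I has_derivative_grad_on)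

lemma smooth_continuous_grad: "smooth f \<Longrightarrow> continuous_on A (grad_on UNIV f)"
  by (rule continuous_on_vec_lambda[of _ "\<lambda>i x. grad_on UNIV f x $ i", simplified vec_nth_inverse])
     (rule smooth_continuous[OF smooth_grad_component])

text \<open>Smoothness is shown by exhibiting a set of functions that is closed under partial derivatives.\<close>
lemma smooth_by_coinduction:
  assumes "f \<in> S"
    and "\<And>f. f \<in> S \<Longrightarrow> \<exists>g. (\<forall>i. (\<lambda>x. g x $ i) \<in> S) \<and> (\<forall>x. (f has_derivative (\<bullet>) (g x)) (at x))"
  shows "smooth f"
  unfolding smooth_def
proof
  fix k
  show "Ck k f" using assms(1)
  proof (induction k arbitrary: f)
    case 0
    with assms(2) show ?case
      by (metis Ck.simps(1) has_derivative_continuous continuous_at_imp_continuous_on)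
  next
    case (Suc k)
    obtain g where g: "\<And>i. (\<lambda>x. g x $ i) \<in> S" "\<And>x. (f has_derivative (\<bullet>) (g x)) (at x)"
      using assms(2)[OF Suc.prems] by blast
    then have "grad_on UNIV f = g" using grad_on_UNIV_eq by blast
    moreover have "f differentiable_on UNIV"
      using g(2) by (auto simp: differentiable_on_def differentiable_def)
    ultimately show ?case using Suc.IH[OF g(1)] by simp
  qed
qed

section \<open>A smooth bump function\<close>

text \<open>The derivative of a member is a combination of later members, so that the family is closed under
  differentiation.\<close>
definition flat :: "nat \<Rightarrow> real \<Rightarrow> real" where
  "flat k t = (if t > 0 then exp (- (1 / t)) / t ^ k else 0)"

lemma flat_nonneg: "flat k t \<ge> 0"
  by (simp add: flat_def)

lemma flat_tendsto_0: "(flat k \<longlongrightarrow> 0) (at 0)"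
proof -
  have "((\<lambda>t. (1/t) ^ k / exp (1/t)) \<longlongrightarrow> 0) (at_right (0::real))"
    by (rule filterlim_compose[OF tendsto_power_div_exp_0])
       (use filterlim_inverse_at_top_right in \<open>simp add: inverse_eq_divide\<close>)
  moreover have "\<forall>\<^sub>F t in at_right 0. (1/t) ^ k / exp (1/t) = flat k t"
    by (rule eventually_at_rightI[of _ 1]) (auto simp: flat_def exp_minus field_simps power_divide)
  ultimately have "(flat k \<longlongrightarrow> 0) (at_right 0)" by (rule Lim_transform_eventually)
  moreover have "(flat k \<longlongrightarrow> 0) (at_left 0)"
    by (rule Lim_transform_eventually[of "\<lambda>_. 0"])
       (auto simp: flat_def intro!: eventually_at_leftI[of "-1"])
  ultimately show ?thesis by (simp add: filterlim_split_at)
qed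

lemma flat_has_derivative:
  "(flat k has_real_derivative (flat (k + 2) t - real k * flat (k + 1) t)) (at t)"
proof -
  consider "t > 0" | "t < 0" | "t = 0" by linarith
  then show ?thesis
  proof cases
    case 1
    have "((\<lambda>t. exp (- (1 / t)) / t ^ k) has_real_derivative
        (exp (- (1 / t)) * (1 / t\<^sup>2) * t ^ k - exp (- (1 / t)) * (real k * t ^ (k - 1))) / (t ^ k * t ^ k)) (at t)"
      using 1 by (auto intro!: derivative_eq_intros simp: power2_eq_square)
    moreover have "(exp (- (1 / t)) * (1 / t\<^sup>2) * t ^ k - exp (- (1 / t)) * (real k * t ^ (k - 1))) / (t ^ k * t ^ k)
        = flat (k + 2) t - real k * flat (k + 1) t"
    proof -
      have "real k * t ^ (k - 1) = real k * t ^ k / t" using 1 by (cases k) auto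
      then show ?thesis using 1 by (auto simp: flat_def power_add field_simps power2_eq_square)
    qed
    ultimately have "((\<lambda>t. exp (- (1 / t)) / t ^ k) has_real_derivative (flat (k + 2) t - real k * flat (k + 1) t)) (at t)"
      by simp
    note A = this
    have B: "\<forall>\<^sub>F x in nhds t. exp (- (1 / x)) / x ^ k = flat k x"
      using eventually_nhds_in_open[of "{0<..}" t] 1 by (auto simp: flat_def elim!: eventually_mono)
    show ?thesis by (rule iffD1[OF DERIV_cong_ev[OF refl B refl] A])
  next
    case 2
    have "((\<lambda>t. 0) has_real_derivative (flat (k + 2) t - real k * flat (k + 1) t)) (at t)"
      using 2 by (auto intro!: derivative_eq_intros simp: flat_def)
    note A = this
    have B: "\<forall>\<^sub>F x in nhds t. 0 = flat k x"
      using eventually_nhds_in_open[of "{..<0}" t] 2 by (auto simp: flat_def elim!: eventually_mono)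
    show ?thesis by (rule iffD1[OF DERIV_cong_ev[OF refl B refl] A])
  next
    case 3
    \<comment> \<open>The difference quotient of \<open>flat k\<close> at the origin is \<open>flat (k + 1)\<close>.\<close>
    have "((\<lambda>h. flat (k+1) h) \<longlongrightarrow> 0) (at 0)" by (rule flat_tendsto_0)
    then have "((\<lambda>h. (flat k (0 + h) - flat k 0) / h) \<longlongrightarrow> 0) (at 0)"
      by (rule Lim_transform_eventually)
         (auto simp: flat_def eventually_at_filter intro!: always_eventually)
    then show ?thesis using 3 by (simp add: DERIV_def flat_def)
  qed
qed

text \<open>An algebra closed under partial derivatives which contains both the bumps supported in a ball of
  squared radius \<open>e\<close> and all polynomials.\<close>
inductive_set bump_algebra :: "real \<Rightarrow> (real^2 \<Rightarrow> real) set" for e where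
  const: "(\<lambda>x. c) \<in> bump_algebra e"
| coord: "(\<lambda>x. x $ i) \<in> bump_algebra e"
| flat: "(\<lambda>x. flat k (e - x \<bullet> x)) \<in> bump_algebra e"
| add: "f \<in> bump_algebra e \<Longrightarrow> g \<in> bump_algebra e \<Longrightarrow> (\<lambda>x. f x + g x) \<in> bump_algebra e"
| mult: "f \<in> bump_algebra e \<Longrightarrow> g \<in> bump_algebra e \<Longrightarrow> (\<lambda>x. f x * g x) \<in> bump_algebra e"

lemma smooth_bump_algebra:
  assumes "f \<in> bump_algebra e"
  shows "smooth f"
  using assms
proof (rule smooth_by_coinduction)
  fix f assume "f \<in> bump_algebra e"
  then show "\<exists>g. (\<forall>i. (\<lambda>x. g x $ i) \<in> bump_algebra e) \<and> (\<forall>x. (f has_derivative (\<bullet>) (g x)) (at x))"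
  proof induction
    case (const c)
    show ?case
      by (rule exI[of _ "\<lambda>x. 0"]) (auto intro!: bump_algebra.intros derivative_eq_intros)
  next
    case (coord i)
    have "((\<lambda>x. x $ i) has_derivative (\<bullet>) (axis i 1)) (at x)" for x :: "real^2"
    proof -
      have "((\<lambda>x::real^2. x $ i) has_derivative (\<lambda>h. h $ i)) (at x)"
        by (rule bounded_linear_imp_has_derivative[OF bounded_linear_vec_nth])
      moreover have "(\<lambda>h::real^2. h $ i) = (\<bullet>) (axis i 1)" by (auto simp: inner_axis')
      ultimately show ?thesis by simp
    qed
    then show ?case
      by (intro exI[of _ "\<lambda>x. axis i 1"]) (auto intro!: bump_algebra.intros)
  next
    case (flat k)
    let ?c = "\<lambda>x::real^2. (flat (k+2) (e - x\<bullet>x) + (- real k) * flat (k+1) (e - x\<bullet>x)) * (-2)"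
    have "((\<lambda>x. flat k (e - x\<bullet>x)) has_derivative (\<bullet>) (?c x *\<^sub>R x)) (at x)" for x :: "real^2"
    proof -
      have "((\<lambda>x. e - x\<bullet>x) has_derivative (\<lambda>h. - 2 * (x \<bullet> h))) (at x)"
        by (auto intro!: derivative_eq_intros simp: inner_commute)
      from has_derivative_compose[OF this flat_has_derivative[of k "e - x\<bullet>x", unfolded has_field_derivative_def]]
      show ?thesis
        by (rule has_derivative_eq_rhs) (auto simp: algebra_simps)
    qed
    moreover have "(\<lambda>x. (?c x *\<^sub>R x) $ i) \<in> bump_algebra e" for i
      unfolding vector_scaleR_component real_scaleR_def by (intro bump_algebra.intros)
    ultimately show ?case by (intro exI[of _ "\<lambda>x. ?c x *\<^sub>R x"]) blast
  next
    case (add f g)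
    then obtain f' g' where "\<And>i. (\<lambda>x. f' x $ i) \<in> bump_algebra e" "\<And>x. (f has_derivative (\<bullet>) (f' x)) (at x)"
      "\<And>i. (\<lambda>x. g' x $ i) \<in> bump_algebra e" "\<And>x. (g has_derivative (\<bullet>) (g' x)) (at x)" by metis
    note d = this
    have "((\<lambda>x. f x + g x) has_derivative (\<bullet>) (f' x + g' x)) (at x)" for x
      using has_derivative_add[OF d(2)[of x] d(4)[of x]] by (simp add: inner_add_left[abs_def])
    then show ?case
      by (intro exI[of _ "\<lambda>x. f' x + g' x"]) (auto intro!: bump_algebra.intros d)
  next
    case (mult f g)
    then obtain f' g' where "\<And>i. (\<lambda>x. f' x $ i) \<in> bump_algebra e" "\<And>x. (f has_derivative (\<bullet>) (f' x)) (at x)"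
      "\<And>i. (\<lambda>x. g' x $ i) \<in> bump_algebra e" "\<And>x. (g has_derivative (\<bullet>) (g' x)) (at x)" by metis
    note d = this
    have "((\<lambda>x. f x * g x) has_derivative (\<bullet>) (f x *\<^sub>R g' x + g x *\<^sub>R f' x)) (at x)" for x
    proof -
      have "((\<lambda>x. f x * g x) has_derivative (\<lambda>h. f x * (g' x \<bullet> h) + (f' x \<bullet> h) * g x)) (at x)"
        by (rule has_derivative_mult[OF d(2)[of x] d(4)[of x]])
      moreover have "(\<lambda>h. f x * (g' x \<bullet> h) + (f' x \<bullet> h) * g x) = (\<bullet>) (f x *\<^sub>R g' x + g x *\<^sub>R f' x)"
        by (auto simp: inner_add_left)
      ultimately show ?thesis by simp
    qed
    then show ?case using mult.hyps
      by (intro exI[of _ "\<lambda>x. f x *\<^sub>R g' x + g x *\<^sub>R f' x"]) (auto intro!: bump_algebra.intros d)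
  qed
qed

lemma integrable_compact_support:
  fixes f :: "'a::euclidean_space \<Rightarrow> real"
  assumes "continuous_on UNIV f" "\<And>x. x \<notin> cball 0 r \<Longrightarrow> f x = 0"
  shows "integrable lborel f"
proof -
  have "(\<lambda>x. indicator (cball 0 r) x *\<^sub>R f x) = f"
    using assms(2) by (force simp: indicator_def fun_eq_iff)
  then show ?thesis
    using borel_integrable_compact[OF compact_cball continuous_on_subset[OF assms(1)], of 0 r] by simp
qed

lemma integral_lborel_translate:
  fixes f :: "'a::euclidean_space \<Rightarrow> real"
  assumes "f \<in> borel_measurable borel"
  shows "(\<integral>x. f (c + x) \<partial>lborel) = (\<integral>x. f x \<partial>lborel)"
  using integral_distr[of "(+) c" lborel borel f] assms by (simp add: lborel_distr_plus)

lemma integral_lborel_reflect: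
  fixes f :: "'a::euclidean_space \<Rightarrow> real"
  assumes "f \<in> borel_measurable borel"
  shows "(\<integral>x. f (c - x) \<partial>lborel) = (\<integral>x. f x \<partial>lborel)"
proof -
  have "distr lborel borel (\<lambda>x. c + (-1) *\<^sub>R x) = (lborel :: 'a measure)"
    by (subst (2) lborel_affine[of "-1" c]) (simp_all add: density_1 one_ennreal_def[symmetric])
  moreover have "(\<integral>x. f x \<partial>distr lborel borel (\<lambda>x. c + (-1) *\<^sub>R x)) = (\<integral>x. f (c + (-1) *\<^sub>R x) \<partial>lborel)"
    by (rule integral_distr) (use assms in auto)
  ultimately show ?thesis by simp
qed

section \<open>Mollification\<close>

definition bump_mass :: "real \<Rightarrow> real" where
  "bump_mass e = (\<integral>x. flat 0 (e\<^sup>2 - x \<bullet> x) \<partial>(lborel :: (real^2) measure))"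

definition bump :: "real \<Rightarrow> real^2 \<Rightarrow> real" where
  "bump e x = flat 0 (e\<^sup>2 - x \<bullet> x) / bump_mass e"

lemma flat_ball_eq_0:
  assumes "e > 0" "norm x \<ge> e" shows "flat k (e\<^sup>2 - x \<bullet> x) = 0"
proof -
  have "e\<^sup>2 \<le> (norm x)\<^sup>2" by (rule power_mono) (use assms in auto)
  then show ?thesis by (simp add: flat_def power2_norm_eq_inner)
qed

lemma smooth_bump: "smooth (bump e)"
  unfolding bump_def[abs_def] divide_inverse
  by (rule smooth_bump_algebra[of _ "e\<^sup>2"]) (intro bump_algebra.intros)

lemma integrable_flat_ball:
  assumes "e > 0" shows "integrable lborel (\<lambda>x::real^2. flat 0 (e\<^sup>2 - x \<bullet> x))"
  by (rule integrable_compact_support[of _ e])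
     (auto simp: smooth_continuous[OF smooth_bump_algebra[OF bump_algebra.flat]] flat_ball_eq_0 assms)

lemma bump_mass_pos:
  assumes "e > 0" shows "bump_mass e > 0"
proof -
  have nn: "bump_mass e \<ge> 0" by (simp add: bump_mass_def flat_nonneg)
  have "bump_mass e \<noteq> 0"
  proof
    assume "bump_mass e = 0"
    then have "AE x::real^2 in lborel. flat 0 (e\<^sup>2 - x \<bullet> x) = 0"
      unfolding bump_mass_def using integrable_flat_ball[OF assms]
      by (subst (asm) integral_nonneg_eq_0_iff_AE) (auto simp: flat_nonneg)
    then have "AE x::real^2 in lborel. x \<notin> ball 0 e"
    proof eventually_elim
      case (elim x)
      show ?case
      proof
        assume "x \<in> ball 0 e"
        then have "e\<^sup>2 - x \<bullet> x > 0" using assms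
          by (simp add: power2_norm_eq_inner[symmetric] power_strict_mono)
        with elim show False by (simp add: flat_def)
      qed
    qed
    then have "emeasure lborel (ball (0::real^2) e) = 0"
      by (subst (asm) AE_iff_null_sets[symmetric]) auto
    then have "negligible (ball (0::real^2) e)"
      by (simp add: negligible_iff_null_sets null_sets_completionI null_setsI)
    then show False using assms open_not_negligible[of "ball (0::real^2) e"] by simp
  qed
  then show ?thesis using nn by simp
qed

lemma bump_nonneg: "e > 0 \<Longrightarrow> bump e x \<ge> 0"
  using bump_mass_pos[of e] by (simp add: bump_def flat_nonneg)

lemma bump_eq_0: "e > 0 \<Longrightarrow> norm x \<ge> e \<Longrightarrow> bump e x = 0"
  by (simp add: bump_def flat_ball_eq_0)

lemma integral_bump: "e > 0 \<Longrightarrow> (\<integral>x. bump e x \<partial>lborel) = 1"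
  using bump_mass_pos[of e] by (simp add: bump_def) (simp add: bump_mass_def)

lemma integrable_bump_mult:
  assumes "e > 0" "continuous_on UNIV q"
  shows "integrable lborel (\<lambda>x. bump e x * q x)"
  by (rule integrable_compact_support[of _ e])
     (auto intro!: continuous_intros assms smooth_continuous[OF smooth_bump] simp: bump_eq_0 assms)

lemma bump_average_bound:
  assumes e: "e > 0" and q: "continuous_on UNIV q" and b: "\<And>x. norm x < e \<Longrightarrow> \<bar>q x - w\<bar> \<le> \<eta>"
  shows "\<bar>(\<integral>x. bump e x * q x \<partial>lborel) - w\<bar> \<le> \<eta>"
proof -
  have le: "bump e x * q x \<le> bump e x * (w + \<eta>)" "bump e x * (w - \<eta>) \<le> bump e x * q x" for x
    by (cases "norm x < e"; use b[of x] bump_nonneg[OF e, of x] bump_eq_0[OF e, of x] in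
         \<open>auto intro!: mult_left_mono simp: abs_le_iff\<close>)+
  have i: "integrable lborel (\<lambda>x. bump e x * c)" for c
    by (rule integrable_bump_mult[OF e]) auto
  have "(\<integral>x. bump e x * q x \<partial>lborel) \<le> (\<integral>x. bump e x * (w + \<eta>) \<partial>lborel)"
    by (intro integral_mono i integrable_bump_mult e q le)
  moreover have "(\<integral>x. bump e x * (w - \<eta>) \<partial>lborel) \<le> (\<integral>x. bump e x * q x \<partial>lborel)"
    by (intro integral_mono i integrable_bump_mult e q le)
  ultimately show ?thesis using integral_bump[OF e] by (simp add: abs_le_iff)
qed

definition mollify :: "real \<Rightarrow> (real^2 \<Rightarrow> real) \<Rightarrow> real^2 \<Rightarrow> real" where
  "mollify e u x = (\<integral>y. bump e y * u (x - y) \<partial>lborel)"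

lemma continuous_on_reflect:
  fixes u :: "'a::real_normed_vector \<Rightarrow> real"
  assumes "continuous_on UNIV u" shows "continuous_on A (\<lambda>y. u (x - y))"
  by (rule continuous_on_compose2[OF assms]) (auto intro!: continuous_intros)

text \<open>For \<open>\<eta> = 0\<close> this is locality: where \<open>u\<close> is constant near \<open>x\<close>, mollification does not change it.\<close>
lemma mollify_near:
  assumes "e > 0" "continuous_on UNIV u" "\<And>y. dist y x < e \<Longrightarrow> \<bar>u y - w\<bar> \<le> \<eta>"
  shows "\<bar>mollify e u x - w\<bar> \<le> \<eta>"
  unfolding mollify_def
  by (rule bump_average_bound[OF assms(1) continuous_on_reflect[OF assms(2)]]) (auto intro!: assms(3) simp: dist_norm)

text \<open>For \<open>w = 0\<close> mollification keeps Lipschitz constants. For \<open>w\<close> a linear function of \<open>z - x\<close> it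
  controls the gradient of the mollification.\<close>
lemma mollify_increment:
  assumes e: "e > 0" and u: "continuous_on UNIV u"
    and inc: "\<And>y. norm y < e \<Longrightarrow> \<bar>u (z - y) - u (x - y) - w\<bar> \<le> \<eta>"
  shows "\<bar>mollify e u z - mollify e u x - w\<bar> \<le> \<eta>"
proof -
  have "mollify e u z - mollify e u x = (\<integral>y. bump e y * (u (z - y) - u (x - y)) \<partial>lborel)"
    unfolding mollify_def right_diff_distrib
    by (intro Bochner_Integration.integral_diff[symmetric] integrable_bump_mult continuous_on_reflect e u)
  moreover have "continuous_on UNIV (\<lambda>y. u (z - y) - u (x - y))"
    by (intro continuous_intros continuous_on_reflect[OF u])
  ultimately show ?thesis
    using bump_average_bound[OF e _ inc] by simp
qed

text \<open>Derivatives of a convolution fall on the kernel, so the convolutions of \<open>u\<close> with smooth kernels are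
  closed under partial derivatives.\<close>
lemma smooth_convolution:
  fixes u :: "real^2 \<Rightarrow> real"
  assumes u: "continuous_on UNIV u" and K: "smooth K"
  shows "smooth (\<lambda>x. integral (cbox a b) (\<lambda>y. K (x - y) * u y))"
proof (rule smooth_by_coinduction)
  let ?S = "{\<lambda>x. integral (cbox a b) (\<lambda>y. K (x - y) * u y) | K. smooth K}"
  show "(\<lambda>x. integral (cbox a b) (\<lambda>y. K (x - y) * u y)) \<in> ?S" using K by blast
  fix f assume "f \<in> ?S"
  then obtain K where f: "f = (\<lambda>x. integral (cbox a b) (\<lambda>y. K (x - y) * u y))" and K: "smooth K" by blast
  define D where "D x y = u y *\<^sub>R blinfun_inner_right (grad_on UNIV K (x - y))" for x y
  have cK: "continuous_on A (\<lambda>p. K (fst p - snd p))" for A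
    by (rule continuous_on_compose2[OF smooth_continuous[OF K, of UNIV]]) (auto intro!: continuous_intros)
  have cG: "continuous_on A (\<lambda>p. grad_on UNIV K (fst p - snd p))" for A
    by (rule continuous_on_compose2[OF smooth_continuous_grad[OF K, of UNIV]]) (auto intro!: continuous_intros)
  have cu: "continuous_on A (\<lambda>p. u (snd p))" for A :: "((real^2) \<times> (real^2)) set"
    by (rule continuous_on_compose2[OF u]) (auto intro!: continuous_intros)
  have cD: "continuous_on A (\<lambda>(x,y). D x y)" for A
    unfolding D_def split_beta
    by (intro continuous_intros bounded_linear.continuous_on[OF bounded_linear_blinfun_inner_right] cG cu)
  have cK': "continuous_on A (\<lambda>y. K (x - y))" for A x
    by (rule continuous_on_compose2[OF smooth_continuous[OF K, of UNIV]]) (auto intro!: continuous_intros)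
  have cG': "continuous_on A (\<lambda>y. grad_on UNIV K (x - y))" for A x
    by (rule continuous_on_compose2[OF smooth_continuous_grad[OF K, of UNIV]]) (auto intro!: continuous_intros)
  have u': "continuous_on A u" for A by (rule continuous_on_subset[OF u]) auto
  have der: "(f has_derivative integral (cbox a b) (D x)) (at x)" for x
    unfolding f
  proof (rule leibniz_rule[of UNIV, where fx = D])
    fix x t
    have "((\<lambda>x. K (x - t)) has_derivative (\<lambda>h. grad_on UNIV K (x - t) \<bullet> h)) (at x)"
      by (rule has_derivative_compose[of "\<lambda>x. x - t" "\<lambda>h. h", OF _ smooth_has_derivative[OF K]])
         (auto intro!: derivative_eq_intros)
    then have "((\<lambda>x. K (x - t) * u t) has_derivative (\<lambda>h. (grad_on UNIV K (x - t) \<bullet> h) * u t)) (at x)"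
      by (rule has_derivative_mult_left)
    then show "((\<lambda>x. K (x - t) * u t) has_derivative blinfun_apply (D x t)) (at x)"
    proof (rule has_derivative_eq_rhs)
      show "(\<lambda>h. (grad_on UNIV K (x - t) \<bullet> h) * u t) = blinfun_apply (D x t)"
        by (simp add: D_def blinfun.scaleR_left fun_eq_iff)
    qed
  next
    fix x show "(\<lambda>y. K (x - y) * u y) integrable_on cbox a b"
      by (intro integrable_continuous continuous_intros cK' u')
  qed (auto intro!: cD)
  define g where "g x = (\<chi> i. integral (cbox a b) (\<lambda>y. grad_on UNIV K (x - y) $ i * u y))" for x
  have "(f has_derivative (\<bullet>) (g x)) (at x)" for x
  proof -
    have cDx: "continuous_on (cbox a b) (D x)"
      unfolding D_def
      by (intro continuous_intros bounded_linear.continuous_on[OF bounded_linear_blinfun_inner_right] cG' u')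
    have "blinfun_apply (integral (cbox a b) (D x)) (axis i 1) = g x $ i" for i
    proof -
      have "integral (cbox a b) ((\<lambda>B. blinfun_apply B (axis i 1)) \<circ> D x) = blinfun_apply (integral (cbox a b) (D x)) (axis i 1)"
        by (rule integral_linear[OF integrable_continuous[OF cDx] blinfun.bounded_linear_left])
      then show ?thesis
        by (simp add: g_def D_def o_def blinfun.scaleR_left inner_axis mult.commute)
    qed
    moreover have "grad_on UNIV f x $ i = blinfun_apply (integral (cbox a b) (D x)) (axis i 1)" for i
      using frechet_derivative_at[OF der[of x], symmetric] by (simp add: grad_on_def)
    ultimately have "grad_on UNIV f x = g x" by (simp add: vec_eq_iff)
    then show ?thesis using has_derivative_grad_on[of f x] der by (auto simp: differentiable_def)
  qed
  moreover have "(\<lambda>x. g x $ i) \<in> ?S" for i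
    using smooth_grad_component[OF K, of i] by (auto simp: g_def)
  ultimately show "\<exists>g. (\<forall>i. (\<lambda>x. g x $ i) \<in> ?S) \<and> (\<forall>x. (f has_derivative (\<bullet>) (g x)) (at x))" by blast
qed

lemma smooth_mollify:
  assumes e: "e > 0" and u: "continuous_on UNIV u" and supp: "\<And>x. x \<notin> cbox a b \<Longrightarrow> u x = 0"
  shows "smooth (mollify e u)"
proof -
  have "mollify e u x = integral (cbox a b) (\<lambda>y. bump e (x - y) * u y)" for x
  proof -
    have cb: "continuous_on UNIV (bump e)" by (rule smooth_continuous[OF smooth_bump])
    have c: "continuous_on UNIV (\<lambda>y. bump e (x - y) * u y)"
      by (intro continuous_intros continuous_on_reflect cb u)
    have "mollify e u x = (\<integral>y. (\<lambda>y. bump e (x - y) * u y) (x - y) \<partial>lborel)"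
      by (simp add: mollify_def)
    also have "\<dots> = (\<integral>y. bump e (x - y) * u y \<partial>lborel)"
      by (rule integral_lborel_reflect) (rule borel_measurable_continuous_onI[OF c])
    also have "\<dots> = integral UNIV (\<lambda>y. bump e (x - y) * u y)"
    proof (rule integral_lborel[symmetric], rule integrable_compact_support[OF c])
      fix y :: "real^2" assume y: "y \<notin> cball 0 (norm x + e)"
      have "norm y \<le> norm x + norm (x - y)" using norm_triangle_ineq4[of x "x - y"] by simp
      with y have "e \<le> norm (x - y)" by simp
      then show "bump e (x - y) * u y = 0" by (simp add: bump_eq_0[OF e])
    qed
    also have "\<dots> = integral (cbox a b) (\<lambda>y. bump e (x - y) * u y)"
    proof -
      have "(\<lambda>y. bump e (x - y) * u y) = (\<lambda>y. if y \<in> cbox a b then bump e (x - y) * u y else 0)"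
        using supp by auto
      then have "integral UNIV (\<lambda>y. bump e (x - y) * u y) =
          integral UNIV (\<lambda>y. if y \<in> cbox a b then bump e (x - y) * u y else 0)"
        by (rule arg_cong)
      then show ?thesis by (simp only: integral_restrict_UNIV)
    qed
    finally show ?thesis .
  qed
  then have "mollify e u = (\<lambda>x. integral (cbox a b) (\<lambda>y. bump e (x - y) * u y))" by blast
  then show ?thesis using smooth_convolution[OF u smooth_bump] by simp
qed

lemma integral_lebesgue_on_eq_lborel:
  fixes f :: "'a::euclidean_space \<Rightarrow> real"
  assumes "open S" "f \<in> borel_measurable borel" "\<And>x. x \<notin> S \<Longrightarrow> f x = 0"
  shows "(\<integral>x. f x \<partial>lebesgue_on S) = (\<integral>x. f x \<partial>lborel)"
proof -
  have "S \<inter> space lebesgue \<in> sets lebesgue" using assms(1) by (simp add: borel_open)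
  then have "(\<integral>x. f x \<partial>lebesgue_on S) = (\<integral>x. indicator S x *\<^sub>R f x \<partial>lebesgue)"
    by (rule integral_restrict_space)
  also have "(\<lambda>x. indicator S x *\<^sub>R f x) = f" using assms(3) by (force simp: indicator_def fun_eq_iff)
  also have "(\<integral>x. f x \<partial>lebesgue) = (\<integral>x. f x \<partial>lborel)" by (rule integral_completion) (use assms in simp)
  finally show ?thesis .
qed

lemma borel_measurable_lebesgue_on: "f \<in> borel_measurable borel \<Longrightarrow> f \<in> borel_measurable (lebesgue_on S)"
  by (intro measurable_restrict_space1 measurable_completion) simp

text \<open>Bounds on increments turn into bounds on gradients: with \<open>w = 0\<close> for Lipschitz functions, and with a
  limit \<open>w\<close> for the convergence of gradients.\<close>
lemma norm_grad_diff_le: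
  fixes w :: "real^2"
  assumes f: "(f has_derivative (\<bullet>) G) (at x)"
    and near: "\<forall>\<^sub>F y in at x. \<bar>f y - f x - w \<bullet> (y - x)\<bar> \<le> \<eta> * dist y x"
  shows "norm (G - w) \<le> \<eta>"
proof (cases "G = w")
  case True
  have "at x \<noteq> bot" by simp
  moreover have "\<forall>\<^sub>F y in at x. y \<noteq> x" by (simp add: eventually_at_filter)
  with near have "\<forall>\<^sub>F y in at x. \<eta> \<ge> 0"
  proof eventually_elim
    case (elim y)
    then have "0 \<le> \<eta> * dist y x" by linarith
    with elim(2) show ?case by (simp add: zero_le_mult_iff)
  qed
  ultimately show ?thesis using True by simp
next
  case False
  define h where "h = G - w"
  have h: "h \<noteq> 0" using False by (simp add: h_def)
  have lim: "((\<lambda>t. x + t *\<^sub>R h) \<longlongrightarrow> x) (at_right 0)"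
    by (auto intro!: tendsto_eq_intros)
  have inj: "\<forall>\<^sub>F t in at_right 0. x + t *\<^sub>R h \<noteq> x"
    using h by (auto simp: eventually_at_filter)
  have "filterlim (\<lambda>t. x + t *\<^sub>R h) (at x) (at_right 0)"
    using lim inj by (simp add: filterlim_at)
  then have near': "\<forall>\<^sub>F t in at_right 0. \<bar>f (x + t *\<^sub>R h) - f x - w \<bullet> (t *\<^sub>R h)\<bar> \<le> \<eta> * norm (t *\<^sub>R h)"
    using near by (auto simp: filterlim_iff dist_norm)
  have "((\<lambda>t. x + t *\<^sub>R h) has_derivative (\<lambda>t. t *\<^sub>R h)) (at 0 within {0<..})"
    by (auto intro!: derivative_eq_intros)
  from has_derivative_compose[OF this, of f "(\<bullet>) G"] f
  have "((\<lambda>t. f (x + t *\<^sub>R h)) has_derivative (\<lambda>t. G \<bullet> (t *\<^sub>R h))) (at 0 within {0<..})"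
    by simp
  then have "((\<lambda>t. f (x + t *\<^sub>R h)) has_real_derivative G \<bullet> h) (at 0 within {0<..})"
    by (simp add: has_field_derivative_def mult.commute[of _ "G \<bullet> h"])
  then have "((\<lambda>t. (f (x + t *\<^sub>R h) - f x) / t) \<longlongrightarrow> G \<bullet> h) (at_right 0)"
    by (simp add: has_field_derivative_iff)
  then have "((\<lambda>t. \<bar>(f (x + t *\<^sub>R h) - f x) / t - w \<bullet> h\<bar>) \<longlongrightarrow> \<bar>G \<bullet> h - w \<bullet> h\<bar>) (at_right 0)"
    by (intro tendsto_intros)
  moreover have "\<forall>\<^sub>F t in at_right 0. \<bar>(f (x + t *\<^sub>R h) - f x) / t - w \<bullet> h\<bar> \<le> \<eta> * norm h"
    using near' eventually_at_right_less[of 0]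
  proof eventually_elim
    case (elim t)
    have "\<bar>(f (x + t *\<^sub>R h) - f x) / t - w \<bullet> h\<bar> = \<bar>f (x + t *\<^sub>R h) - f x - w \<bullet> (t *\<^sub>R h)\<bar> / t"
      using elim(2) by (simp add: field_simps abs_divide flip: abs_of_pos)
    also have "\<dots> \<le> \<eta> * norm (t *\<^sub>R h) / t"
      using elim by (intro divide_right_mono) auto
    also have "\<dots> = \<eta> * norm h" using elim(2) by simp
    finally show ?case .
  qed
  ultimately have "\<bar>G \<bullet> h - w \<bullet> h\<bar> \<le> \<eta> * norm h"
    by (rule tendsto_upperbound) simp
  then have "norm h * norm h \<le> \<eta> * norm h"
    by (simp add: h_def inner_diff_left[symmetric] power2_norm_eq_inner[symmetric] power2_eq_square)
  then show ?thesis using h by (simp add: h_def)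
qed

section \<open>Difference quotients of test functions\<close>

locale C1_compact =
  fixes W :: "real^2 \<Rightarrow> real" and g :: "real^2 \<Rightarrow> real^2" and R :: real
  assumes W: "\<And>x. (W has_derivative (\<bullet>) (g x)) (at x)"
    and g: "continuous_on UNIV g"
    and supp: "\<And>x. x \<notin> cball 0 R \<Longrightarrow> W x = 0"
begin

lemma W_continuous: "continuous_on A W"
  using W by (meson continuous_at_imp_continuous_on has_derivative_continuous)

lemma quotient_bound:
  obtains B where "\<And>s x. 0 < s \<Longrightarrow> s \<le> 1 \<Longrightarrow> \<bar>(W (x + s *\<^sub>R h) - W x) / s\<bar> \<le> B * indicator (cball 0 (R + norm h)) x"
    "B \<ge> 0"
proof -
  let ?C = "cball 0 (R + 2 * norm h) :: (real^2) set"
  have "bounded (g ` ?C)"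
    by (intro compact_imp_bounded compact_continuous_image continuous_on_subset[OF g]) auto
  then obtain B where B: "B > 0" "\<And>x. x \<in> ?C \<Longrightarrow> norm (g x) \<le> B"
    unfolding bounded_pos by blast
  have "\<bar>(W (x + s *\<^sub>R h) - W x) / s\<bar> \<le> (B * norm h) * indicator (cball 0 (R + norm h)) x"
    if s: "0 < s" "s \<le> 1" for s x
  proof (cases "x \<in> cball 0 (R + norm h)")
    case True
    have sh: "norm (s *\<^sub>R h) \<le> norm h" using s by (simp add: mult_left_le_one_le)
    have "norm (W (x + s *\<^sub>R h) - W x) \<le> B * norm (x + s *\<^sub>R h - x)"
    proof (rule differentiable_bound[of ?C])
      show "(W has_derivative (\<bullet>) (g y)) (at y within ?C)" for y
        using W by (rule has_derivative_at_withinI)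
      show "onorm ((\<bullet>) (g y)) \<le> B" if "y \<in> ?C" for y
      proof (rule onorm_bound)
        show "norm (g y \<bullet> v) \<le> B * norm v" for v
          using Cauchy_Schwarz_ineq2[of "g y" v] mult_right_mono[OF B(2)[OF that], of "norm v"] by simp
      qed (use B(1) in simp)
      show "x \<in> ?C" using True by (simp) (use norm_ge_zero[of h] in linarith)
      show "x + s *\<^sub>R h \<in> ?C" using True sh norm_triangle_ineq[of x "s *\<^sub>R h"] by simp
    qed simp
    then have "\<bar>W (x + s *\<^sub>R h) - W x\<bar> \<le> (B * norm h) * s"
      using s by (simp add: mult.commute mult.left_commute)
    then show ?thesis using s True by (simp add: field_simps abs_divide)
  next
    case False
    have "norm (s *\<^sub>R h) \<le> norm h" using s by (simp add: mult_left_le_one_le)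
    then have "W x = 0" "W (x + s *\<^sub>R h) = 0"
      using False norm_triangle_ineq2[of x "- (s *\<^sub>R h)"]
      by (auto intro!: supp) (use norm_ge_zero[of h] in linarith)
    then show ?thesis using False by simp
  qed
  then show thesis using that[of "B * norm h"] B(1) by simp
qed

lemma quotient_tendsto:
  assumes "\<And>n. s n \<noteq> 0" "s \<longlonglongrightarrow> 0"
  shows "(\<lambda>n. (W (x + s n *\<^sub>R h) - W x) / s n) \<longlonglongrightarrow> g x \<bullet> h"
proof -
  have "((\<lambda>t. x + t *\<^sub>R h) has_derivative (\<lambda>t. t *\<^sub>R h)) (at 0)"
    by (auto intro!: derivative_eq_intros)
  from has_derivative_compose[OF this, of W "(\<bullet>) (g x)"] W[of x]
  have "((\<lambda>t. W (x + t *\<^sub>R h)) has_derivative (\<lambda>t. g x \<bullet> (t *\<^sub>R h))) (at 0)"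
    by simp
  then have "((\<lambda>t. W (x + t *\<^sub>R h)) has_real_derivative g x \<bullet> h) (at 0)"
    by (simp add: has_field_derivative_def mult.commute[of _ "g x \<bullet> h"])
  then have "((\<lambda>t. (W (x + t *\<^sub>R h) - W x) / t) \<longlongrightarrow> g x \<bullet> h) (at 0)"
    by (simp add: has_field_derivative_iff)
  moreover have "filterlim s (at 0) sequentially"
    using assms by (simp add: filterlim_at)
  ultimately show ?thesis by (rule filterlim_compose)
qed

text \<open>Dominated convergence: the quotients are bounded and vanish off a fixed ball. It is applied with
  \<open>\<psi>\<close> the identity and the square.\<close>
lemma integral_quotient_tendsto:
  fixes \<psi> :: "real \<Rightarrow> real"
  assumes \<psi>: "continuous_on UNIV \<psi>" "\<psi> 0 = 0" "\<And>s t. \<bar>s\<bar> \<le> t \<Longrightarrow> \<bar>\<psi> s\<bar> \<le> \<psi> t"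
  shows "(\<lambda>n. \<integral>x. \<psi> ((W (x + (1 / real (Suc n)) *\<^sub>R h) - W x) / (1 / real (Suc n))) \<partial>lborel)
           \<longlonglongrightarrow> (\<integral>x. \<psi> (g x \<bullet> h) \<partial>lborel)"
proof -
  obtain B where B: "\<And>s x. 0 < s \<Longrightarrow> s \<le> 1 \<Longrightarrow> \<bar>(W (x + s *\<^sub>R h) - W x) / s\<bar> \<le> B * indicator (cball 0 (R + norm h)) x" "B \<ge> 0"
    using quotient_bound[of h] by blast
  have cW': "continuous_on UNIV (\<lambda>x. W (x + c))" for c
    by (rule continuous_on_compose2[OF W_continuous[of UNIV]]) (auto intro!: continuous_intros)
  show ?thesis
  proof (rule integral_dominated_convergence[where w = "\<lambda>x. indicator (cball 0 (R + norm h)) x *\<^sub>R \<psi> B"])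
    show "(\<lambda>x. \<psi> (g x \<bullet> h)) \<in> borel_measurable lborel"
      by (simp, rule borel_measurable_continuous_onI, rule continuous_on_compose2[OF \<psi>(1)])
         (auto intro!: continuous_intros g)
    show "(\<lambda>x. \<psi> ((W (x + (1 / real (Suc n)) *\<^sub>R h) - W x) / (1 / real (Suc n)))) \<in> borel_measurable lborel" for n
      by (simp, rule borel_measurable_continuous_onI, rule continuous_on_compose2[OF \<psi>(1)])
         (auto intro!: continuous_intros W_continuous cW')
    show "integrable lborel (\<lambda>x. indicator (cball 0 (R + norm h)) x *\<^sub>R \<psi> B)"
      by (rule borel_integrable_compact) auto
    show "AE x in lborel. (\<lambda>n. \<psi> ((W (x + (1 / real (Suc n)) *\<^sub>R h) - W x) / (1 / real (Suc n)))) \<longlonglongrightarrow> \<psi> (g x \<bullet> h)"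
    proof (rule AE_I2)
      fix x
      have "(\<lambda>n. (W (x + (1 / real (Suc n)) *\<^sub>R h) - W x) / (1 / real (Suc n))) \<longlonglongrightarrow> g x \<bullet> h"
        by (rule quotient_tendsto) (use LIMSEQ_inverse_real_of_nat in \<open>auto simp: inverse_eq_divide\<close>)
      moreover have "isCont \<psi> (g x \<bullet> h)" using \<psi>(1) by (simp add: continuous_on_eq_continuous_at)
      ultimately show "(\<lambda>n. \<psi> ((W (x + (1 / real (Suc n)) *\<^sub>R h) - W x) / (1 / real (Suc n)))) \<longlonglongrightarrow> \<psi> (g x \<bullet> h)"
        using isCont_tendsto_compose by fast
    qed
    show "AE x in lborel. norm (\<psi> ((W (x + (1 / real (Suc n)) *\<^sub>R h) - W x) / (1 / real (Suc n)))) \<le> indicator (cball 0 (R + norm h)) x *\<^sub>R \<psi> B" for n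
    proof (rule AE_I2)
      fix x
      have "\<bar>(W (x + (1 / real (Suc n)) *\<^sub>R h) - W x) / (1 / real (Suc n))\<bar> \<le> B * indicator (cball 0 (R + norm h)) x"
        by (rule B) (auto simp: field_simps)
      from \<psi>(3)[OF this] show "norm (\<psi> ((W (x + (1 / real (Suc n)) *\<^sub>R h) - W x) / (1 / real (Suc n)))) \<le> indicator (cball 0 (R + norm h)) x *\<^sub>R \<psi> B"
        using \<psi>(2) by (cases "x \<in> cball 0 (R + norm h)") auto
    qed
  qed
qed

text \<open>The difference quotients have integral zero by translation invariance.\<close>
lemma integral_derivative_eq_0: "(\<integral>x. g x \<bullet> h \<partial>lborel) = 0"
proof -
  have iW: "integrable lborel W" by (rule integrable_compact_support[OF W_continuous supp])
  have *: "(\<integral>x. (W (x + c) - W x) / s \<partial>lborel) = 0" for c s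
  proof -
    have "integrable lborel (\<lambda>x. W (c + x))"
      using iW integrable_distr_eq[of "(+) c" lborel borel W]
      by (simp add: lborel_distr_plus borel_measurable_continuous_onI W_continuous)
    then have "(\<integral>x. W (c + x) - W x \<partial>lborel) = 0"
      using iW by (simp add: integral_lborel_translate borel_measurable_continuous_onI W_continuous)
    then show ?thesis by (simp add: add.commute)
  qed
  have "(\<lambda>n. \<integral>x. (W (x + (1 / real (Suc n)) *\<^sub>R h) - W x) / (1 / real (Suc n)) \<partial>lborel)
           \<longlonglongrightarrow> (\<integral>x. g x \<bullet> h \<partial>lborel)"
    by (rule integral_quotient_tendsto) auto
  then show ?thesis unfolding * by (simp add: LIMSEQ_const_iff)
qed

text \<open>The increment over \<open>h\<close> is the sum of \<open>n + 1\<close> increments over \<open>h / (n + 1)\<close>. By the Cauchy--Schwarz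
  inequality and translation invariance its square integral is at most that of one difference
  quotient with step \<open>h / (n + 1)\<close>, which converges to the right-hand side.\<close>
lemma integral_translation_le:
  "(\<integral>x. (W (x + h) - W x)\<^sup>2 \<partial>lborel) \<le> (\<integral>x. (g x \<bullet> h)\<^sup>2 \<partial>lborel)"
proof (rule LIMSEQ_le_const)
  show "(\<lambda>n. \<integral>x. ((W (x + (1 / real (Suc n)) *\<^sub>R h) - W x) / (1 / real (Suc n)))\<^sup>2 \<partial>lborel)
           \<longlonglongrightarrow> (\<integral>x. (g x \<bullet> h)\<^sup>2 \<partial>lborel)"
    by (rule integral_quotient_tendsto[of "\<lambda>t. t\<^sup>2"]) (auto intro!: continuous_intros abs_le_square_iff[THEN iffD1])
  have cW': "continuous_on UNIV (\<lambda>x. W (x + c))" for c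
    by (rule continuous_on_compose2[OF W_continuous[of UNIV]]) (auto intro!: continuous_intros)
  have int: "integrable lborel (\<lambda>x. (W (x + c) - W (x + d))\<^sup>2)" for c d :: "real^2"
  proof (rule integrable_compact_support[of _ "R + norm c + norm d"])
    show "continuous_on UNIV (\<lambda>x. (W (x + c) - W (x + d))\<^sup>2)"
      by (intro continuous_intros cW')
    fix x :: "real^2" assume x: "x \<notin> cball 0 (R + norm c + norm d)"
    have "W (x + c) = 0" "W (x + d) = 0"
      using x norm_triangle_ineq2[of x "- c"] norm_triangle_ineq2[of x "- d"]
      by (auto intro!: supp) (use norm_ge_zero[of c] norm_ge_zero[of d] in linarith)+
    then show "(W (x + c) - W (x + d))\<^sup>2 = 0" by simp
  qed
  have "(\<integral>x. (W (x + h) - W x)\<^sup>2 \<partial>lborel) \<le> (\<integral>x. ((W (x + (1 / real (Suc n)) *\<^sub>R h) - W x) / (1 / real (Suc n)))\<^sup>2 \<partial>lborel)" for n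
  proof -
    define s where "s = 1 / real (Suc n)"
    define D where "D k x = W (x + (real (Suc k) * s) *\<^sub>R h) - W (x + (real k * s) *\<^sub>R h)" for k x
    have tel: "(\<Sum>k<Suc n. D k x) = W (x + h) - W x" for x
    proof -
      have "(\<Sum>k<m. D k x) = W (x + (real m * s) *\<^sub>R h) - W x" for m
        by (induction m) (auto simp: D_def)
      from this[of "Suc n"] show ?thesis by (simp add: s_def del: sum.lessThan_Suc)
    qed
    have intD: "integrable lborel (\<lambda>x. (D k x)\<^sup>2)" for k
      unfolding D_def by (rule int)
    have eqD: "(\<integral>x. (D k x)\<^sup>2 \<partial>lborel) = (\<integral>x. (W (x + s *\<^sub>R h) - W x)\<^sup>2 \<partial>lborel)" for k
    proof -
      have "(\<integral>x. (D k x)\<^sup>2 \<partial>lborel) = (\<integral>x. (\<lambda>x. (W (x + s *\<^sub>R h) - W x)\<^sup>2) ((real k * s) *\<^sub>R h + x) \<partial>lborel)"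
        by (rule Bochner_Integration.integral_cong) (auto simp: D_def algebra_simps)
      also have "\<dots> = (\<integral>x. (W (x + s *\<^sub>R h) - W x)\<^sup>2 \<partial>lborel)"
        by (rule integral_lborel_translate, rule borel_measurable_continuous_onI) (intro continuous_intros W_continuous cW')
      finally show ?thesis .
    qed
    have "(\<integral>x. (W (x + h) - W x)\<^sup>2 \<partial>lborel) \<le> (\<integral>x. (\<Sum>k<Suc n. (D k x)\<^sup>2) * real (Suc n) \<partial>lborel)"
    proof (rule integral_mono)
      show "integrable lborel (\<lambda>x. (W (x + h) - W x)\<^sup>2)" using int[of h 0] by simp
      show "integrable lborel (\<lambda>x. (\<Sum>k<Suc n. (D k x)\<^sup>2) * real (Suc n))"
        by (intro integrable_mult_left Bochner_Integration.integrable_sum intD)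
      show "(W (x + h) - W x)\<^sup>2 \<le> (\<Sum>k<Suc n. (D k x)\<^sup>2) * real (Suc n)" for x
        using sum_squared_le_sum_of_squares[of "\<lambda>k. D k x" "{..<Suc n}"] unfolding tel by simp
    qed
    also have "\<dots> = (\<Sum>k<Suc n. (\<integral>x. (D k x)\<^sup>2 \<partial>lborel)) * real (Suc n)"
      by (simp only: Bochner_Integration.integral_mult_left_zero Bochner_Integration.integral_sum intD)
    also have "\<dots> = (real (Suc n))\<^sup>2 * (\<integral>x. (W (x + s *\<^sub>R h) - W x)\<^sup>2 \<partial>lborel)"
      unfolding eqD by (simp add: power2_eq_square del: of_nat_Suc)
    also have "\<dots> = (\<integral>x. ((W (x + s *\<^sub>R h) - W x) / s)\<^sup>2 \<partial>lborel)"
      by (simp add: s_def power_mult_distrib power_divide mult.commute del: of_nat_Suc)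
    finally show ?thesis unfolding s_def .
  qed
  then show "\<exists>N. \<forall>n\<ge>N. (\<integral>x. (W (x + h) - W x)\<^sup>2 \<partial>lborel) \<le> (\<integral>x. ((W (x + (1 / real (Suc n)) *\<^sub>R h) - W x) / (1 / real (Suc n)))\<^sup>2 \<partial>lborel)"
    by blast
qed

end

lemma test_functionD:
  assumes "\<phi> \<in> test_functions \<Omega>"
  shows "smooth \<phi>" "\<And>x. x \<notin> \<Omega> \<Longrightarrow> \<phi> x = 0" "\<And>x. x \<notin> \<Omega> \<Longrightarrow> grad_on UNIV \<phi> x = 0"
    "\<exists>R. C1_compact \<phi> (grad_on UNIV \<phi>) R"
proof -
  have \<phi>: "smooth \<phi>" "compact (closure {x. \<phi> x \<noteq> 0})" "closure {x. \<phi> x \<noteq> 0} \<subseteq> \<Omega>"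
    using assms by (auto simp: test_functions_def smooth_def)
  show "smooth \<phi>" by fact
  show "\<phi> x = 0" if "x \<notin> \<Omega>" for x using that \<phi>(3) closure_subset[of "{x. \<phi> x \<noteq> 0}"] by auto
  show "grad_on UNIV \<phi> x = 0" if "x \<notin> \<Omega>" for x
  proof (rule grad_on_UNIV_eq)
    have "\<forall>\<^sub>F y in nhds x. y \<in> - closure {x. \<phi> x \<noteq> 0}"
      by (rule eventually_nhds_in_open) (use that \<phi>(3) in auto)
    then have *: "\<forall>\<^sub>F y in nhds x. 0 = \<phi> y"
      by eventually_elim (use closure_subset[of "{x. \<phi> x \<noteq> 0}"] in auto)
    have "((\<lambda>y. 0) has_derivative (\<bullet>) 0) (at x)" by (auto intro!: derivative_eq_intros)
    then show "(\<phi> has_derivative (\<bullet>) 0) (at x)"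
      by (rule has_derivative_transform_eventually)
         (use * in \<open>auto simp: eventually_at_filter elim: eventually_mono dest: eventually_nhds_x_imp_x\<close>)
  qed
  obtain R where R: "closure {x. \<phi> x \<noteq> 0} \<subseteq> cball 0 R"
    using bounded_subset_ballD[OF compact_imp_bounded[OF \<phi>(2)], of 0] ball_subset_cball by blast
  show "\<exists>R. C1_compact \<phi> (grad_on UNIV \<phi>) R"
    by (intro exI[of _ R] C1_compact.intro smooth_has_derivative smooth_continuous_grad \<phi>)
       (use R closure_subset[of "{x. \<phi> x \<noteq> 0}"] in auto)
qed

lemma test_function_by_parts:
  assumes \<Omega>: "open \<Omega>" and \<phi>: "\<phi> \<in> test_functions \<Omega>" and \<theta>: "\<theta> \<in> test_functions \<Omega>"
  shows "(\<integral>x. \<phi> x * (grad_on UNIV \<theta> x $ i) \<partial>lebesgue_on \<Omega>) = - (\<integral>x. grad_on UNIV \<phi> x $ i * \<theta> x \<partial>lebesgue_on \<Omega>)"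
proof -
  obtain R where "C1_compact \<phi> (grad_on UNIV \<phi>) R" using test_functionD[OF \<phi>] by blast
  then interpret \<phi>: C1_compact \<phi> "grad_on UNIV \<phi>" R .
  obtain R' where "C1_compact \<theta> (grad_on UNIV \<theta>) R'" using test_functionD[OF \<theta>] by blast
  then interpret \<theta>: C1_compact \<theta> "grad_on UNIV \<theta>" R' .
  interpret prod: C1_compact "\<lambda>x. \<phi> x * \<theta> x" "\<lambda>x. \<phi> x *\<^sub>R grad_on UNIV \<theta> x + \<theta> x *\<^sub>R grad_on UNIV \<phi> x" R
  proof
    show "((\<lambda>x. \<phi> x * \<theta> x) has_derivative (\<bullet>) (\<phi> x *\<^sub>R grad_on UNIV \<theta> x + \<theta> x *\<^sub>R grad_on UNIV \<phi> x)) (at x)" for x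
      by (rule has_derivative_eq_rhs[OF has_derivative_mult[OF \<phi>.W \<theta>.W]]) (auto simp: inner_add_left)
    show "continuous_on UNIV (\<lambda>x. \<phi> x *\<^sub>R grad_on UNIV \<theta> x + \<theta> x *\<^sub>R grad_on UNIV \<phi> x)"
      by (intro continuous_intros \<phi>.W_continuous \<theta>.W_continuous \<phi>.g \<theta>.g)
    show "x \<notin> cball 0 R \<Longrightarrow> \<phi> x * \<theta> x = 0" for x using \<phi>.supp by auto
  qed
  have c: "continuous_on UNIV (\<lambda>x. \<phi> x * (grad_on UNIV \<theta> x $ i))" "continuous_on UNIV (\<lambda>x. grad_on UNIV \<phi> x $ i * \<theta> x)"
    by (intro continuous_intros \<phi>.W_continuous \<theta>.W_continuous \<phi>.g \<theta>.g)+
  have "(\<integral>x. \<phi> x * (grad_on UNIV \<theta> x $ i) \<partial>lborel) + (\<integral>x. grad_on UNIV \<phi> x $ i * \<theta> x \<partial>lborel)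
      = (\<integral>x. (\<phi> x *\<^sub>R grad_on UNIV \<theta> x + \<theta> x *\<^sub>R grad_on UNIV \<phi> x) \<bullet> axis i 1 \<partial>lborel)"
  proof (subst Bochner_Integration.integral_add[symmetric])
    show "integrable lborel (\<lambda>x. \<phi> x * (grad_on UNIV \<theta> x $ i))"
      by (rule integrable_compact_support[OF c(1), of R]) (use \<phi>.supp in auto)
    show "integrable lborel (\<lambda>x. grad_on UNIV \<phi> x $ i * \<theta> x)"
      by (rule integrable_compact_support[OF c(2), of R']) (use \<theta>.supp in auto)
  qed (simp add: inner_axis mult.commute)
  also have "\<dots> = 0" by (rule prod.integral_derivative_eq_0)
  finally show ?thesis
    using \<Omega> by (subst (1 2) integral_lebesgue_on_eq_lborel) (auto simp: borel_measurable_continuous_onI c test_functionD[OF \<phi>] test_functionD[OF \<theta>])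
qed

section \<open>Functions in \<open>H\<^sup>1\<^sub>0\<close> vanish on the boundary\<close>

lemma L2_bounded:
  assumes "f \<in> borel_measurable (lebesgue_on \<Omega>)" "\<Omega> \<in> lmeasurable" "\<And>x. x \<in> \<Omega> \<Longrightarrow> \<bar>f x\<bar> \<le> M"
  shows "f \<in> L2 \<Omega>"
proof -
  interpret finite_measure "lebesgue_on \<Omega>" using assms(2) by (rule finite_measure_lebesgue_on)
  have "integrable (lebesgue_on \<Omega>) (\<lambda>x. (f x)\<^sup>2)"
  proof (rule integrable_const_bound[of _ "M\<^sup>2"])
    show "AE x in lebesgue_on \<Omega>. norm ((f x)\<^sup>2) \<le> M\<^sup>2"
      by (rule AE_I2) (use power_mono[OF assms(3) abs_ge_zero, of _ 2] in auto)
  qed (use assms in measurable)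
  then show ?thesis using assms by (simp add: L2_def)
qed

lemma integrable_L2_diff:
  assumes "f \<in> L2 \<Omega>" "h \<in> L2 \<Omega>"
  shows "integrable (lebesgue_on \<Omega>) (\<lambda>x. (f x - h x)\<^sup>2)"
proof (rule Bochner_Integration.integrable_bound[of _ "\<lambda>x. 2 * (f x)\<^sup>2 + 2 * (h x)\<^sup>2"])
  show "integrable (lebesgue_on \<Omega>) (\<lambda>x. 2 * (f x)\<^sup>2 + 2 * (h x)\<^sup>2)"
    using assms by (auto simp: L2_def)
  have [measurable]: "f \<in> borel_measurable (lebesgue_on \<Omega>)" "h \<in> borel_measurable (lebesgue_on \<Omega>)"
    using assms by (auto simp: L2_def)
  show "(\<lambda>x. (f x - h x)\<^sup>2) \<in> borel_measurable (lebesgue_on \<Omega>)"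
    by measurable
  have "(a - b)\<^sup>2 \<le> 2 * a\<^sup>2 + 2 * b\<^sup>2" for a b :: real
    using zero_le_power2[of "a + b"] by (simp add: power2_eq_square algebra_simps)
  then show "AE x in lebesgue_on \<Omega>. norm ((f x - h x)\<^sup>2) \<le> norm (2 * (f x)\<^sup>2 + 2 * (h x)\<^sup>2)"
    by (intro AE_I2) (simp add: abs_of_nonneg)
qed

lemma norm_squared_real2: "(norm (x::real^2))\<^sup>2 = (x$1)\<^sup>2 + (x$2)\<^sup>2"
  unfolding power2_norm_eq_inner by (simp add: inner_vec_def sum_2 power2_eq_square)

lemma integrable_L2_vec_diff:
  assumes "\<And>i. (\<lambda>x. f x $ i) \<in> L2 \<Omega>" "\<And>i. (\<lambda>x. h x $ i) \<in> L2 \<Omega>"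
  shows "integrable (lebesgue_on \<Omega>) (\<lambda>x. (norm (f x - h x :: real^2))\<^sup>2)"
  unfolding norm_squared_real2 vector_minus_component
  by (intro Bochner_Integration.integrable_add integrable_L2_diff assms)

lemma test_function_L2:
  assumes \<Omega>: "open \<Omega>" "bounded \<Omega>" and \<phi>: "\<phi> \<in> test_functions \<Omega>"
  shows "\<phi> \<in> L2 \<Omega>" "(\<lambda>x. grad_on UNIV \<phi> x $ i) \<in> L2 \<Omega>"
proof -
  have m: "\<Omega> \<in> lmeasurable" using \<Omega> by (simp add: bounded_set_imp_lmeasurable borel_open)
  have *: "f \<in> L2 \<Omega>" if f: "continuous_on UNIV f" for f :: "real^2 \<Rightarrow> real"
  proof -
    have "compact (f ` closure \<Omega>)"
      by (intro compact_continuous_image continuous_on_subset[OF f]) (use \<Omega> in auto)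
    then obtain M where "\<And>x. x \<in> closure \<Omega> \<Longrightarrow> norm (f x) \<le> M"
      by (meson compact_imp_bounded bounded_iff imageI)
    then show ?thesis
      using closure_subset[of \<Omega>] by (intro L2_bounded[OF _ m, of f M] borel_measurable_lebesgue_on borel_measurable_continuous_onI f) auto
  qed
  show "\<phi> \<in> L2 \<Omega>" "(\<lambda>x. grad_on UNIV \<phi> x $ i) \<in> L2 \<Omega>"
    using test_functionD(1)[OF \<phi>] by (auto intro!: * smooth_continuous smooth_grad_component)
qed

text \<open>The set \<open>A\<close> lies in the part of \<open>\<Omega>\<close> that the translation by \<open>h\<close> moves out of \<open>\<Omega>\<close>, where test
  functions become zero. The square integral of an approximating test function over \<open>A\<close> is therefore
  at most its translation defect.\<close>
lemma H10_translation_bound: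
  assumes \<Omega>: "open \<Omega>" "bounded \<Omega>" and v: "v \<in> H10 \<Omega>"
  obtains C where "C \<ge> 0" "\<And>h A c. A \<in> sets lebesgue \<Longrightarrow> A \<subseteq> \<Omega> \<Longrightarrow> (\<And>y. y \<in> A \<Longrightarrow> y + h \<notin> \<Omega> \<and> c \<le> \<bar>v y\<bar>) \<Longrightarrow> c \<ge> 0 \<Longrightarrow>
      c\<^sup>2 * measure lebesgue A \<le> C * (norm h)\<^sup>2"
proof -
  let ?M = "lebesgue_on \<Omega>"
  obtain g \<phi> where vL: "v \<in> L2 \<Omega>" and gL: "\<And>i. (\<lambda>x. g x $ i) \<in> L2 \<Omega>"
    and \<phi>: "\<And>n. \<phi> n \<in> test_functions \<Omega>"
    and lim: "(\<lambda>n::nat. \<integral>x. (\<phi> n x - v x)\<^sup>2 + (norm (grad_on UNIV (\<phi> n) x - g x))\<^sup>2 \<partial>?M) \<longlonglongrightarrow> 0"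
    using v unfolding H10_def by blast
  define I where "I n = (\<integral>x. (\<phi> n x - v x)\<^sup>2 + (norm (grad_on UNIV (\<phi> n) x - g x))\<^sup>2 \<partial>?M)" for n
  \<comment> \<open>Twice the bound on the squared gradient norm of every approximation with error below one.\<close>
  define C where "C = 4 * (1 + (\<integral>x. (norm (g x))\<^sup>2 \<partial>?M))"
  note \<phi>L = test_function_L2[OF \<Omega> \<phi>]
  have Om: "\<Omega> \<in> sets lebesgue" using \<Omega> by (simp add: borel_open)
  have Oml: "\<Omega> \<in> lmeasurable" using \<Omega> by (simp add: bounded_set_imp_lmeasurable borel_open)
  have i1: "integrable ?M (\<lambda>x. (\<phi> n x - v x)\<^sup>2)" for n by (rule integrable_L2_diff[OF \<phi>L(1) vL])
  have i2: "integrable ?M (\<lambda>x. (norm (grad_on UNIV (\<phi> n) x - g x))\<^sup>2)" for n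
    by (rule integrable_L2_vec_diff[OF \<phi>L(2) gL])
  have z: "(\<lambda>x. (0::real)) \<in> L2 \<Omega>" by (simp add: L2_def)
  have i3: "integrable ?M (\<lambda>x. (norm (g x))\<^sup>2)"
    using integrable_L2_vec_diff[of g, OF gL, of "\<lambda>x. 0"] z by simp
  have i4: "integrable ?M (\<lambda>x. (norm (grad_on UNIV (\<phi> n) x))\<^sup>2)" for n
    using integrable_L2_vec_diff[OF \<phi>L(2), of "\<lambda>x. 0"] z by simp
  have "c\<^sup>2 * measure lebesgue A \<le> C * (norm h)\<^sup>2"
    if A: "A \<in> sets lebesgue" "A \<subseteq> \<Omega>" "\<And>y. y \<in> A \<Longrightarrow> y + h \<notin> \<Omega> \<and> c \<le> \<bar>v y\<bar>" and c: "c \<ge> 0" for h A c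
  proof (rule LIMSEQ_le_const)
    show "(\<lambda>n. C * (norm h)\<^sup>2 + 2 * I n) \<longlonglongrightarrow> C * (norm h)\<^sup>2"
      using tendsto_add[OF tendsto_const tendsto_mult[OF tendsto_const lim], of "C * (norm h)\<^sup>2" 2]
      unfolding I_def by simp
    have "\<forall>\<^sub>F n in sequentially. I n < 1" using lim unfolding I_def by (rule order_tendstoD) simp
    moreover have "c\<^sup>2 * measure lebesgue A \<le> C * (norm h)\<^sup>2 + 2 * I n" if In: "I n < 1" for n
    proof -
      obtain R where "C1_compact (\<phi> n) (grad_on UNIV (\<phi> n)) R" using test_functionD[OF \<phi>] by blast
      then interpret C1_compact "\<phi> n" "grad_on UNIV (\<phi> n)" R .
      have cW': "continuous_on UNIV (\<lambda>x. \<phi> n (x + c))" for c :: "real^2"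
        by (rule continuous_on_compose2[OF W_continuous[of UNIV]]) (auto intro!: continuous_intros)
      define D where "D x = (\<phi> n (x + h) - \<phi> n x)\<^sup>2" for x
      have cD: "continuous_on UNIV D" unfolding D_def by (intro continuous_intros W_continuous cW')
      have iD: "integrable lborel D"
      proof (rule integrable_compact_support[OF cD, of "R + norm h"])
        fix x :: "real^2" assume "x \<notin> cball 0 (R + norm h)"
        then have "\<phi> n (x + h) = 0" "\<phi> n x = 0"
          using norm_triangle_ineq2[of x "- h"] 
          by (auto intro!: supp) (use norm_ge_zero[of h] in linarith)+
        then show "D x = 0" by (simp add: D_def)
      qed
      then have "integrable lebesgue (\<lambda>x. indicator \<Omega> x *\<^sub>R D x)"
        by (intro integrable_mult_indicator Om) (simp add: integrable_completion borel_measurable_continuous_onI cD)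
      then have iD': "integrable ?M D"
        by (simp add: integrable_restrict_space Om)
      have grad_le: "(\<integral>x. (norm (grad_on UNIV (\<phi> n) x))\<^sup>2 \<partial>?M) \<le> C / 2"
      proof -
        have "(\<integral>x. (norm (grad_on UNIV (\<phi> n) x))\<^sup>2 \<partial>?M)
            \<le> (\<integral>x. 2 * ((\<phi> n x - v x)\<^sup>2 + (norm (grad_on UNIV (\<phi> n) x - g x))\<^sup>2) + 2 * (norm (g x))\<^sup>2 \<partial>?M)"
        proof (rule integral_mono)
          show "(norm (grad_on UNIV (\<phi> n) x))\<^sup>2 \<le> 2 * ((\<phi> n x - v x)\<^sup>2 + (norm (grad_on UNIV (\<phi> n) x - g x))\<^sup>2) + 2 * (norm (g x))\<^sup>2" for x
          proof -
            have "(norm (grad_on UNIV (\<phi> n) x))\<^sup>2 \<le> (norm (grad_on UNIV (\<phi> n) x - g x) + norm (g x))\<^sup>2"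
              by (intro power_mono) (use norm_triangle_ineq[of "grad_on UNIV (\<phi> n) x - g x" "g x"] in auto)
            also have "\<dots> \<le> 2 * (norm (grad_on UNIV (\<phi> n) x - g x))\<^sup>2 + 2 * (norm (g x))\<^sup>2"
              using zero_le_power2[of "norm (grad_on UNIV (\<phi> n) x - g x) - norm (g x)"]
              by (simp add: power2_eq_square algebra_simps)
            also have "\<dots> \<le> 2 * ((\<phi> n x - v x)\<^sup>2 + (norm (grad_on UNIV (\<phi> n) x - g x))\<^sup>2) + 2 * (norm (g x))\<^sup>2"
              by simp
            finally show ?thesis .
          qed
        qed (intro Bochner_Integration.integrable_add integrable_mult_right i1 i2 i3 i4)+
        also have "\<dots> = 2 * I n + 2 * (\<integral>x. (norm (g x))\<^sup>2 \<partial>?M)"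
          unfolding I_def using i1 i2 i3 by simp
        finally show ?thesis using In by (simp add: C_def)
      qed
      have D_le: "(\<integral>x. D x \<partial>?M) \<le> C / 2 * (norm h)\<^sup>2"
      proof -
        have "(\<integral>x. D x \<partial>?M) = (\<integral>x. indicator \<Omega> x *\<^sub>R D x \<partial>lborel)"
        proof -
          have "(\<lambda>x. indicator \<Omega> x *\<^sub>R D x) \<in> borel_measurable lborel"
          proof -
            have [measurable]: "\<Omega> \<in> sets borel" "D \<in> borel_measurable borel"
              using \<Omega> cD by (simp_all add: borel_open borel_measurable_continuous_onI)
            show ?thesis by measurable
          qed
          from integral_completion[OF this] show ?thesis
            by (subst integral_restrict_space) (auto simp: Om)
        qed
        also have "\<dots> \<le> (\<integral>x. D x \<partial>lborel)"
        proof (rule integral_mono[OF integrable_mult_indicator[OF _ iD] iD])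
          show "\<Omega> \<in> sets lborel" using \<Omega> by (simp add: borel_open)
          show "indicator \<Omega> x *\<^sub>R D x \<le> D x" for x by (auto simp: indicator_def D_def)
        qed
        also have "\<dots> \<le> (\<integral>x. (grad_on UNIV (\<phi> n) x \<bullet> h)\<^sup>2 \<partial>lborel)"
          unfolding D_def by (rule integral_translation_le)
        also have "\<dots> = (\<integral>x. (grad_on UNIV (\<phi> n) x \<bullet> h)\<^sup>2 \<partial>?M)"
          by (rule integral_lebesgue_on_eq_lborel[symmetric, OF \<Omega>(1)])
             (auto intro!: borel_measurable_continuous_onI continuous_intros g simp: test_functionD[OF \<phi>])
        also have "\<dots> \<le> (\<integral>x. (norm (grad_on UNIV (\<phi> n) x))\<^sup>2 * (norm h)\<^sup>2 \<partial>?M)"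
        proof (rule integral_mono_AE')
          show "AE x in ?M. (grad_on UNIV (\<phi> n) x \<bullet> h)\<^sup>2 \<le> (norm (grad_on UNIV (\<phi> n) x))\<^sup>2 * (norm h)\<^sup>2"
            by (intro AE_I2) (metis Cauchy_Schwarz_ineq power2_norm_eq_inner)
        qed (use i4 in auto)
        also have "\<dots> = (\<integral>x. (norm (grad_on UNIV (\<phi> n) x))\<^sup>2 \<partial>?M) * (norm h)\<^sup>2" by simp
        also have "\<dots> \<le> C / 2 * (norm h)\<^sup>2" by (rule mult_right_mono[OF grad_le]) simp
        finally show ?thesis .
      qed
      have A': "A \<in> sets ?M" using A(1,2) Om by (simp add: sets_restrict_space_iff)
      interpret finite_measure ?M using Oml by (rule finite_measure_lebesgue_on)
      have "c\<^sup>2 * measure lebesgue A = (\<integral>x. c\<^sup>2 * indicator A x \<partial>?M)"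
        using A' A(2) Om by (simp add: measure_restrict_space Int_absorb2)
      also have "\<dots> \<le> (\<integral>x. 2 * D x + 2 * ((\<phi> n x - v x)\<^sup>2 + (norm (grad_on UNIV (\<phi> n) x - g x))\<^sup>2) \<partial>?M)"
      proof (rule integral_mono)
        show "integrable ?M (\<lambda>x. c\<^sup>2 * indicator A x)"
          using A' by (intro integrable_mult_right) (simp add: emeasure_finite less_top[symmetric])
        fix x
        show "c\<^sup>2 * indicator A x \<le> 2 * D x + 2 * ((\<phi> n x - v x)\<^sup>2 + (norm (grad_on UNIV (\<phi> n) x - g x))\<^sup>2)"
        proof (cases "x \<in> A")
          case True
          then have "\<phi> n (x + h) = 0" using A(3) test_functionD(2)[OF \<phi>] by blast
          then have "D x = (\<phi> n x)\<^sup>2" by (simp add: D_def)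
          moreover have "c\<^sup>2 \<le> (v x)\<^sup>2" using A(3)[OF True] c power_mono[of c "\<bar>v x\<bar>" 2] by simp
          moreover have "(v x)\<^sup>2 \<le> 2 * (\<phi> n x)\<^sup>2 + 2 * (\<phi> n x - v x)\<^sup>2"
            using zero_le_power2[of "2 * \<phi> n x - v x"] by (simp add: power2_eq_square algebra_simps)
          ultimately have "c\<^sup>2 \<le> 2 * D x + 2 * (\<phi> n x - v x)\<^sup>2" by simp
          also have "\<dots> \<le> 2 * D x + 2 * ((\<phi> n x - v x)\<^sup>2 + (norm (grad_on UNIV (\<phi> n) x - g x))\<^sup>2)" by simp
          finally show ?thesis using True by simp
        qed (simp add: D_def)
      qed (intro Bochner_Integration.integrable_add integrable_mult_right i1 i2 iD')
      also have "\<dots> = 2 * (\<integral>x. D x \<partial>?M) + 2 * I n"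
        unfolding I_def using i1 i2 iD' by simp
      finally show ?thesis using D_le by simp
    qed
    ultimately show "\<exists>N. \<forall>n\<ge>N. c\<^sup>2 * measure lebesgue A \<le> C * (norm h)\<^sup>2 + 2 * I n"
      by (auto simp: eventually_sequentially)
  qed
  note main = this
  have "C \<ge> 0" by (simp add: C_def)
  then show thesis using main by (rule that)
qed

text \<open>If \<open>v\<close> did not vanish at \<open>x0\<close>, a ball \<open>Q \<subseteq> \<Omega>\<close> could be moved across the boundary in \<open>N\<close> steps \<open>h = u / N\<close>
  inside a neighbourhood on which \<open>\<bar>v\<bar> \<ge> c\<close>. Each of its points leaves \<open>\<Omega>\<close> in one of the steps, so
  \<open>N\<close> translates of the shell \<open>A\<close> of the previous lemma cover \<open>Q\<close>. Then \<open>A\<close> has measure at least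
  \<open>\<bar>Q\<bar> / N\<close>, but also at most a constant times \<open>1 / N\<^sup>2\<close>.\<close>
lemma H10_zero_on_frontier:
  assumes \<Omega>: "open \<Omega>" "bounded \<Omega>" and v: "v \<in> H10 \<Omega>" and cont: "continuous_on (closure \<Omega>) v"
    and x0: "x0 \<in> frontier \<Omega>" "x0 \<in> closure (- closure \<Omega>)"
  shows "v x0 = 0"
proof (rule ccontr)
  assume nz: "v x0 \<noteq> 0"
  define c where "c = \<bar>v x0\<bar> / 2"
  have c: "c > 0" using nz by (simp add: c_def)
  have x0': "x0 \<in> closure \<Omega>" using x0 by (simp add: frontier_def)
  obtain \<rho> where \<rho>: "\<rho> > 0" "\<And>y. y \<in> closure \<Omega> \<Longrightarrow> dist y x0 < \<rho> \<Longrightarrow> dist (v y) (v x0) < c"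
    using cont x0' c unfolding continuous_on_iff by metis
  have big: "c \<le> \<bar>v y\<bar>" if "y \<in> \<Omega>" "y \<in> ball x0 \<rho>" for y
    using \<rho>(2)[OF subsetD[OF closure_subset that(1)]] that(2) abs_triangle_ineq2[of "v x0" "v y"]
    by (simp add: c_def dist_real_def dist_commute abs_minus_commute)
  obtain q where q: "q \<in> \<Omega>" "q \<in> ball x0 \<rho>"
    using x0' \<rho>(1) by (auto simp: closure_approachable dist_commute)
  obtain p where p: "p \<in> - closure \<Omega>" "p \<in> ball x0 \<rho>"
    using x0(2) \<rho>(1) unfolding closure_approachable by (metis dist_commute mem_ball)
  obtain d1 where d1: "d1 > 0" "ball q d1 \<subseteq> \<Omega> \<inter> ball x0 \<rho>"
    using q \<Omega> by (metis IntI open_Int open_ball open_contains_ball)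
  obtain d2 where d2: "d2 > 0" "ball p d2 \<subseteq> - closure \<Omega> \<inter> ball x0 \<rho>"
    using p by (metis IntI open_Int open_ball open_contains_ball open_Compl closed_closure)
  define d where "d = min d1 d2"
  define Q where "Q = ball q d"
  have Q: "Q \<subseteq> \<Omega> \<inter> ball x0 \<rho>" using d1(2) by (auto simp: Q_def d_def)
  define u where "u = p - q"
  have Qu: "x + u \<in> ball x0 \<rho> \<and> x + u \<notin> \<Omega>" if "x \<in> Q" for x
  proof -
    have "x + u \<in> ball p d2" using that by (simp add: Q_def u_def d_def dist_norm algebra_simps)
    then show ?thesis using d2(2) closure_subset[of \<Omega>] by blast
  qed
  obtain C where C: "C \<ge> 0" "\<And>h A c. A \<in> sets lebesgue \<Longrightarrow> A \<subseteq> \<Omega> \<Longrightarrow> (\<And>y. y \<in> A \<Longrightarrow> y + h \<notin> \<Omega> \<and> c \<le> \<bar>v y\<bar>) \<Longrightarrow> c \<ge> 0 \<Longrightarrow>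
      c\<^sup>2 * measure lebesgue A \<le> C * (norm h)\<^sup>2"
    using H10_translation_bound[OF \<Omega> v] by metis
  define mQ where "mQ = measure lebesgue Q"
  have mQ: "mQ > 0"
    unfolding mQ_def Q_def using content_ball_pos[of d q] d1(1) d2(1) by (simp add: d_def)
  have key: "c\<^sup>2 * mQ * real N \<le> C * (norm u)\<^sup>2" if N: "N > 0" for N :: nat
  proof -
    define h where "h = (1 / real N) *\<^sub>R u"
    define A where "A = {y \<in> \<Omega> \<inter> ball x0 \<rho>. y + h \<notin> \<Omega>}"
    have "A = (\<Omega> \<inter> ball x0 \<rho>) \<inter> ((\<lambda>y. y + h) -` (- \<Omega>))" by (auto simp: A_def)
    moreover have "closed ((\<lambda>y. y + h) -` (- \<Omega>))"
      by (rule closed_vimage) (use \<Omega> in \<open>auto intro!: continuous_intros\<close>)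
    ultimately have "A \<in> sets borel" using \<Omega> by (auto intro!: sets.Int borel_open borel_closed)
    then have Am: "A \<in> sets lebesgue" by simp
    have Al: "A \<in> lmeasurable"
      by (rule bounded_set_imp_lmeasurable[OF bounded_subset[OF \<Omega>(2)] Am]) (auto simp: A_def)
    have cover: "Q \<subseteq> (\<Union>k<N. (+) (- (real k *\<^sub>R h)) ` A)"
    proof
      fix x assume x: "x \<in> Q"
      let ?P = "\<lambda>k. x + real k *\<^sub>R h \<notin> \<Omega>"
      have PN: "?P N" using Qu[OF x] N by (simp add: h_def)
      define m where "m = (LEAST k. ?P k)"
      have m: "?P m" "m \<le> N" unfolding m_def by (rule LeastI[of ?P, OF PN]) (rule Least_le[of ?P, OF PN])
      have "m \<noteq> 0"
      proof
        assume "m = 0" then show False using m(1) x Q by auto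
      qed
      then obtain k where k: "m = Suc k" by (cases m) auto
      have kin: "x + real k *\<^sub>R h \<in> \<Omega>" using not_less_Least[of k ?P] k unfolding m_def[symmetric] by auto
      have "x + real k *\<^sub>R h = (1 - real k / real N) *\<^sub>R x + (real k / real N) *\<^sub>R (x + u)"
        by (simp add: h_def algebra_simps)
      moreover have "\<dots> \<in> ball x0 \<rho>"
        by (rule convexD[OF convex_ball]) (use Qu[OF x] x Q m k in \<open>auto simp: field_simps\<close>)
      ultimately have "x + real k *\<^sub>R h \<in> A"
        using kin m(1) by (auto simp: A_def k algebra_simps)
      then have "x \<in> (+) (- (real k *\<^sub>R h)) ` A" by (rule image_eqI[rotated]) simp
      then show "x \<in> (\<Union>k<N. (+) (- (real k *\<^sub>R h)) ` A)" using k m by auto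
    qed
    have tl: "(+) a ` A \<in> lmeasurable" for a using Al by (rule measurable_translation)
    have "mQ \<le> measure lebesgue (\<Union>k<N. (+) (- (real k *\<^sub>R h)) ` A)"
      unfolding mQ_def
    proof (rule measure_mono_fmeasurable[OF cover])
      show "Q \<in> sets lebesgue" by (simp add: Q_def)
      show "(\<Union>k<N. (+) (- (real k *\<^sub>R h)) ` A) \<in> lmeasurable"
        by (rule fmeasurable.finite_UN) (use tl in blast)+
    qed
    also have "\<dots> \<le> (\<Sum>k<N. measure lebesgue ((+) (- (real k *\<^sub>R h)) ` A))"
      by (rule measure_UNION_le) (use fmeasurableD[OF tl] in blast)+
    also have "\<dots> = real N * measure lebesgue A" by (simp add: measure_translation measure_translation_subtract)
    finally have 1: "mQ \<le> real N * measure lebesgue A" .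
    have "c\<^sup>2 * measure lebesgue A \<le> C * (norm h)\<^sup>2"
      by (rule C(2)[OF Am]) (use big c in \<open>auto simp: A_def\<close>)
    also have "\<dots> = C * (norm u)\<^sup>2 / (real N)\<^sup>2" by (simp add: h_def power_divide)
    finally have 2: "c\<^sup>2 * measure lebesgue A * (real N)\<^sup>2 \<le> C * (norm u)\<^sup>2"
      using N by (simp add: field_simps)
    have "c\<^sup>2 * mQ * real N \<le> c\<^sup>2 * (real N * measure lebesgue A) * real N"
      using 1 by (intro mult_right_mono mult_left_mono) auto
    with 2 show ?thesis by (simp add: power2_eq_square mult_ac)
  qed
  have pos: "c\<^sup>2 * mQ > 0" using c mQ by simp
  obtain N :: nat where "C * (norm u)\<^sup>2 / (c\<^sup>2 * mQ) < real N" using reals_Archimedean2 by blast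
  then have "C * (norm u)\<^sup>2 < real N * (c\<^sup>2 * mQ)" using pos by (simp add: pos_divide_less_eq)
  moreover have "0 \<le> C * (norm u)\<^sup>2" using C(1) by simp
  with calculation have "N > 0" by (cases N) auto
  ultimately show False using key[of N] by (simp add: mult_ac)
qed

section \<open>Lipschitz functions with zero boundary values lie in \<open>H\<^sup>1\<^sub>0\<close>\<close>

text \<open>The cutoff is \<open>0\<close> up to the distance \<open>2 * e\<close> from the complement and \<open>1\<close> from the distance \<open>3 * e\<close> on.
  This leaves room for a mollification of radius \<open>e\<close>.\<close>
definition cutoff :: "(real^2) set \<Rightarrow> real \<Rightarrow> real^2 \<Rightarrow> real" where
  "cutoff \<Omega> e x = max 0 (min 1 (infdist x (- \<Omega>) / e - 2))"

lemma cutoff_range: "0 \<le> cutoff \<Omega> e x" "cutoff \<Omega> e x \<le> 1"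
  by (auto simp: cutoff_def)

lemma cutoff_lipschitz:
  assumes "e > 0"
  shows "\<bar>cutoff \<Omega> e x - cutoff \<Omega> e y\<bar> \<le> dist x y / e"
proof -
  have "\<bar>cutoff \<Omega> e x - cutoff \<Omega> e y\<bar> \<le> \<bar>infdist x (- \<Omega>) / e - infdist y (- \<Omega>) / e\<bar>"
    by (auto simp: cutoff_def max_def min_def)
  also have "\<dots> = \<bar>infdist x (- \<Omega>) - infdist y (- \<Omega>)\<bar> / e"
    using assms by (simp add: abs_divide flip: diff_divide_distrib)
  also have "\<dots> \<le> dist x y / e"
    using assms by (intro divide_right_mono infdist_triangle_abs) auto
  finally show ?thesis .
qed

lemma cutoff_eq_0: "e > 0 \<Longrightarrow> infdist x (- \<Omega>) \<le> 2 * e \<Longrightarrow> cutoff \<Omega> e x = 0"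
  by (simp add: cutoff_def field_simps)

lemma cutoff_eq_1: "e > 0 \<Longrightarrow> infdist x (- \<Omega>) \<ge> 3 * e \<Longrightarrow> cutoff \<Omega> e x = 1"
  by (simp add: cutoff_def field_simps)

locale zero_trace_lipschitz =
  fixes \<Omega> :: "(real^2) set" and v :: "real^2 \<Rightarrow> real" and L :: real
  assumes \<Omega>: "open \<Omega>" "bounded \<Omega>"
    and lip: "L-lipschitz_on UNIV v" and zero: "\<And>x. x \<notin> \<Omega> \<Longrightarrow> v x = 0"
begin

lemma L_nonneg: "L \<ge> 0" using lip by (rule lipschitz_on_nonneg)

lemma lip': "\<bar>v x - v y\<bar> \<le> L * dist x y"
  using lipschitz_onD[OF lip, of x y] by (simp add: dist_real_def)

lemma Compl_nonempty: "- \<Omega> \<noteq> {}"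
  using \<Omega>(2) not_bounded_UNIV[where 'a = "real^2"] by (metis Compl_empty_eq double_complement)

lemma v_le: "\<bar>v x\<bar> \<le> L * infdist x (- \<Omega>)"
proof -
  obtain y where y: "y \<in> - \<Omega>" "infdist x (- \<Omega>) = dist x y"
    using infdist_attains_inf[of "- \<Omega>" x] Compl_nonempty \<Omega> by auto
  then show ?thesis using lip'[of x y] zero[of y] by simp
qed

definition u :: "real \<Rightarrow> real^2 \<Rightarrow> real" where
  "u e x = cutoff \<Omega> e x * v x"

text \<open>The Lipschitz constant of the cutoff is \<open>1 / e\<close>, but it varies only where the distance to the
  complement, and with it \<open>\<bar>v\<bar> / L\<close>, is at most \<open>3 * e\<close>. So the constant of the product does not
  depend on \<open>e\<close>.\<close>
lemma u_lipschitz: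
  assumes e: "e > 0" shows "\<bar>u e x - u e y\<bar> \<le> 4 * L * dist x y"
proof -
  let ?\<rho> = "cutoff \<Omega> e"
  have near: "\<bar>u e x - u e y\<bar> \<le> 4 * L * dist x y" if "infdist y (- \<Omega>) \<le> 3 * e" for x y
  proof -
    have "u e x - u e y = ?\<rho> x * (v x - v y) + v y * (?\<rho> x - ?\<rho> y)"
      by (simp add: u_def algebra_simps)
    then have "\<bar>u e x - u e y\<bar> \<le> \<bar>?\<rho> x\<bar> * \<bar>v x - v y\<bar> + \<bar>v y\<bar> * \<bar>?\<rho> x - ?\<rho> y\<bar>"
      by (metis abs_mult abs_triangle_ineq)
    also have "\<bar>?\<rho> x\<bar> * \<bar>v x - v y\<bar> \<le> 1 * (L * dist x y)"
      by (intro mult_mono lip') (use cutoff_range[of \<Omega> e x] in auto)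
    also have "\<bar>v y\<bar> * \<bar>?\<rho> x - ?\<rho> y\<bar> \<le> (L * (3 * e)) * (dist x y / e)"
    proof (intro mult_mono cutoff_lipschitz e)
      show "\<bar>v y\<bar> \<le> L * (3 * e)"
        using v_le[of y] mult_left_mono[OF that L_nonneg] by linarith
    qed (use L_nonneg e in auto)
    finally show ?thesis using e by simp
  qed
  consider "infdist y (- \<Omega>) \<le> 3 * e" | "infdist x (- \<Omega>) \<le> 3 * e" | "infdist y (- \<Omega>) \<ge> 3 * e" "infdist x (- \<Omega>) \<ge> 3 * e"
    by linarith
  then show ?thesis
  proof cases
    case 1 then show ?thesis by (rule near)
  next
    case 2 from near[OF this, of y] show ?thesis by (simp add: dist_commute abs_minus_commute)
  next
    case 3
    then have "\<bar>u e x - u e y\<bar> = \<bar>v x - v y\<bar>" by (simp add: u_def cutoff_eq_1[OF e])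
    also have "\<dots> \<le> L * dist x y" by (rule lip')
    also have "\<dots> \<le> 4 * L * dist x y" using L_nonneg by (intro mult_right_mono) auto
    finally show ?thesis .
  qed
qed

lemma cont_u: "e > 0 \<Longrightarrow> continuous_on A (u e)"
  by (rule lipschitz_on_continuous_on[of "4 * L"]) (auto intro!: lipschitz_onI u_lipschitz simp: dist_real_def L_nonneg)

definition \<phi> :: "nat \<Rightarrow> real^2 \<Rightarrow> real" where
  "\<phi> n = mollify (1 / real (Suc n)) (u (1 / real (Suc n)))"

lemma smooth_\<phi>: "smooth (\<phi> n)"
proof -
  obtain a b where "\<Omega> \<subseteq> cbox a b" using \<Omega>(2) bounded_subset_cbox_symmetric by metis
  then show ?thesis
    unfolding \<phi>_def by (intro smooth_mollify[of _ _ a b] cont_u) (auto simp: u_def intro!: zero)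
qed

lemma \<phi>_test: "\<phi> n \<in> test_functions \<Omega>"
proof -
  define e where "e = 1 / real (Suc n)"
  have e: "e > 0" by (simp add: e_def)
  let ?K = "{x. infdist x (- \<Omega>) \<ge> e}"
  have K: "closed ?K" by (intro closed_Collect_le continuous_intros)
  have KO: "?K \<subseteq> \<Omega>"
  proof
    fix x assume "x \<in> ?K"
    then show "x \<in> \<Omega>" using e by (cases "x \<in> \<Omega>") auto
  qed
  have "{x. \<phi> n x \<noteq> 0} \<subseteq> ?K"
  proof
    fix x assume x: "x \<in> {x. \<phi> n x \<noteq> 0}"
    show "x \<in> ?K"
    proof (rule ccontr)
      assume "x \<notin> ?K"
      have "\<bar>mollify e (u e) x - 0\<bar> \<le> 0"
      proof (rule mollify_near[OF e cont_u[OF e]])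
        fix y assume "dist y x < e"
        then have "infdist y (- \<Omega>) \<le> 2 * e"
          using infdist_triangle[of y "- \<Omega>" x] \<open>x \<notin> ?K\<close> by simp
        then show "\<bar>u e y - 0\<bar> \<le> 0" by (simp add: u_def cutoff_eq_0[OF e])
      qed
      then show False using x by (simp add: \<phi>_def e_def)
    qed
  qed
  then have cl: "closure {x. \<phi> n x \<noteq> 0} \<subseteq> ?K" using K by (rule closure_minimal)
  moreover have "compact (closure {x. \<phi> n x \<noteq> 0})"
    using cl KO \<Omega>(2) by (meson bounded_subset compact_eq_bounded_closed closed_closure)
  ultimately show ?thesis
    using smooth_\<phi> KO by (auto simp: test_functions_def smooth_def)
qed

lemma v_bounded: obtains M where "M \<ge> 0" "\<And>x. \<bar>v x\<bar> \<le> M"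
proof -
  have "compact (v ` closure \<Omega>)"
    using \<Omega>(2) by (intro compact_continuous_image continuous_on_subset[OF lipschitz_on_continuous_on[OF lip]]) auto
  then have "bounded (v ` closure \<Omega>)" by (rule compact_imp_bounded)
  then obtain M where M: "M > 0" "\<And>x. x \<in> closure \<Omega> \<Longrightarrow> norm (v x) \<le> M"
    unfolding bounded_pos by blast
  then have "\<bar>v x\<bar> \<le> M" for x using zero[of x] closure_subset[of \<Omega>] by (cases "x \<in> \<Omega>") auto
  then show thesis using that[of M] M by simp
qed

lemma \<phi>_bound:
  assumes M: "\<And>x. \<bar>v x\<bar> \<le> M" shows "\<bar>\<phi> n x\<bar> \<le> M"
proof -
  have "\<bar>mollify (1 / real (Suc n)) (u (1 / real (Suc n))) x - 0\<bar> \<le> M"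
  proof (rule mollify_near)
    fix y
    have "\<bar>u (1 / real (Suc n)) y\<bar> = cutoff \<Omega> (1 / real (Suc n)) y * \<bar>v y\<bar>"
      using cutoff_range(1) by (simp add: u_def abs_mult)
    also have "\<dots> \<le> 1 * M" using M cutoff_range by (intro mult_mono) auto
    finally show "\<bar>u (1 / real (Suc n)) y - 0\<bar> \<le> M" by simp
  qed (auto intro!: cont_u)
  then show ?thesis by (simp add: \<phi>_def)
qed

lemma grad_\<phi>_bound: "norm (grad_on UNIV (\<phi> n) x) \<le> 4 * L"
proof -
  have "norm (grad_on UNIV (\<phi> n) x - 0) \<le> 4 * L"
  proof (rule norm_grad_diff_le[OF smooth_has_derivative[OF smooth_\<phi>]], intro always_eventually allI)
    fix y
    have "\<bar>\<phi> n y - \<phi> n x - 0\<bar> \<le> 4 * L * dist y x"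
      unfolding \<phi>_def
    proof (rule mollify_increment)
      fix z
      show "\<bar>u (1 / real (Suc n)) (y - z) - u (1 / real (Suc n)) (x - z) - 0\<bar> \<le> 4 * L * dist y x"
        using u_lipschitz[of "1 / real (Suc n)" "y - z" "x - z"] by (simp add: dist_norm)
    qed (auto intro!: cont_u)
    then show "\<bar>\<phi> n y - \<phi> n x - 0 \<bullet> (y - x)\<bar> \<le> 4 * L * dist y x" by simp
  qed
  then show ?thesis by simp
qed

lemma small_index: "r > 0 \<Longrightarrow> \<forall>\<^sub>F n in sequentially. 1 / real (Suc n) < r"
  using order_tendstoD(2)[OF LIMSEQ_inverse_real_of_nat, of r] by (simp add: inverse_eq_divide)

lemma infdist_ball:
  assumes "ball x (5 * r) \<subseteq> \<Omega>" "dist y x \<le> 2 * r"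
  shows "infdist y (- \<Omega>) \<ge> 3 * r"
proof -
  obtain z where z: "z \<in> - \<Omega>" "infdist y (- \<Omega>) = dist y z"
    using infdist_attains_inf[of "- \<Omega>" y] Compl_nonempty \<Omega> by auto
  then have "dist x z \<ge> 5 * r" using assms(1) by (auto simp: subset_iff not_less[symmetric])
  then show ?thesis using z(2) assms(2) dist_triangle[of x z y] by (simp add: dist_commute)
qed

lemma u_eq_v:
  assumes "ball x (5 * r) \<subseteq> \<Omega>" "dist y x \<le> 2 * r" "0 < e" "e \<le> r"
  shows "u e y = v y"
  using infdist_ball[OF assms(1,2)] assms(3,4) by (simp add: u_def cutoff_eq_1)

lemma \<phi>_tendsto:
  assumes x: "x \<in> \<Omega>" shows "(\<lambda>n. \<phi> n x) \<longlonglongrightarrow> v x"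
proof -
  obtain r0 where r0: "r0 > 0" "ball x r0 \<subseteq> \<Omega>" using \<Omega>(1) x open_contains_ball by blast
  define r where "r = r0 / 5"
  have r: "r > 0" "ball x (5 * r) \<subseteq> \<Omega>" using r0 by (auto simp: r_def)
  have A: "\<forall>\<^sub>F n in sequentially. \<bar>\<phi> n x - v x\<bar> \<le> L * (1 / real (Suc n))"
    using small_index[OF r(1)]
  proof eventually_elim
    case (elim n)
    define e where "e = 1 / real (Suc n)"
    have e: "e > 0" "e < r" using elim by (auto simp: e_def)
    have "\<bar>mollify e (u e) x - v x\<bar> \<le> L * e"
    proof (rule mollify_near[OF e(1) cont_u[OF e(1)]])
      fix y assume y: "dist y x < e"
      then have "u e y = v y" using e r(1) by (intro u_eq_v[OF r(2)]) auto
      then show "\<bar>u e y - v x\<bar> \<le> L * e"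
        using lip'[of y x] mult_left_mono[OF less_imp_le[OF y] L_nonneg] by simp
    qed
    then show ?case by (simp add: \<phi>_def e_def)
  qed
  have B: "(\<lambda>n. L * (1 / real (Suc n))) \<longlonglongrightarrow> 0"
    using tendsto_mult[OF tendsto_const LIMSEQ_inverse_real_of_nat, of L] by (simp add: inverse_eq_divide)
  have "(\<lambda>n. \<phi> n x - v x) \<longlonglongrightarrow> 0"
    by (rule Lim_null_comparison[OF _ B]) (use A in \<open>simp only: real_norm_def\<close>)
  then show ?thesis by (simp add: LIM_zero_iff)
qed

lemma grad_\<phi>_tendsto:
  assumes U: "open U" "U \<subseteq> \<Omega>" and x: "x \<in> U"
    and g: "\<And>x. x \<in> U \<Longrightarrow> (v has_derivative (\<bullet>) (g x)) (at x)" "continuous_on U g"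
  shows "(\<lambda>n. grad_on UNIV (\<phi> n) x) \<longlonglongrightarrow> g x"
  unfolding tendsto_iff dist_norm
proof (intro allI impI)
  fix \<eta>' :: real assume "\<eta>' > 0"
  define \<eta> where "\<eta> = \<eta>' / 2"
  have \<eta>: "\<eta> > 0" "\<eta> < \<eta>'" using \<open>\<eta>' > 0\<close> by (auto simp: \<eta>_def)
  obtain r1 where r1: "r1 > 0" "ball x r1 \<subseteq> U" using U(1) x open_contains_ball by blast
  have "isCont g x" using g(2) U(1) x by (simp add: continuous_on_eq_continuous_at)
  then obtain r2 where r2: "r2 > 0" "\<And>y. dist y x < r2 \<Longrightarrow> dist (g y) (g x) < \<eta>"
    using \<eta>(1) unfolding continuous_at_eps_delta by blast
  define r where "r = min r1 r2 / 5"
  have r: "r > 0" "ball x (5 * r) \<subseteq> U" "\<And>y. dist y x < 5 * r \<Longrightarrow> dist (g y) (g x) < \<eta>"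
    using r1 r2 by (auto simp: r_def)
  have inc: "\<bar>v z - v y - g x \<bullet> (z - y)\<bar> \<le> \<eta> * dist z y" if "z \<in> ball x (5*r)" "y \<in> ball x (5*r)" for y z
  proof -
    have "norm ((v z - g x \<bullet> z) - (v y - g x \<bullet> y)) \<le> \<eta> * norm (z - y)"
    proof (rule differentiable_bound[OF convex_ball])
      fix w assume w: "w \<in> ball x (5*r)"
      have "((\<lambda>z. v z - g x \<bullet> z) has_derivative (\<lambda>h. g w \<bullet> h - g x \<bullet> h)) (at w)"
        by (intro has_derivative_diff bounded_linear_imp_has_derivative bounded_linear_inner_right g(1))
           (use r(2) w in blast)
      then show "((\<lambda>z. v z - g x \<bullet> z) has_derivative (\<lambda>h. g w \<bullet> h - g x \<bullet> h)) (at w within ball x (5*r))"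
        by (rule has_derivative_at_withinI)
      show "onorm (\<lambda>h. g w \<bullet> h - g x \<bullet> h) \<le> \<eta>"
      proof (rule onorm_bound)
        show "norm (g w \<bullet> h - g x \<bullet> h) \<le> \<eta> * norm h" for h
          using Cauchy_Schwarz_ineq2[of "g w - g x" h] r(3)[of w] w
            mult_right_mono[of "norm (g w - g x)" \<eta> "norm h"]
          by (simp add: inner_diff_left dist_norm norm_minus_commute)
      qed (use \<eta> in simp)
    qed (use that in auto)
    then show ?thesis by (simp add: dist_norm inner_diff_right algebra_simps)
  qed
  show "\<forall>\<^sub>F n in sequentially. norm (grad_on UNIV (\<phi> n) x - g x) < \<eta>'"
    using small_index[OF r(1)]
  proof eventually_elim
    case (elim n)
    define e where "e = 1 / real (Suc n)"
    have e: "e > 0" "e < r" using elim by (auto simp: e_def)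
    have "norm (grad_on UNIV (\<phi> n) x - g x) \<le> \<eta>"
    proof (rule norm_grad_diff_le[OF smooth_has_derivative[OF smooth_\<phi>]])
      have "\<forall>\<^sub>F z in nhds x. z \<in> ball x r" by (rule eventually_nhds_in_open) (use r in auto)
      then show "\<forall>\<^sub>F z in at x. \<bar>\<phi> n z - \<phi> n x - g x \<bullet> (z - x)\<bar> \<le> \<eta> * dist z x"
        unfolding eventually_at_filter
      proof eventually_elim
        case (elim z)
        have "\<bar>mollify e (u e) z - mollify e (u e) x - g x \<bullet> (z - x)\<bar> \<le> \<eta> * dist z x"
        proof (rule mollify_increment[OF e(1) cont_u[OF e(1)]])
          fix y :: "real^2" assume y: "norm y < e"
          have d: "dist (z - y) x < 2 * r" "dist (x - y) x < 2 * r"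
            using elim y e norm_triangle_ineq4[of "z - x" y] by (auto simp: dist_norm norm_minus_commute algebra_simps)
          then have "u e (z - y) = v (z - y)" "u e (x - y) = v (x - y)"
            using e r U(2) by (auto intro!: u_eq_v[of x r])
          then show "\<bar>u e (z - y) - u e (x - y) - g x \<bullet> (z - x)\<bar> \<le> \<eta> * dist z x"
            using inc[of "z - y" "x - y"] d r(1) by (simp add: dist_commute dist_norm)
        qed
        then show ?case by (simp add: \<phi>_def e_def)
      qed
    qed
    then show ?case using \<eta> by simp
  qed
qed

text \<open>On \<open>U\<close> the approximations converge pointwise together with their gradients, within uniform bounds.
  Dominated convergence gives the \<open>H\<^sup>1\<close> convergence and carries integration by parts over to \<open>v\<close>.\<close>
theorem in_H10:
  assumes U: "open U" "U \<subseteq> \<Omega>" "negligible (\<Omega> - U)"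
    and g: "\<And>x. x \<in> U \<Longrightarrow> (v has_derivative (\<bullet>) (g x)) (at x)" "continuous_on U g"
  shows "v \<in> H10 \<Omega>"
proof -
  let ?M = "lebesgue_on \<Omega>"
  define G where "G x = (if x \<in> U then g x else 0)" for x
  have Om: "\<Omega> \<in> sets lebesgue" using \<Omega> by (simp add: borel_open)
  have Oml: "\<Omega> \<in> lmeasurable" using \<Omega> by (simp add: bounded_set_imp_lmeasurable borel_open)
  interpret finite_measure ?M using Oml by (rule finite_measure_lebesgue_on)
  obtain M where M: "M \<ge> 0" "\<And>x. \<bar>v x\<bar> \<le> M" using v_bounded by blast
  have AEU: "AE x in ?M. x \<in> U"
  proof -
    have "AE x in lebesgue. x \<notin> \<Omega> - U"
      using U(3) by (intro AE_not_in) (simp add: negligible_iff_null_sets)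
    then show ?thesis using Om by (simp add: AE_restrict_space_iff)
  qed
  have cv: "continuous_on UNIV v" using lip by (rule lipschitz_on_continuous_on)
  have mv[measurable]: "v \<in> borel_measurable ?M"
    by (intro borel_measurable_lebesgue_on borel_measurable_continuous_onI cv)
  have mG[measurable]: "G \<in> borel_measurable ?M"
    unfolding G_def by (intro borel_measurable_lebesgue_on borel_measurable_continuous_on_if) (use U g in auto)
  have mGi[measurable]: "(\<lambda>x. G x $ i) \<in> borel_measurable ?M" for i
    by (rule measurable_compose[OF mG borel_measurable_continuous_onI]) (intro continuous_intros)
  have m\<phi>[measurable]: "\<phi> n \<in> borel_measurable ?M" for n
    by (intro borel_measurable_lebesgue_on borel_measurable_continuous_onI smooth_continuous[OF smooth_\<phi>])
  have mg\<phi>[measurable]: "grad_on UNIV (\<phi> n) \<in> borel_measurable ?M" for n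
    by (intro borel_measurable_lebesgue_on borel_measurable_continuous_onI smooth_continuous_grad[OF smooth_\<phi>])
  have gl: "(\<lambda>n. grad_on UNIV (\<phi> n) x) \<longlonglongrightarrow> G x" if "x \<in> U" for x
    using grad_\<phi>_tendsto[OF U(1,2) that g] that by (simp add: G_def)
  have vl: "(\<lambda>n. \<phi> n x) \<longlonglongrightarrow> v x" if "x \<in> U" for x
    using \<phi>_tendsto that U(2) by blast
  have Gb: "norm (G x) \<le> 4 * L" for x
  proof (cases "x \<in> U")
    case True
    show ?thesis
      by (rule LIMSEQ_le_const2[OF tendsto_norm[OF gl[OF True]]]) (use grad_\<phi>_bound in blast)
  qed (use L_nonneg in \<open>auto simp: G_def\<close>)
  have Gbi: "\<bar>G x $ i\<bar> \<le> 4 * L" for x i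
    using component_le_norm_cart[of "G x" i] Gb[of x] by linarith
  have vL2: "v \<in> L2 \<Omega>" by (rule L2_bounded[OF mv Oml M(2)])
  have GL2: "(\<lambda>x. G x $ i) \<in> L2 \<Omega>" for i by (rule L2_bounded[OF mGi Oml Gbi])
  have conv: "(\<lambda>n. \<integral>x. (\<phi> n x - v x)\<^sup>2 + (norm (grad_on UNIV (\<phi> n) x - G x))\<^sup>2 \<partial>?M) \<longlonglongrightarrow> (\<integral>x. 0 \<partial>?M)"
  proof (rule integral_dominated_convergence[where w = "\<lambda>x. (2 * M)\<^sup>2 + (8 * L)\<^sup>2"])
    show "AE x in ?M. (\<lambda>n. (\<phi> n x - v x)\<^sup>2 + (norm (grad_on UNIV (\<phi> n) x - G x))\<^sup>2) \<longlonglongrightarrow> 0"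
      using AEU
    proof eventually_elim
      case (elim x)
      have "(\<lambda>n. (\<phi> n x - v x)\<^sup>2 + (norm (grad_on UNIV (\<phi> n) x - G x))\<^sup>2) \<longlonglongrightarrow> (v x - v x)\<^sup>2 + (norm (G x - G x))\<^sup>2"
        by (intro tendsto_intros vl gl elim)
      then show ?case by simp
    qed
    show "AE x in ?M. norm ((\<phi> n x - v x)\<^sup>2 + (norm (grad_on UNIV (\<phi> n) x - G x))\<^sup>2) \<le> (2 * M)\<^sup>2 + (8 * L)\<^sup>2" for n
    proof (rule AE_I2)
      fix x
      have "\<bar>\<phi> n x - v x\<bar> \<le> 2 * M" using \<phi>_bound[OF M(2), of n x] M(2)[of x] by linarith
      moreover have "norm (grad_on UNIV (\<phi> n) x - G x) \<le> 8 * L"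
        using grad_\<phi>_bound[of n x] Gb[of x] norm_triangle_ineq4[of "grad_on UNIV (\<phi> n) x" "G x"] by linarith
      ultimately have "(\<bar>\<phi> n x - v x\<bar>)\<^sup>2 + (norm (grad_on UNIV (\<phi> n) x - G x))\<^sup>2 \<le> (2 * M)\<^sup>2 + (8 * L)\<^sup>2"
        by (intro add_mono power_mono) auto
      then show "norm ((\<phi> n x - v x)\<^sup>2 + (norm (grad_on UNIV (\<phi> n) x - G x))\<^sup>2) \<le> (2 * M)\<^sup>2 + (8 * L)\<^sup>2"
        by simp
    qed
  qed auto
  have "has_weak_gradient v G \<Omega>"
    unfolding has_weak_gradient_def
  proof (intro ballI allI)
    fix \<theta> i assume \<theta>: "\<theta> \<in> test_functions \<Omega>"
    have sm: "smooth \<theta>" by (rule test_functionD[OF \<theta>])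
    have [measurable]: "\<theta> \<in> borel_measurable ?M" "(\<lambda>x. grad_on UNIV \<theta> x $ i) \<in> borel_measurable ?M"
      by (intro borel_measurable_lebesgue_on borel_measurable_continuous_onI smooth_continuous smooth_grad_component sm)+
    have mc[measurable]: "(\<lambda>x. grad_on UNIV (\<phi> n) x $ i) \<in> borel_measurable ?M" for n
      by (intro borel_measurable_lebesgue_on borel_measurable_continuous_onI smooth_continuous smooth_grad_component smooth_\<phi>)
    have bnd: "\<exists>B\<ge>0. \<forall>x\<in>\<Omega>. \<bar>f x\<bar> \<le> B" if "continuous_on UNIV f" for f :: "real^2 \<Rightarrow> real"
    proof -
      have "compact (f ` closure \<Omega>)"
        using \<Omega>(2) by (intro compact_continuous_image continuous_on_subset[OF that]) auto
      then have "bounded (f ` closure \<Omega>)" by (rule compact_imp_bounded)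
      then obtain B where B: "B > 0" "\<And>x. x \<in> closure \<Omega> \<Longrightarrow> norm (f x) \<le> B"
        unfolding bounded_pos by blast
      then show ?thesis using closure_subset[of \<Omega>] by (intro exI[of _ B]) auto
    qed
    obtain B where B: "B \<ge> 0" "\<And>x. x \<in> \<Omega> \<Longrightarrow> \<bar>\<theta> x\<bar> \<le> B"
      using bnd[OF smooth_continuous[OF sm]] by blast
    obtain B' where B': "B' \<ge> 0" "\<And>x. x \<in> \<Omega> \<Longrightarrow> \<bar>grad_on UNIV \<theta> x $ i\<bar> \<le> B'"
      using bnd[OF smooth_continuous[OF smooth_grad_component[OF sm, of i]]] by blast
    have 1: "(\<lambda>n. \<integral>x. \<phi> n x * (grad_on UNIV \<theta> x $ i) \<partial>?M) \<longlonglongrightarrow> (\<integral>x. v x * (grad_on UNIV \<theta> x $ i) \<partial>?M)"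
    proof (rule integral_dominated_convergence[where w = "\<lambda>x. M * B'"])
      show "AE x in ?M. (\<lambda>n. \<phi> n x * (grad_on UNIV \<theta> x $ i)) \<longlonglongrightarrow> v x * (grad_on UNIV \<theta> x $ i)"
        using AEU by eventually_elim (intro tendsto_intros vl)
      show "AE x in ?M. norm (\<phi> n x * (grad_on UNIV \<theta> x $ i)) \<le> M * B'" for n
        by (rule AE_I2) (auto simp: abs_mult intro!: mult_mono \<phi>_bound M B')
    qed auto
    have 2: "(\<lambda>n. \<integral>x. grad_on UNIV (\<phi> n) x $ i * \<theta> x \<partial>?M) \<longlonglongrightarrow> (\<integral>x. G x $ i * \<theta> x \<partial>?M)"
    proof (rule integral_dominated_convergence[where w = "\<lambda>x. 4 * L * B"])
      show "AE x in ?M. (\<lambda>n. grad_on UNIV (\<phi> n) x $ i * \<theta> x) \<longlonglongrightarrow> G x $ i * \<theta> x"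
        using AEU by eventually_elim (intro tendsto_intros gl)
      show "AE x in ?M. norm (grad_on UNIV (\<phi> n) x $ i * \<theta> x) \<le> 4 * L * B" for n
        by (rule AE_I2) (use order_trans[OF component_le_norm_cart grad_\<phi>_bound] L_nonneg in
              \<open>auto simp: abs_mult intro!: mult_mono B\<close>)
    qed auto
    have "(\<lambda>n. \<integral>x. \<phi> n x * (grad_on UNIV \<theta> x $ i) \<partial>?M) \<longlonglongrightarrow> - (\<integral>x. G x $ i * \<theta> x \<partial>?M)"
      unfolding test_function_by_parts[OF \<Omega>(1) \<phi>_test \<theta>] by (rule tendsto_minus[OF 2])
    then show "(\<integral>x. v x * (grad_on UNIV \<theta> x $ i) \<partial>?M) = - (\<integral>x. G x $ i * \<theta> x \<partial>?M)"
      using 1 LIMSEQ_unique by blast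
  qed
  then show ?thesis
    unfolding H10_def using vL2 GL2 \<phi>_test conv by (auto intro!: exI[of _ G] exI[of _ \<phi>])
qed

end

section \<open>Polynomials in the plane\<close>

lemma P_cong: "f \<in> P k S \<Longrightarrow> (\<And>x. x \<in> S \<Longrightarrow> f x = g x) \<Longrightarrow> g \<in> P k S"
  unfolding P_def by (auto; metis)

lemma P_I:
  "(\<And>x. x \<in> S \<Longrightarrow> f x = (\<Sum>i\<le>k. \<Sum>j\<le>k - i. c i j * (x $ 1) ^ i * (x $ 2) ^ j)) \<Longrightarrow> f \<in> P k S"
  unfolding P_def by blast

lemma P_const: "(\<lambda>x. c) \<in> P k S"
proof -
  have "c = (\<Sum>i\<le>k. \<Sum>j\<le>k - i. (if i = 0 \<and> j = 0 then c else 0) * (x $ 1) ^ i * (x $ 2) ^ j)" for x :: "real^2"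
  proof -
    have "(\<Sum>j\<le>k - i. (if i = 0 \<and> j = 0 then c else 0) * (x $ 1) ^ i * (x $ 2) ^ j) = (if i = 0 then c else 0)" for i
      by (cases "i = 0") (auto simp: if_distrib[where f = "\<lambda>c. c * _"] sum.delta cong: if_cong)
    then show ?thesis by simp
  qed
  then show ?thesis by (rule P_I)
qed

lemma P_add: assumes "f \<in> P k S" "g \<in> P k S" shows "(\<lambda>x. f x + g x) \<in> P k S"
proof -
  obtain c d where "\<forall>x\<in>S. f x = (\<Sum>i\<le>k. \<Sum>j\<le>k - i. c i j * (x $ 1) ^ i * (x $ 2) ^ j)"
    "\<forall>x\<in>S. g x = (\<Sum>i\<le>k. \<Sum>j\<le>k - i. d i j * (x $ 1) ^ i * (x $ 2) ^ j)"
    using assms unfolding P_def by blast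
  then show ?thesis unfolding P_def
    by (intro CollectI exI[of _ "\<lambda>i j. c i j + d i j"]) (auto simp: sum.distrib algebra_simps)
qed

lemma P_cmult: assumes "f \<in> P k S" shows "(\<lambda>x. r * f x) \<in> P k S"
proof -
  obtain c where "\<forall>x\<in>S. f x = (\<Sum>i\<le>k. \<Sum>j\<le>k - i. c i j * (x $ 1) ^ i * (x $ 2) ^ j)"
    using assms unfolding P_def by blast
  then show ?thesis unfolding P_def
    by (intro CollectI exI[of _ "\<lambda>i j. r * c i j"]) (auto simp: sum_distrib_left algebra_simps)
qed

lemma P_diff: "f \<in> P k S \<Longrightarrow> g \<in> P k S \<Longrightarrow> (\<lambda>x. f x - g x) \<in> P k S"
  using P_add[of f k S "\<lambda>x. (-1) * g x"] P_cmult[of g k S "-1"] by simp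

lemma P_mult_coord1: assumes "f \<in> P k S" shows "(\<lambda>x. x $ 1 * f x) \<in> P (Suc k) S"
proof -
  obtain c where c: "\<forall>x\<in>S. f x = (\<Sum>i\<le>k. \<Sum>j\<le>k - i. c i j * (x $ 1) ^ i * (x $ 2) ^ j)"
    using assms unfolding P_def by blast
  have *: "x $ 1 * (\<Sum>i\<le>k. \<Sum>j\<le>k - i. c i j * (x $ 1) ^ i * (x $ 2) ^ j) =
      (\<Sum>i\<le>Suc k. \<Sum>j\<le>Suc k - i. (if i = 0 then 0 else c (i - 1) j) * (x $ 1) ^ i * (x $ 2) ^ j)" for x :: "real^2"
    by (subst sum.atMost_Suc_shift) (simp add: sum_distrib_left mult_ac)
  show ?thesis by (rule P_I) (simp only: c[rule_format] *)
qed

lemma P_mult_coord2: assumes "f \<in> P k S" shows "(\<lambda>x. x $ 2 * f x) \<in> P (Suc k) S"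
proof -
  obtain c where c: "\<forall>x\<in>S. f x = (\<Sum>i\<le>k. \<Sum>j\<le>k - i. c i j * (x $ 1) ^ i * (x $ 2) ^ j)"
    using assms unfolding P_def by blast
  have shift: "(\<Sum>j\<le>Suc m. (if j = 0 then 0 else e (j - 1)) * A * B ^ j) = B * (\<Sum>j\<le>m. e j * A * B ^ j)"
    for m and e :: "nat \<Rightarrow> real" and A B
    by (subst sum.atMost_Suc_shift) (simp add: sum_distrib_left mult_ac)
  have *: "x $ 2 * (\<Sum>i\<le>k. \<Sum>j\<le>k - i. c i j * (x $ 1) ^ i * (x $ 2) ^ j) =
      (\<Sum>i\<le>Suc k. \<Sum>j\<le>Suc k - i. (if j = 0 then 0 else c i (j - 1)) * (x $ 1) ^ i * (x $ 2) ^ j)" for x :: "real^2"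
  proof -
    have "(\<Sum>j\<le>Suc k - i. (if j = 0 then 0 else c i (j - 1)) * (x $ 1) ^ i * (x $ 2) ^ j)
       = x $ 2 * (\<Sum>j\<le>k - i. c i j * (x $ 1) ^ i * (x $ 2) ^ j)" if "i \<le> k" for i
      unfolding Suc_diff_le[OF that] by (rule shift)
    then show ?thesis by (simp add: sum_distrib_left)
  qed
  show ?thesis by (rule P_I) (simp only: c[rule_format] *)
qed

lemma P_Suc: assumes "f \<in> P k S" shows "f \<in> P (Suc k) S"
proof -
  obtain c where c: "\<forall>x\<in>S. f x = (\<Sum>i\<le>k. \<Sum>j\<le>k - i. c i j * (x $ 1) ^ i * (x $ 2) ^ j)"
    using assms unfolding P_def by blast
  have *: "(\<Sum>i\<le>k. \<Sum>j\<le>k - i. c i j * (x $ 1) ^ i * (x $ 2) ^ j) =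
      (\<Sum>i\<le>Suc k. \<Sum>j\<le>Suc k - i. (if i + j \<le> k then c i j else 0) * (x $ 1) ^ i * (x $ 2) ^ j)" for x :: "real^2"
  proof -
    have "(\<Sum>j\<le>Suc k - i. (if i + j \<le> k then c i j else 0) * (x $ 1) ^ i * (x $ 2) ^ j)
      = (\<Sum>j\<le>k - i. c i j * (x $ 1) ^ i * (x $ 2) ^ j)" if "i \<le> k" for i
      using that by (simp add: Suc_diff_le) (rule sum.cong, auto)
    then show ?thesis by simp
  qed
  show ?thesis by (rule P_I) (simp only: c[rule_format] *)
qed

lemma P_mult_affine:
  assumes "f \<in> P k S" shows "(\<lambda>x. (\<alpha> + \<beta> \<bullet> x) * f x) \<in> P (Suc k) S"
proof -
  have "(\<lambda>x. \<alpha> * f x + (\<beta> $ 1 * (x $ 1 * f x) + \<beta> $ 2 * (x $ 2 * f x))) \<in> P (Suc k) S"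
    by (intro P_add P_cmult P_mult_coord1 P_mult_coord2 assms P_Suc[OF assms])
  then show ?thesis by (simp add: inner_vec_def sum_2 algebra_simps)
qed

lemma P_affine: "(\<lambda>x. \<alpha> + \<beta> \<bullet> x) \<in> P (Suc k) S"
  using P_mult_affine[OF P_const[of 1 k S]] by simp

lemma P1_affine:
  assumes "f \<in> P 1 S" obtains \<alpha> \<beta> where "\<And>x. x \<in> S \<Longrightarrow> f x = \<alpha> + \<beta> \<bullet> x"
proof -
  obtain c where "\<forall>x\<in>S. f x = (\<Sum>i\<le>1. \<Sum>j\<le>1 - i. c i j * (x $ 1) ^ i * (x $ 2) ^ j)"
    using assms unfolding P_def by blast
  then show thesis
    by (intro that[of "c 0 0" "vector [c 1 0, c 0 1]"]) (auto simp: inner_vec_def sum_2)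
qed

lemma P_extend:
  assumes "f \<in> P k S" obtains p where "p \<in> P k UNIV" "\<And>x. x \<in> S \<Longrightarrow> f x = p x"
proof -
  obtain c where c: "\<forall>x\<in>S. f x = (\<Sum>i\<le>k. \<Sum>j\<le>k - i. c i j * (x $ 1) ^ i * (x $ 2) ^ j)"
    using assms unfolding P_def by blast
  show thesis
    by (rule that[of "\<lambda>x. \<Sum>i\<le>k. \<Sum>j\<le>k - i. c i j * (x $ 1) ^ i * (x $ 2) ^ j"])
       (use c in \<open>auto simp: P_def\<close>)
qed

lemma P_smooth: assumes "p \<in> P k UNIV" shows "smooth p"
proof -
  obtain c where c: "p = (\<lambda>x. \<Sum>i\<le>k. \<Sum>j\<le>k - i. c i j * (x $ 1) ^ i * (x $ 2) ^ j)"
    using assms unfolding P_def by blast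
  have sum: "(\<lambda>x. \<Sum>i\<in>I. f i x) \<in> bump_algebra 0" if "\<And>i. i \<in> I \<Longrightarrow> f i \<in> bump_algebra 0" for I :: "nat set" and f
    using that by (induction I rule: infinite_finite_induct) (auto intro: bump_algebra.intros)
  have pow: "(\<lambda>x. (x $ i) ^ n) \<in> bump_algebra 0" for i n
    by (induction n) (auto intro: bump_algebra.intros)
  have "p \<in> bump_algebra 0" unfolding c
    by (intro sum bump_algebra.mult bump_algebra.const pow)
  then show ?thesis by (rule smooth_bump_algebra)
qed

lemma P_line:
  assumes "p \<in> P k UNIV" obtains q :: "real poly" where "degree q \<le> k" "\<And>t. p (a + t *\<^sub>R d) = poly q t"
proof -
  obtain c where c: "p = (\<lambda>x. \<Sum>i\<le>k. \<Sum>j\<le>k - i. c i j * (x $ 1) ^ i * (x $ 2) ^ j)"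
    using assms unfolding P_def by blast
  define q where "q = (\<Sum>i\<le>k. \<Sum>j\<le>k - i. smult (c i j) ([:a$1, d$1:] ^ i * [:a$2, d$2:] ^ j))"
  have "degree (smult (c i j) ([:a$1, d$1:] ^ i * [:a$2, d$2:] ^ j)) \<le> k" if "i \<le> k" "j \<le> k - i" for i j
  proof -
    have "degree ([:a$1, d$1:] ^ i) \<le> 1 * i" "degree ([:a$2, d$2:] ^ j) \<le> 1 * j"
      by (intro order_trans[OF degree_power_le] mult_right_mono; simp)+
    then have "degree ([:a$1, d$1:] ^ i * [:a$2, d$2:] ^ j) \<le> i + j"
      using degree_mult_le[of "[:a$1, d$1:] ^ i" "[:a$2, d$2:] ^ j"] by linarith
    then show ?thesis using that degree_smult_le[of "c i j" "[:a$1, d$1:] ^ i * [:a$2, d$2:] ^ j"] by linarith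
  qed
  then have "degree q \<le> k" unfolding q_def by (intro degree_sum_le) auto
  moreover have "p (a + t *\<^sub>R d) = poly q t" for t
    by (simp add: c q_def poly_sum algebra_simps)
  ultimately show thesis using that by blast
qed

section \<open>One-sided gradients\<close>

text \<open>The directions from \<open>x\<close> to the points of a convex set with interior points span the plane, which
  determines the derivative within \<open>T\<close> also at vertices.\<close>
lemma grad_on_eq:
  assumes T: "convex T" "interior T \<noteq> {}" and x: "x \<in> T"
    and p: "(p has_derivative (\<bullet>) g) (at x)" and eq: "\<And>y. y \<in> T \<Longrightarrow> v y = p y"
  shows "grad_on T v x = g"
proof -
  have v: "(v has_derivative (\<bullet>) g) (at x within T)"
    by (rule has_derivative_transform[OF x eq has_derivative_at_withinI[OF p]])
  define D where "D = frechet_derivative v (at x within T)"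
  have D: "(v has_derivative D) (at x within T)"
    unfolding D_def using v by (simp add: frechet_derivative_works[symmetric] differentiable_def) blast
  have lin: "linear D" using D by (rule has_derivative_linear)
  have dir: "D (y - x) = g \<bullet> (y - x)" if y: "y \<in> T" for y
  proof -
    have sub: "(\<lambda>t. x + t *\<^sub>R (y - x)) ` {0..1} \<subseteq> T"
    proof clarsimp
      fix t :: real assume "0 \<le> t" "t \<le> 1"
      then have "(1 - t) *\<^sub>R x + t *\<^sub>R y \<in> T" by (intro convexD[OF T(1)] x y) auto
      then show "x + t *\<^sub>R (y - x) \<in> T" by (simp add: algebra_simps)
    qed
    have l: "((\<lambda>t. x + t *\<^sub>R (y - x)) has_derivative (\<lambda>t. t *\<^sub>R (y - x))) (at 0 within {0..1})"
      by (auto intro!: derivative_eq_intros)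
    have "((\<lambda>t. v (x + t *\<^sub>R (y - x))) has_vector_derivative E (y - x)) (at 0 within {0..1})"
      if E: "(v has_derivative E) (at x within T)" for E
    proof -
      have "((\<lambda>t. v (x + t *\<^sub>R (y - x))) has_derivative (\<lambda>t. E (t *\<^sub>R (y - x)))) (at 0 within {0..1})"
        by (rule has_derivative_in_compose[OF l]) (use has_derivative_subset[OF E sub] in simp)
      moreover have "(\<lambda>t. E (t *\<^sub>R (y - x))) = (\<lambda>t. t *\<^sub>R E (y - x))"
        using linear_scale[OF has_derivative_linear[OF E]] by auto
      ultimately show ?thesis by (simp add: has_vector_derivative_def)
    qed
    moreover have "at (0::real) within {0..1} \<noteq> bot" by (simp add: at_within_Icc_at_right)
    ultimately show ?thesis using D v vector_derivative_unique_within by blast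
  qed
  obtain z r where z: "r > 0" "ball z r \<subseteq> T"
    using T(2) by (metis ex_in_conv mem_interior)
  have "D h = g \<bullet> h" for h
  proof (cases "h = 0")
    case True then show ?thesis using linear_0[OF lin] by simp
  next
    case False
    define s where "s = r / (2 * norm h)"
    have s: "s > 0" using z False by (simp add: s_def)
    have "z + s *\<^sub>R h \<in> T" "z \<in> T" using z s False by (auto intro!: subsetD[OF z(2)] simp: dist_norm s_def)
    from dir[OF this(1)] dir[OF this(2)]
    have "D ((z + s *\<^sub>R h - x) - (z - x)) = g \<bullet> ((z + s *\<^sub>R h - x) - (z - x))"
      by (simp only: linear_diff[OF lin] inner_diff_right)
    then have "s * D h = s * (g \<bullet> h)" using linear_scale[OF lin] by simp
    then show ?thesis using s by simp
  qed
  then show ?thesis by (simp add: grad_on_def D_def[symmetric] vec_eq_iff inner_axis)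
qed

lemma cubic_Hermite_midpoint:
  fixes q :: "real poly"
  assumes "degree q \<le> 3"
  shows "poly (pderiv q) (1/2) = 3/2 * (poly q 1 - poly q 0) - 1/4 * (poly (pderiv q) 0 + poly (pderiv q) 1)"
proof -
  obtain a b c d where q: "q = [:a, b, c, d:]"
  proof -
    have "q = [:coeff q 0, coeff q 1, coeff q 2, coeff q 3:]"
    proof (rule poly_eqI)
      fix n :: nat
      consider "n = 0" | "n = 1" | "n = 2" | "n = 3" | "n > 3" by linarith
      then show "coeff q n = coeff [:coeff q 0, coeff q 1, coeff q 2, coeff q 3:] n"
        using assms by cases (auto simp: coeff_pCons coeff_eq_0 numeral_2_eq_2 numeral_3_eq_3 split: nat.splits)
    qed
    then show thesis using that by blast
  qed
  show ?thesis by (simp add: q pderiv_pCons field_simps)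
qed

lemma P3_edge_midpoint:
  assumes T: "convex T" "interior T \<noteq> {}" and v: "v \<in> P 3 T" and ab: "a \<in> T" "b \<in> T"
  shows "grad_on T v ((1/2) *\<^sub>R (a + b)) \<bullet> (b - a)
     = 3/2 * (v b - v a) - 1/4 * ((grad_on T v a + grad_on T v b) \<bullet> (b - a))"
proof -
  obtain p where p: "p \<in> P 3 UNIV" "\<And>x. x \<in> T \<Longrightarrow> v x = p x" using P_extend[OF v] by blast
  obtain q where q: "degree q \<le> 3" "\<And>t. p (a + t *\<^sub>R (b - a)) = poly q t" using P_line[OF p(1)] by blast
  note dp = smooth_has_derivative[OF P_smooth[OF p(1)]]
  have gr: "grad_on T v x = grad_on UNIV p x" if "x \<in> T" for x
    by (rule grad_on_eq[OF T that dp p(2)])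
  have der: "grad_on UNIV p (a + t *\<^sub>R (b - a)) \<bullet> (b - a) = poly (pderiv q) t" for t
  proof -
    have "((\<lambda>t. a + t *\<^sub>R (b - a)) has_derivative (\<lambda>t. t *\<^sub>R (b - a))) (at t)"
      by (auto intro!: derivative_eq_intros)
    from has_derivative_compose[OF this dp]
    have "(poly q has_derivative (\<lambda>s. grad_on UNIV p (a + t *\<^sub>R (b - a)) \<bullet> (s *\<^sub>R (b - a)))) (at t)"
      by (simp add: q(2))
    then have "(poly q has_real_derivative (grad_on UNIV p (a + t *\<^sub>R (b - a)) \<bullet> (b - a))) (at t)"
      by (simp add: has_field_derivative_def mult.commute[of _ "grad_on UNIV p (a + t *\<^sub>R (b - a)) \<bullet> (b - a)"])
    then show ?thesis using DERIV_unique poly_DERIV by blast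
  qed
  have m: "(1/2) *\<^sub>R (a + b) \<in> T" using convexD[OF T(1) ab, of "1/2" "1/2"] by (simp add: scaleR_add_right)
  have "a + (1/2) *\<^sub>R (b - a) = (1/2) *\<^sub>R (a + b)" by (simp add: vec_eq_iff field_simps)
  then show ?thesis
    using cubic_Hermite_midpoint[OF q(1)] der[of 0] der[of 1] der[of "1/2"] q(2)[of 0] q(2)[of 1] ab m
    by (simp add: gr p(2) inner_add_left)
qed

section \<open>Triangles and barycentric coordinates\<close>

definition cross2 :: "real^2 \<Rightarrow> real^2 \<Rightarrow> real" where
  "cross2 u v = u$1 * v$2 - u$2 * v$1"

text \<open>The order of the vertices is part of the data, and all six orders are admitted. A statement about
  the vertex \<open>a\<close> or the edge \<open>[a, b]\<close> thereby covers all vertices and edges.\<close>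
definition tri :: "real^2 \<Rightarrow> real^2 \<Rightarrow> real^2 \<Rightarrow> (real^2) set \<Rightarrow> bool" where
  "tri a b c T \<longleftrightarrow> \<not> affine_dependent {a, b, c} \<and> card {a, b, c} = 3 \<and> T = convex hull {a, b, c}"

lemma simplex_tri: assumes "2 simplex T" obtains a b c where "tri a b c T"
proof -
  obtain C where C: "\<not> affine_dependent C" "card C = 3" "T = convex hull C"
    using assms by (auto simp: simplex_def)
  then obtain a b c where "C = {a,b,c}" by (auto simp: card_3_iff)
  with C show thesis by (intro that[of a b c]) (auto simp: tri_def)
qed

lemma tri_perms: assumes "tri a b c T" shows "tri b c a T" "tri c a b T" "tri b a c T" "tri a c b T" "tri c b a T"
  using assms by (simp_all add: tri_def insert_commute)

lemma tri_distinct: assumes "tri a b c T" shows "a \<noteq> b" "b \<noteq> c" "a \<noteq> c"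
  using assms by (auto simp: tri_def card_insert_if split: if_splits)

lemma tri_verts: "tri a b c T \<Longrightarrow> verts T = {a, b, c}"
  unfolding tri_def verts_def by (auto simp: extreme_point_of_convex_hull_affine_independent)

lemma tri_convex: "tri a b c T \<Longrightarrow> convex T" and tri_compact: "tri a b c T \<Longrightarrow> compact T"
  by (auto simp: tri_def finite_imp_compact_convex_hull)

lemma tri_aff_dim: "tri a b c T \<Longrightarrow> aff_dim T = 2"
  using aff_dim_affine_independent[of "{a, b, c}"] by (simp only: tri_def aff_dim_convex_hull) simp

lemma tri_interior: "tri a b c T \<Longrightarrow> interior T \<noteq> {}"
  using tri_convex tri_aff_dim by (simp add: interior_rel_interior_gen rel_interior_eq_empty) force

lemma tri_cross2: assumes "tri a b c T" shows "cross2 (b - a) (c - a) \<noteq> 0"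
proof
  assume z: "cross2 (b - a) (c - a) = 0"
  have "aff_dim {a, b, c} = 2" using tri_aff_dim[OF assms] assms by (simp only: tri_def aff_dim_convex_hull)
  then have "affine hull {a, b, c} = UNIV" using aff_dim_eq_full[of "{a, b, c}"] by simp
  then obtain u v w where uvw: "u + v + w = 1" "a + rot90 *v (b - a) = u *\<^sub>R a + v *\<^sub>R b + w *\<^sub>R c"
    unfolding affine_hull_3 by blast
  have u: "u = 1 - v - w" using uvw(1) by simp
  have "rot90 *v (b - a) = v *\<^sub>R (b - a) + w *\<^sub>R (c - a)"
    using uvw(2) unfolding u by (simp add: algebra_simps)
  moreover have "cross2 (b - a) (v *\<^sub>R (b - a) + w *\<^sub>R (c - a)) = v * cross2 (b - a) (b - a) + w * cross2 (b - a) (c - a)"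
    by (simp add: cross2_def algebra_simps)
  ultimately have "cross2 (b - a) (rot90 *v (b - a)) = v * cross2 (b - a) (b - a) + w * cross2 (b - a) (c - a)"
    by simp
  then have "cross2 (b - a) (rot90 *v (b - a)) = 0" using z by (simp add: cross2_def)
  moreover have "cross2 u (rot90 *v u) = (u$1)\<^sup>2 + (u$2)\<^sup>2" for u
    by (simp add: cross2_def rot90_def matrix_vector_mult_def sum_2 power2_eq_square)
  ultimately have "((b - a)$1)\<^sup>2 + ((b - a)$2)\<^sup>2 = 0" by metis
  then have "a = b" by (simp add: vec_eq_iff forall_2 sum_power2_eq_zero_iff)
  then show False using tri_distinct[OF assms] by simp
qed

definition bary :: "real^2 \<Rightarrow> real^2 \<Rightarrow> real^2 \<Rightarrow> real^2 \<Rightarrow> real" where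
  "bary a b c x = cross2 (b - x) (c - x) / cross2 (b - a) (c - a)"

lemma bary_swap: "bary a c b x = bary a b c x"
proof -
  have "cross2 u v = - cross2 v u" for u v by (simp add: cross2_def)
  then show ?thesis unfolding bary_def by (metis minus_divide_divide)
qed

lemma bary_affine: "bary a b c x = cross2 b c / cross2 (b - a) (c - a)
    + (1 / cross2 (b - a) (c - a)) *\<^sub>R (rot90 *v (c - b)) \<bullet> x"
  by (simp add: bary_def cross2_def rot90_def matrix_vector_mult_def inner_vec_def sum_2 add_divide_distrib[symmetric] diff_divide_distrib[symmetric])
     (simp add: algebra_simps)

lemma cross2_cyclic: "cross2 (c - b) (a - b) = cross2 (b - a) (c - a)"
  by (simp add: cross2_def algebra_simps)

lemma bary_sum:
  assumes "cross2 (b - a) (c - a) \<noteq> 0"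
  shows "bary a b c x + bary b c a x + bary c a b x = 1"
    "bary a b c x *\<^sub>R a + bary b c a x *\<^sub>R b + bary c a b x *\<^sub>R c = x"
proof -
  define D where "D = cross2 (b - a) (c - a)"
  have D: "cross2 (b - a) (c - a) = D" "cross2 (c - b) (a - b) = D" "cross2 (a - c) (b - c) = D" "D \<noteq> 0"
    using assms cross2_cyclic by (auto simp: D_def)
  have D': "(b$1 - a$1) * (c$2 - a$2) - (b$2 - a$2) * (c$1 - a$1) = D" by (simp add: D_def cross2_def)
  show "bary a b c x + bary b c a x + bary c a b x = 1"
    using D(4) by (simp add: bary_def D add_divide_distrib[symmetric]) (simp add: D'[symmetric] cross2_def algebra_simps)
  show "bary a b c x *\<^sub>R a + bary b c a x *\<^sub>R b + bary c a b x *\<^sub>R c = x"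
    using D(4) by (simp add: vec_eq_iff forall_2 bary_def D add_divide_distrib[symmetric] divide_simps) (simp add: D'[symmetric] cross2_def algebra_simps)
qed

lemma bary_unique:
  assumes "cross2 (b - a) (c - a) \<noteq> 0" "u + v + w = 1"
  shows "bary a b c (u *\<^sub>R a + v *\<^sub>R b + w *\<^sub>R c) = u"
proof -
  have v: "v = 1 - u - w" using assms(2) by simp
  have "cross2 (b - (u *\<^sub>R a + v *\<^sub>R b + w *\<^sub>R c)) (c - (u *\<^sub>R a + v *\<^sub>R b + w *\<^sub>R c)) = u * cross2 (b - a) (c - a)"
    unfolding v by (simp add: cross2_def algebra_simps)
  then show ?thesis using assms(1) by (simp add: bary_def)
qed

text \<open>The barycentric coordinate belonging to the vertex \<open>z\<close>, as an affine function on the whole plane.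
  With the value \<open>0\<close> for points \<open>z\<close> that are not vertices of \<open>T\<close>, the coordinates of two triangles
  agree on their common face.\<close>
definition nodal :: "(real^2) set \<Rightarrow> real^2 \<Rightarrow> real^2 \<Rightarrow> real" where
  "nodal T z x = (if z \<in> verts T then (let (b, c) = SOME (b, c). tri z b c T in bary z b c x) else 0)"

lemma nodal_bary: assumes "tri a b c T" shows "nodal T a x = bary a b c x"
proof -
  define bc where "bc = (SOME (b, c). tri a b c T)"
  have "case bc of (b, c) \<Rightarrow> tri a b c T"
    unfolding bc_def by (rule someI_ex) (use assms in auto)
  then obtain b' c' where bc: "bc = (b', c')" and t: "tri a b' c' T" by (cases bc) auto
  have "{a, b, c} = {a, b', c'}" using tri_verts[OF assms] tri_verts[OF t] by simp
  then have "b' = b \<and> c' = c \<or> b' = c \<and> c' = b"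
    using tri_distinct[OF assms] tri_distinct[OF t] by (metis empty_iff insert_iff)
  moreover have "nodal T a x = bary a b' c' x"
    using tri_verts[OF assms] bc by (simp add: nodal_def bc_def)
  ultimately show ?thesis using bary_swap by auto
qed

lemma nodal_not_vert: "z \<notin> verts T \<Longrightarrow> nodal T z x = 0"
  by (simp add: nodal_def)

lemma nodal_bary_all:
  assumes "tri a b c T"
  shows "nodal T a x = bary a b c x" "nodal T b x = bary b c a x" "nodal T c x = bary c a b x"
  using nodal_bary assms tri_perms[OF assms] by blast+

lemma nodal_sum3:
  assumes "tri a b c T"
  shows "nodal T a x + nodal T b x + nodal T c x = 1"
    "nodal T a x *\<^sub>R a + nodal T b x *\<^sub>R b + nodal T c x *\<^sub>R c = x"
  using bary_sum[OF tri_cross2[OF assms]] by (simp_all add: nodal_bary_all[OF assms])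

lemma nodal_unique3:
  assumes "tri a b c T" "u + v + w = 1"
  shows "nodal T a (u *\<^sub>R a + v *\<^sub>R b + w *\<^sub>R c) = u"
  unfolding nodal_bary[OF assms(1)] by (rule bary_unique[OF tri_cross2[OF assms(1)] assms(2)])

lemma nodal_vert3:
  assumes "tri a b c T"
  shows "nodal T a a = 1" "nodal T a b = 0" "nodal T a c = 0"
  using nodal_unique3[OF assms, of 1 0 0] nodal_unique3[OF assms, of 0 1 0] nodal_unique3[OF assms, of 0 0 1] by auto

lemma nodal_affine: assumes "tri a b c T" obtains \<alpha> \<beta> where "\<And>x. nodal T z x = \<alpha> + \<beta> \<bullet> x"
proof (cases "z \<in> verts T")
  case True
  then obtain b c where "tri z b c T" using tri_verts[OF assms] assms tri_perms[OF assms] by auto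
  from nodal_bary[OF this] bary_affine[of z b c] show thesis by (rule that[OF trans])
next
  case False then show thesis by (intro that[of 0 0]) (simp add: nodal_not_vert)
qed

lemma tri_mem_iff: assumes "tri a b c T"
  shows "x \<in> T \<longleftrightarrow> 0 \<le> nodal T a x \<and> 0 \<le> nodal T b x \<and> 0 \<le> nodal T c x"
proof
  assume "x \<in> T"
  then obtain u v w where uvw: "0 \<le> u" "0 \<le> v" "0 \<le> w" "u + v + w = 1" "x = u *\<^sub>R a + v *\<^sub>R b + w *\<^sub>R c"
    using assms unfolding tri_def convex_hull_3 by blast
  then have "nodal T a x = u" "nodal T b x = v" "nodal T c x = w"
    using nodal_unique3[OF assms, of u v w] nodal_unique3[OF tri_perms(1)[OF assms], of v w u]
      nodal_unique3[OF tri_perms(2)[OF assms], of w u v] by (auto simp: add_ac)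
  then show "0 \<le> nodal T a x \<and> 0 \<le> nodal T b x \<and> 0 \<le> nodal T c x" using uvw by simp
next
  assume "0 \<le> nodal T a x \<and> 0 \<le> nodal T b x \<and> 0 \<le> nodal T c x"
  moreover have "T = {u *\<^sub>R a + v *\<^sub>R b + w *\<^sub>R c | u v w. 0 \<le> u \<and> 0 \<le> v \<and> 0 \<le> w \<and> u + v + w = 1}"
    using assms unfolding tri_def convex_hull_3 by blast
  ultimately show "x \<in> T" using nodal_sum3[OF assms, of x] by (metis (mono_tags, lifting) mem_Collect_eq)
qed

lemma nodal_combination:
  assumes T: "tri a b c T" and S: "finite S" "S \<subseteq> verts T" "sum \<mu> S = 1"
  shows "nodal T z (\<Sum>v\<in>S. \<mu> v *\<^sub>R v) = (if z \<in> S then \<mu> z else 0)"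
proof -
  obtain \<alpha> \<beta> where n: "\<And>x. nodal T z x = \<alpha> + \<beta> \<bullet> x" using nodal_affine[OF T] by blast
  have v: "nodal T z v = (if v = z then 1 else 0)" if "v \<in> S" for v
  proof (cases "z \<in> verts T")
    case True
    then show ?thesis
      using that S(2) tri_verts[OF T] nodal_vert3[OF T] nodal_vert3[OF tri_perms(1)[OF T]] nodal_vert3[OF tri_perms(2)[OF T]] tri_distinct[OF T]
      by auto
  next
    case False then show ?thesis using that S by (auto simp: nodal_not_vert)
  qed
  have "nodal T z (\<Sum>v\<in>S. \<mu> v *\<^sub>R v) = (\<Sum>v\<in>S. \<mu> v * nodal T z v)"
    by (simp add: n inner_sum_right distrib_left sum.distrib S(3) flip: sum_distrib_right)
  also have "\<dots> = (\<Sum>v\<in>S. if v = z then \<mu> z else 0)" by (rule sum.cong) (auto simp: v)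
  also have "\<dots> = (if z \<in> S then \<mu> z else 0)" using S(1) by (simp add: sum.delta)
  finally show ?thesis .
qed

lemma P1_interpolation:
  assumes T: "tri a b c T" and f: "f \<in> P 1 T" and x: "x \<in> T"
  shows "f x = f a * nodal T a x + f b * nodal T b x + f c * nodal T c x"
proof -
  obtain \<alpha> \<beta> where f': "\<And>x. x \<in> T \<Longrightarrow> f x = \<alpha> + \<beta> \<bullet> x" using P1_affine[OF f] by blast
  have abc: "a \<in> T" "b \<in> T" "c \<in> T" using T by (auto simp: tri_def hull_inc)
  let ?u = "nodal T a x" and ?v = "nodal T b x" and ?w = "nodal T c x"
  have "\<alpha> + \<beta> \<bullet> x = \<alpha> * (?u + ?v + ?w) + \<beta> \<bullet> (?u *\<^sub>R a + ?v *\<^sub>R b + ?w *\<^sub>R c)"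
    unfolding nodal_sum3[OF T] by simp
  then show ?thesis using f' x abc by (simp add: inner_add_right algebra_simps)
qed

lemma P2_zero:
  assumes T: "tri a b c T" and p: "p \<in> P 2 T"
    and z: "p a = 0" "p b = 0" "p c = 0" "p ((1/2) *\<^sub>R (a + b)) = 0" "p ((1/2) *\<^sub>R (b + c)) = 0" "p ((1/2) *\<^sub>R (a + c)) = 0"
    and x: "x \<in> T"
  shows "p x = 0"
proof -
  obtain k where k: "\<forall>x\<in>T. p x = (\<Sum>i\<le>2. \<Sum>j\<le>2 - i. k i j * (x $ 1) ^ i * (x $ 2) ^ j)"
    using p unfolding P_def by blast
  define q where "q x = k 0 0 + k 0 1 * x$2 + k 0 2 * (x$2)^2 + k 1 0 * x$1 + k 1 1 * x$1 * x$2 + k 2 0 * (x$1)^2" for x :: "real^2"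
  have pq: "p x = q x" if "x \<in> T" for x
    using k that by (simp add: q_def numeral_2_eq_2)
  have abc: "a \<in> T" "b \<in> T" "c \<in> T" using T by (auto simp: tri_def hull_inc)
  have mid: "(1/2) *\<^sub>R (s + t) \<in> T" if "s \<in> T" "t \<in> T" for s t
    using convexD[OF tri_convex[OF T] that, of "1/2" "1/2"] by (simp add: scaleR_add_right)
  have zq: "q a = 0" "q b = 0" "q c = 0" "q ((1/2) *\<^sub>R (a + b)) = 0" "q ((1/2) *\<^sub>R (b + c)) = 0" "q ((1/2) *\<^sub>R (a + c)) = 0"
    using z pq[OF abc(1)] pq[OF abc(2)] pq[OF abc(3)] pq[OF mid[OF abc(1,2)]] pq[OF mid[OF abc(2,3)]] pq[OF mid[OF abc(1,3)]]
    by auto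
  define u v w where "u = nodal T a x" and "v = nodal T b x" and "w = nodal T c x"
  have s: "u = 1 - v - w" and xx: "x = u *\<^sub>R a + v *\<^sub>R b + w *\<^sub>R c"
    using nodal_sum3[OF T, of x] by (auto simp: u_def v_def w_def)
  \<comment> \<open>Quadratic interpolation at vertices and midpoints, which reproduces every monomial of degree at
    most two.\<close>
  define J where "J f = f a * (u * (2 * u - 1)) + f b * (v * (2 * v - 1)) + f c * (w * (2 * w - 1))
     + 4 * (u * v * f ((1/2) *\<^sub>R (a + b)) + v * w * f ((1/2) *\<^sub>R (b + c)) + u * w * f ((1/2) *\<^sub>R (a + c)))"
    for f :: "real^2 \<Rightarrow> real"
  have J1: "J (\<lambda>x. 1) = 1" by (simp add: J_def s algebra_simps)
  have J2: "J (\<lambda>x. x $ i) = x $ i" for i by (simp add: J_def s xx field_simps)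
  have J3: "J (\<lambda>x. x $ i * x $ j) = x $ i * x $ j" for i j
    by (simp add: J_def s xx field_simps)
  have "J q = k 0 0 * J (\<lambda>x. 1) + k 0 1 * J (\<lambda>x. x $ 2) + k 0 2 * J (\<lambda>x. x $ 2 * x $ 2) + k 1 0 * J (\<lambda>x. x $ 1)
      + k 1 1 * J (\<lambda>x. x $ 1 * x $ 2) + k 2 0 * J (\<lambda>x. x $ 1 * x $ 1)"
    by (simp only: J_def q_def power2_eq_square) (simp only: ring_distribs mult_ac add_ac)
  then have "J q = q x" unfolding J1 J2 J3 by (simp add: q_def power2_eq_square)
  moreover have "J q = 0" using zq by (simp add: J_def)
  ultimately show ?thesis using pq[OF x] by simp
qed

section \<open>Gluing local primitives in the plane\<close>

text \<open>The number \<open>f x y\<close> is a prescribed increment from \<open>x\<close> to a nearby point \<open>y\<close>.\<close>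
definition primitive_on :: "('a::topological_space \<Rightarrow> 'a \<Rightarrow> real) \<Rightarrow> 'a set \<Rightarrow> ('a \<Rightarrow> real) \<Rightarrow> bool"
  where "primitive_on f A F \<longleftrightarrow> (\<forall>x\<in>A. \<forall>\<^sub>F y in nhds x. F y - F x = f x y)"

lemma primitive_on_subset: "primitive_on f A F \<Longrightarrow> B \<subseteq> A \<Longrightarrow> primitive_on f B F"
  by (auto simp: primitive_on_def)

lemma locally_constant_within:
  fixes f :: "'a::topological_space \<Rightarrow> 'b"
  assumes "connected S" and "\<And>x. x \<in> S \<Longrightarrow> \<forall>\<^sub>F y in nhds x. y \<in> S \<longrightarrow> f y = f x"
  obtains c where "\<And>x. x \<in> S \<Longrightarrow> f x = c"
proof -
  have "f constant_on S"
  proof (rule locally_constant_imp_constant[OF assms(1)])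
    fix a assume a: "a \<in> S"
    from assms(2)[OF this] obtain U where "open U" "a \<in> U" "\<forall>y\<in>U. y \<in> S \<longrightarrow> f y = f a"
      by (auto simp: eventually_nhds)
    then show "\<exists>T. openin (top_of_set S) T \<and> a \<in> T \<and> (\<forall>x\<in>T. f x = f a)"
      using a by (intro exI[of _ "S \<inter> U"] conjI openin_open_Int) blast+
  qed
  then show thesis using that by (auto simp: constant_on_def)
qed

text \<open>On the connected overlap the two primitives differ by a constant.\<close>
lemma primitive_on_Un:
  fixes f :: "'a::topological_space \<Rightarrow> 'a \<Rightarrow> real"
  assumes "open A" "open B" "connected (A \<inter> B)" "primitive_on f A F" "primitive_on f B F'"
  shows "\<exists>F''. primitive_on f (A \<union> B) F''"
proof -
  obtain c where c: "\<And>x. x \<in> A \<inter> B \<Longrightarrow> F x - F' x = c"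
  proof (rule locally_constant_within[OF assms(3), where f = "\<lambda>x. F x - F' x"])
    fix x assume "x \<in> A \<inter> B"
    then have "\<forall>\<^sub>F y in nhds x. F y - F x = f x y" "\<forall>\<^sub>F y in nhds x. F' y - F' x = f x y"
      using assms by (auto simp: primitive_on_def)
    then show "\<forall>\<^sub>F y in nhds x. y \<in> A \<inter> B \<longrightarrow> F y - F' y = F x - F' x"
      by eventually_elim auto
  qed auto
  define G where "G x = (if x \<in> A then F x else F' x + c)" for x
  have GB: "G x = F' x + c" if "x \<in> B" for x
    using c[of x] that by (auto simp: G_def)
  have "\<forall>\<^sub>F y in nhds x. G y - G x = f x y" if x: "x \<in> A \<union> B" for x
  proof (cases "x \<in> A")
    case True
    then have "\<forall>\<^sub>F y in nhds x. y \<in> A" using assms(1) by (rule eventually_nhds_in_open[rotated])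
    moreover have "\<forall>\<^sub>F y in nhds x. F y - F x = f x y"
      using True assms by (auto simp: primitive_on_def)
    ultimately show ?thesis by eventually_elim (use True in \<open>auto simp: G_def\<close>)
  next
    case False
    then have xB: "x \<in> B" using x by auto
    then have "\<forall>\<^sub>F y in nhds x. y \<in> B" using assms(2) by (rule eventually_nhds_in_open[rotated])
    moreover have "\<forall>\<^sub>F y in nhds x. F' y - F' x = f x y"
      using xB assms by (auto simp: primitive_on_def)
    ultimately show ?thesis by eventually_elim (use xB in \<open>auto simp: GB\<close>)
  qed
  then show ?thesis by (auto simp: primitive_on_def)
qed

definition rect :: "real \<Rightarrow> real \<Rightarrow> real \<Rightarrow> real \<Rightarrow> (real^2) set" where
  "rect a b c d = {x. a < x$1 \<and> x$1 < b \<and> c < x$2 \<and> x$2 < d}"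

lemma open_rect: "open (rect a b c d)"
  unfolding rect_def by (intro open_Collect_conj open_Collect_less continuous_intros)

lemma convex_rect: "convex (rect a b c d)"
proof -
  have "rect a b c d = {x. axis 1 1 \<bullet> x > a} \<inter> {x. axis 1 1 \<bullet> x < b} \<inter> {x. axis 2 1 \<bullet> x > c} \<inter> {x. axis 2 1 \<bullet> x < d}"
    by (auto simp: rect_def inner_axis')
  then show ?thesis by (auto intro!: convex_Int convex_halfspace_lt convex_halfspace_gt)
qed

text \<open>The hypothesis says that \<open>f x\<close> itself is a primitive near \<open>x\<close>. Small rectangles are first joined to
  a thin row and then rows are stacked. All overlaps are rectangles, hence connected.\<close>
lemma primitive_on_rect:
  fixes f :: "real^2 \<Rightarrow> real^2 \<Rightarrow> real"
  assumes cons: "\<And>x. \<forall>\<^sub>F y in nhds x. \<forall>\<^sub>F z in nhds y. f x z - f x y = f y z"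
    and le: "a \<le> b" "c \<le> d"
  shows "\<exists>F. primitive_on f (rect a b c d) F"
proof -
  have loc: "\<exists>e>0. \<exists>F. primitive_on f (rect (x$1-e) (x$1+e) (x$2-e) (x$2+e)) F" for x :: "real^2"
  proof -
    obtain e where e: "e > 0" and E: "\<And>y. dist y x < e \<Longrightarrow> \<forall>\<^sub>F z in nhds y. f x z - f x y = f y z"
      using cons[of x] by (auto simp: eventually_nhds_metric)
    have "primitive_on f (rect (x$1-e/2) (x$1+e/2) (x$2-e/2) (x$2+e/2)) (f x)"
      unfolding primitive_on_def
    proof (rule ballI, rule E)
      fix y :: "real^2" assume y: "y \<in> rect (x$1-e/2) (x$1+e/2) (x$2-e/2) (x$2+e/2)"
      have "dist y x \<le> \<bar>(y-x)$1\<bar> + \<bar>(y-x)$2\<bar>"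
        using norm_le_l1_cart[of "y - x"] by (simp add: dist_norm sum_2)
      also have "\<dots> < e" using y by (auto simp: rect_def)
      finally show "dist y x < e" .
    qed
    then show ?thesis using e by (intro exI[of _ "e/2"]) auto
  qed
  have row: "\<exists>\<delta>>0. \<exists>F. primitive_on f (rect (a-\<delta>) (b+\<delta>) (y-\<delta>) (y+\<delta>)) F" for y
    using le(1)
  proof (induction rule: Bolzano)
    case (trans a b c)
    then obtain d1 F1 d2 F2 where d: "d1 > 0" "d2 > 0"
      and F: "primitive_on f (rect (a-d1) (b+d1) (y-d1) (y+d1)) F1" "primitive_on f (rect (b-d2) (c+d2) (y-d2) (y+d2)) F2"
      by blast
    define e where "e = min d1 d2"
    have e: "e > 0" using d by (auto simp: e_def)
    have "primitive_on f (rect (a-e) (b+e) (y-e) (y+e)) F1"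
      by (rule primitive_on_subset[OF F(1)]) (auto simp: rect_def e_def)
    moreover have "primitive_on f (rect (b-e) (c+e) (y-e) (y+e)) F2"
      by (rule primitive_on_subset[OF F(2)]) (auto simp: rect_def e_def)
    ultimately obtain F where "primitive_on f (rect (a-e) (b+e) (y-e) (y+e) \<union> rect (b-e) (c+e) (y-e) (y+e)) F"
      using primitive_on_Un[OF open_rect open_rect convex_connected[OF convex_Int[OF convex_rect convex_rect]]] by blast
    then have "primitive_on f (rect (a-e) (c+e) (y-e) (y+e)) F"
      by (rule primitive_on_subset) (use e in \<open>auto simp: rect_def\<close>)
    then show ?case using e by blast
  next
    case (local x)
    obtain e F where e: "e > 0" "primitive_on f (rect (x-e) (x+e) (y-e) (y+e)) F"
      using loc[of "vector [x,y]"] by auto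
    show ?case
    proof (rule exI[of _ "e/2"], intro conjI allI impI)
      fix a b assume "a \<le> x \<and> x \<le> b \<and> b - a < e/2"
      then show "\<exists>\<delta>>0. \<exists>F. primitive_on f (rect (a-\<delta>) (b+\<delta>) (y-\<delta>) (y+\<delta>)) F"
        using e(1) by (intro exI[of _ "e/2"] conjI exI[of _ F] primitive_on_subset[OF e(2)]) (auto simp: rect_def)
    qed (use e in auto)
  qed
  have "\<exists>\<delta>>0. \<exists>F. primitive_on f (rect (a-\<delta>) (b+\<delta>) (c-\<delta>) (d+\<delta>)) F"
    using le(2)
  proof (induction rule: Bolzano)
    case (trans c d d')
    then obtain d1 F1 d2 F2 where d: "d1 > 0" "d2 > 0"
      and F: "primitive_on f (rect (a-d1) (b+d1) (c-d1) (d+d1)) F1" "primitive_on f (rect (a-d2) (b+d2) (d-d2) (d'+d2)) F2"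
      by blast
    define e where "e = min d1 d2"
    have e: "e > 0" using d by (auto simp: e_def)
    have "primitive_on f (rect (a-e) (b+e) (c-e) (d+e)) F1"
      by (rule primitive_on_subset[OF F(1)]) (auto simp: rect_def e_def)
    moreover have "primitive_on f (rect (a-e) (b+e) (d-e) (d'+e)) F2"
      by (rule primitive_on_subset[OF F(2)]) (auto simp: rect_def e_def)
    ultimately obtain F where "primitive_on f (rect (a-e) (b+e) (c-e) (d+e) \<union> rect (a-e) (b+e) (d-e) (d'+e)) F"
      using primitive_on_Un[OF open_rect open_rect convex_connected[OF convex_Int[OF convex_rect convex_rect]]] by blast
    then have "primitive_on f (rect (a-e) (b+e) (c-e) (d'+e)) F"
      by (rule primitive_on_subset) (use e in \<open>auto simp: rect_def\<close>)
    then show ?case using e by blast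
  next
    case (local y)
    obtain e F where e: "e > 0" "primitive_on f (rect (a-e) (b+e) (y-e) (y+e)) F"
      using row[of y] by auto
    show ?case
    proof (rule exI[of _ "e/2"], intro conjI allI impI)
      fix c d assume "c \<le> y \<and> y \<le> d \<and> d - c < e/2"
      then show "\<exists>\<delta>>0. \<exists>F. primitive_on f (rect (a-\<delta>) (b+\<delta>) (c-\<delta>) (d+\<delta>)) F"
        using e(1) by (intro exI[of _ "e/2"] conjI exI[of _ F] primitive_on_subset[OF e(2)]) (auto simp: rect_def)
    qed (use e in auto)
  qed
  then obtain \<delta> F where \<delta>: "\<delta> > 0" and F: "primitive_on f (rect (a-\<delta>) (b+\<delta>) (c-\<delta>) (d+\<delta>)) F" by blast
  have "primitive_on f (rect a b c d) F"
    by (rule primitive_on_subset[OF F]) (use \<delta> in \<open>auto simp: rect_def\<close>)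
  then show ?thesis by blast
qed

lemma connected_Compl_simply_connected:
  fixes S :: "(real^2) set"
  assumes "open S" "bounded S" "simply_connected S"
  shows "connected (- S)"
proof -
  define h :: "real^2 \<Rightarrow> complex" where "h x = Complex (x$1) (x$2)" for x
  define k :: "complex \<Rightarrow> real^2" where "k z = vector [Re z, Im z]" for z
  have hk: "h (k z) = z" "k (h x) = x" for x z
    by (auto simp: h_def k_def vec_eq_iff forall_2)
  have lh: "linear h" by (auto simp: h_def linear_iff complex_eq_iff)
  have lk: "linear k" by (auto simp: k_def linear_iff vec_eq_iff forall_2)
  have ch: "continuous_on A h" for A by (rule linear_continuous_on) (use lh in \<open>simp add: linear_conv_bounded_linear\<close>)
  have ck: "continuous_on A k" for A by (rule linear_continuous_on) (use lk in \<open>simp add: linear_conv_bounded_linear\<close>)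
  have im: "h ` S = k -` S"
  proof (intro equalityI subsetI)
    fix z assume "z \<in> k -` S" then show "z \<in> h ` S" using hk(1)[of z] by (metis image_eqI vimageE)
  qed (auto simp: hk)
  have hom: "S homeomorphic (h ` S)"
    unfolding homeomorphic_def homeomorphism_def
    by (intro exI[of _ h] exI[of _ k]) (auto simp: hk ch ck image_image)
  have "open (h ` S)" unfolding im by (rule open_vimage[OF assms(1)]) (rule ck)
  moreover have "bounded (h ` S)"
    by (rule bounded_linear_image[OF assms(2)]) (use lh in \<open>simp add: linear_conv_bounded_linear\<close>)
  moreover have "simply_connected (h ` S)"
    using assms(3) homeomorphic_simply_connected_eq[OF hom] by blast
  ultimately have "connected (- (h ` S))" by (simp add: simply_connected_iff_simple)
  then have "connected (k ` (- (h ` S)))" by (rule connected_continuous_image[OF ck])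
  moreover have "k ` (- (h ` S)) = - S" unfolding im
  proof (intro equalityI subsetI)
    fix x assume "x \<in> - S" then show "x \<in> k ` (- (k -` S))" by (intro image_eqI[of _ _ "h x"]) (auto simp: hk)
  qed auto
  ultimately show ?thesis by simp
qed

lemma eventually_closed_family:
  assumes "finite \<A>" "\<And>A. A \<in> \<A> \<Longrightarrow> closed A"
  shows "\<forall>\<^sub>F y in nhds x. \<forall>A\<in>\<A>. y \<in> A \<longrightarrow> x \<in> A"
proof (rule eventually_ball_finite[OF assms(1)], rule ballI)
  fix A assume A: "A \<in> \<A>"
  show "\<forall>\<^sub>F y in nhds x. y \<in> A \<longrightarrow> x \<in> A"
  proof (cases "x \<in> A")
    case False
    then have "\<forall>\<^sub>F y in nhds x. y \<in> - A"
      using assms(2)[OF A] by (intro eventually_nhds_in_open) auto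
    then show ?thesis by eventually_elim auto
  qed auto
qed

section \<open>Regular triangulations\<close>

lemma verts_subset: "verts S \<subseteq> S"
  by (auto simp: verts_def extreme_point_of_def)

locale triangulated_polygon =
  fixes \<Omega> :: "(real^2) set" and \<T> :: "(real^2) set set"
  assumes polygon: "lipschitz_polygon \<Omega>" and reg: "regular_triangulation \<T> \<Omega>"
begin

lemma open_\<Omega>: "open \<Omega>" and bounded_\<Omega>: "bounded \<Omega>"
  and lipschitz_\<Omega>: "lipschitz_boundary \<Omega>"
  using polygon by (auto simp: lipschitz_polygon_def)

lemma finite_\<T>: "finite \<T>"
  and cover: "\<Union>\<T> = closure \<Omega>"
  and simplex_\<T>: "T \<in> \<T> \<Longrightarrow> 2 simplex T"
  and face_\<T>: "T \<in> \<T> \<Longrightarrow> T' \<in> \<T> \<Longrightarrow> (T \<inter> T') face_of T"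
  using reg by (auto simp: regular_triangulation_def triangulation_def)

lemma tri_\<T>: assumes "T \<in> \<T>" obtains a b c where "tri a b c T"
  using simplex_tri[OF simplex_\<T>[OF assms]] .

lemma closed_\<T>: "T \<in> \<T> \<Longrightarrow> closed T" and convex_\<T>: "T \<in> \<T> \<Longrightarrow> convex T"
  and interior_\<T>: "T \<in> \<T> \<Longrightarrow> interior T \<noteq> {}" and compact_\<T>: "T \<in> \<T> \<Longrightarrow> compact T"
  by (meson tri_\<T> tri_compact tri_convex tri_interior compact_imp_closed)+

lemma finite_verts: "T \<in> \<T> \<Longrightarrow> finite (verts T)"
  using tri_\<T>[of T] tri_verts by (metis finite.emptyI finite.insertI)

lemma finite_vertices: "finite (vertices \<T>)"
  unfolding vertices_def using finite_\<T> finite_verts by blast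

text \<open>The common face is spanned by vertices of each triangle, and the two spanning sets coincide because
  they are the extreme points of the face.\<close>
lemma common_face:
  assumes "T \<in> \<T>" "T' \<in> \<T>"
  obtains S where "finite S" "S \<subseteq> verts T" "S \<subseteq> verts T'" "T \<inter> T' = convex hull S"
proof -
  have face: "\<exists>c\<subseteq>verts T. T \<inter> T' = convex hull c" if TT: "T \<in> \<T>" "T' \<in> \<T>" for T T'
  proof -
    obtain x y z where t: "tri x y z T" using tri_\<T>[OF TT(1)] .
    have "(T \<inter> T') face_of convex hull {x, y, z}" using face_\<T>[OF TT] t by (simp add: tri_def)
    then show ?thesis
      using face_of_convex_hull_affine_independent[of "{x,y,z}" "T \<inter> T'"] t tri_verts[OF t] by (auto simp: tri_def)
  qed
  obtain c where c: "c \<subseteq> verts T" "T \<inter> T' = convex hull c" using face[OF assms] by blast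
  obtain c' where c': "c' \<subseteq> verts T'" "T \<inter> T' = convex hull c'" using face[OF assms(2,1)] by (auto simp: Int_commute)
  have "c \<subseteq> c'"
  proof
    fix z assume z: "z \<in> c"
    then have "z \<in> T \<inter> T'" unfolding c(2) by (rule hull_inc)
    then have "z extreme_point_of (T \<inter> T')"
      using z c(1) by (auto simp: verts_def extreme_point_of_def)
    then show "z \<in> c'" unfolding c'(2) by (rule extreme_point_of_convex_hull)
  qed
  then have "c \<subseteq> verts T'" using c'(1) by (rule order_trans)
  moreover have "finite c" using c(1) finite_verts[OF assms(1)] by (rule finite_subset)
  ultimately show thesis using that c by simp
qed

lemma nodal_compat:
  assumes "T \<in> \<T>" "T' \<in> \<T>" "x \<in> T" "x \<in> T'"
  shows "nodal T z x = nodal T' z x"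
proof -
  obtain S where S: "finite S" "S \<subseteq> verts T" "S \<subseteq> verts T'" "T \<inter> T' = convex hull S"
    using common_face[OF assms(1,2)] .
  have "x \<in> convex hull S" using S(4) assms by blast
  then obtain \<mu> where \<mu>: "sum \<mu> S = 1" "(\<Sum>v\<in>S. \<mu> v *\<^sub>R v) = x"
    unfolding convex_hull_finite[OF S(1)] by blast
  obtain a b c where t: "tri a b c T" using tri_\<T>[OF assms(1)] .
  obtain a' b' c' where t': "tri a' b' c' T'" using tri_\<T>[OF assms(2)] .
  show ?thesis
    using nodal_combination[OF t S(1,2) \<mu>(1), of z] nodal_combination[OF t' S(1,3) \<mu>(1), of z]
    by (simp add: \<mu>(2))
qed

lemma nodal_verts:
  assumes "T \<in> \<T>" "v \<in> verts T" shows "nodal T z v = (if z = v then 1 else 0)"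
proof -
  obtain a b c where t: "tri a b c T" using tri_\<T>[OF assms(1)] .
  show ?thesis using nodal_combination[OF t, of "{v}" "\<lambda>_. 1" z] assms(2) by simp
qed

lemma vertex_in_verts:
  assumes "T \<in> \<T>" "z \<in> vertices \<T>" "z \<in> T" shows "z \<in> verts T"
proof -
  obtain T' where T': "T' \<in> \<T>" "z \<in> verts T'" using assms(2) by (auto simp: vertices_def)
  then have "nodal T z z = 1"
    using nodal_compat[OF assms(1) T'(1) assms(3)] nodal_verts[OF T'] verts_subset[of T'] by auto
  then show ?thesis using nodal_not_vert by fastforce
qed

lemma hat_eq:
  "hat \<T> z = (\<lambda>x. if x \<in> \<Union>\<T> then nodal (SOME T. T \<in> \<T> \<and> x \<in> T) z x else 0)"
proof -
  define h where "h = (\<lambda>x. if x \<in> \<Union>\<T> then nodal (SOME T. T \<in> \<T> \<and> x \<in> T) z x else 0)"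
  have h: "h x = nodal T z x" if "T \<in> \<T>" "x \<in> T" for x T
  proof -
    define T0 where "T0 = (SOME T. T \<in> \<T> \<and> x \<in> T)"
    have T0: "T0 \<in> \<T> \<and> x \<in> T0"
      unfolding T0_def by (rule someI_ex) (use that in blast)
    have "h x = nodal T0 z x" using that by (auto simp: h_def T0_def)
    also have "\<dots> = nodal T z x" by (rule nodal_compat) (use T0 that in auto)
    finally show ?thesis .
  qed
  have hv: "h y = (if y = z then 1 else 0)" if y: "y \<in> vertices \<T>" for y
  proof -
    obtain T where T: "T \<in> \<T>" "y \<in> verts T" using y by (auto simp: vertices_def)
    then show ?thesis using h[OF T(1)] verts_subset[of T] nodal_verts[OF T] by auto
  qed
  have "hat \<T> z = h"
    unfolding hat_def
  proof (rule the_equality)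
    have "h \<in> P 1 T" if T: "T \<in> \<T>" for T
    proof -
      obtain a b c where t: "tri a b c T" using tri_\<T>[OF T] .
      obtain \<alpha> \<beta> where n: "\<And>x. nodal T z x = \<alpha> + \<beta> \<bullet> x" using nodal_affine[OF t] by blast
      show ?thesis by (rule P_cong[of "\<lambda>x. \<alpha> + \<beta> \<bullet> x"]) (use P_affine[of \<alpha> \<beta> 0 T] h[OF T] n in auto)
    qed
    then show "h \<in> piecewise \<T> (P 1) \<and> (\<forall>y\<in>vertices \<T>. h y = (if y = z then 1 else 0))"
      using hv by (auto simp: piecewise_def h_def)
    fix f assume f: "f \<in> piecewise \<T> (P 1) \<and> (\<forall>y\<in>vertices \<T>. f y = (if y = z then 1 else 0))"
    show "f = h"
    proof
      fix x
      show "f x = h x"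
      proof (cases "x \<in> \<Union>\<T>")
        case True
        then obtain T where T: "T \<in> \<T>" "x \<in> T" by blast
        obtain a b c where t: "tri a b c T" using tri_\<T>[OF T(1)] .
        have V: "a \<in> vertices \<T>" "b \<in> vertices \<T>" "c \<in> vertices \<T>"
          using T(1) tri_verts[OF t] by (auto simp: vertices_def)
        have "f \<in> P 1 T" using f T by (auto simp: piecewise_def)
        from P1_interpolation[OF t this T(2)]
        have "f x = (if a = z then 1 else 0) * nodal T a x + (if b = z then 1 else 0) * nodal T b x + (if c = z then 1 else 0) * nodal T c x"
          using f V by simp
        also have "\<dots> = nodal T z x"
          using tri_distinct[OF t] nodal_not_vert[of z T x] tri_verts[OF t] by auto
        finally show ?thesis using h[OF T] by simp
      qed (use f in \<open>auto simp: piecewise_def h_def\<close>)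
    qed
  qed
  then show ?thesis by (simp add: h_def)
qed

lemma hat_nodal:
  assumes "T \<in> \<T>" "x \<in> T" shows "hat \<T> z x = nodal T z x"
proof -
  define T0 where "T0 = (SOME T. T \<in> \<T> \<and> x \<in> T)"
  have T0: "T0 \<in> \<T> \<and> x \<in> T0"
    unfolding T0_def by (rule someI_ex) (use assms in blast)
  have "hat \<T> z x = nodal T0 z x" using assms by (auto simp: hat_eq T0_def)
  also have "\<dots> = nodal T z x" by (rule nodal_compat) (use T0 assms in auto)
  finally show ?thesis .
qed

lemma hat_outside: "x \<notin> \<Union>\<T> \<Longrightarrow> hat \<T> z x = 0"
  by (simp add: hat_eq)

lemma tri_edge: assumes "tri a b c T" shows "closed_segment a b edge_of T"
proof -
  have "closed_segment a b face_of T"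
  proof -
    have "\<exists>S\<subseteq>{a,b,c}. convex hull {a,b} = convex hull S" by (intro exI[of _ "{a,b}"]) auto
    moreover have "\<not> affine_dependent {a,b,c}" "T = convex hull {a,b,c}" using assms by (auto simp: tri_def)
    ultimately show ?thesis
      unfolding segment_convex_hull by (metis face_of_convex_hull_affine_independent)
  qed
  moreover have "aff_dim (closed_segment a b) = 1"
    using tri_distinct[OF assms] by (simp only: segment_convex_hull aff_dim_convex_hull aff_dim_2) simp
  ultimately show ?thesis by (simp add: edge_of_def)
qed

lemma edge_tri:
  assumes "T \<in> \<T>" "F edge_of T" obtains a b c where "tri a b c T" "F = closed_segment a b"
proof -
  obtain a b c where t: "tri a b c T" using tri_\<T>[OF assms(1)] .
  obtain S where S: "S \<subseteq> {a,b,c}" "F = convex hull S"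
    using assms(2) t face_of_convex_hull_affine_independent[of "{a,b,c}" F] by (auto simp: tri_def edge_of_def)
  have "aff_dim F = 1" using assms(2) by (simp add: edge_of_def)
  then have "aff_dim S = 1" by (simp only: S(2) aff_dim_convex_hull)
  moreover have "\<not> affine_dependent S" using S(1) t affine_independent_subset by (auto simp: tri_def)
  ultimately have "card S = 2" using aff_dim_affine_independent by force
  then obtain x y where xy: "S = {x, y}" "x \<noteq> y" by (auto simp: card_2_iff)
  then have F: "F = closed_segment x y" using S(2) by (simp add: segment_convex_hull)
  have xy': "x \<in> {a,b,c}" "y \<in> {a,b,c}" using xy S(1) by auto
  obtain z where "tri x y z T" using xy' xy(2) t tri_perms[OF t] by auto
  then show thesis using that F by blast
qed

lemma verts_segment: "verts (closed_segment a b) = {a, b}"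
  by (auto simp: verts_def extreme_point_of_segment)

lemma barycentre_segment: "a \<noteq> b \<Longrightarrow> barycentre (closed_segment a b) = (1/2) *\<^sub>R (a + b)"
  by (simp add: barycentre_def verts_segment)

lemma edges_iff: "F \<in> edges \<T> \<longleftrightarrow> (\<exists>T a b c. T \<in> \<T> \<and> tri a b c T \<and> F = closed_segment a b)"
proof
  assume "F \<in> edges \<T>"
  then obtain T where T: "T \<in> \<T>" "F edge_of T" by (auto simp: edges_def)
  obtain a b c where "tri a b c T" "F = closed_segment a b" using edge_tri[OF T] .
  with T show "\<exists>T a b c. T \<in> \<T> \<and> tri a b c T \<and> F = closed_segment a b" by metis
next
  assume "\<exists>T a b c. T \<in> \<T> \<and> tri a b c T \<and> F = closed_segment a b"
  then obtain T a b c where T: "T \<in> \<T>" "F = closed_segment a b" and t: "tri a b c T" by (elim exE conjE)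
  show "F \<in> edges \<T>" unfolding edges_def T(2) using T(1) tri_edge[OF t] by blast
qed

lemma edgesE:
  assumes "F \<in> edges \<T>" obtains T a b c where "T \<in> \<T>" "tri a b c T" "F = closed_segment a b"
  using assms[unfolded edges_iff] by (elim exE conjE)

lemma finite_edges: "finite (edges \<T>)"
proof -
  have "edges \<T> \<subseteq> (\<lambda>(a, b). closed_segment a b) ` (vertices \<T> \<times> vertices \<T>)"
  proof
    fix F assume "F \<in> edges \<T>"
    then obtain T a b c where T: "T \<in> \<T>" "tri a b c T" "F = closed_segment a b" by (rule edgesE)
    then have "(a, b) \<in> vertices \<T> \<times> vertices \<T>" using tri_verts[OF T(2)] by (auto simp: vertices_def)
    then show "F \<in> (\<lambda>(a, b). closed_segment a b) ` (vertices \<T> \<times> vertices \<T>)"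
      using T(3) by (intro image_eqI[of _ _ "(a, b)"]) auto
  qed
  then show ?thesis by (rule finite_subset) (intro finite_imageI finite_cartesian_product finite_vertices)
qed

lemma edge_bubble_segment: "a \<noteq> b \<Longrightarrow> edge_bubble \<T> (closed_segment a b) x = hat \<T> a x * hat \<T> b x"
  by (simp add: edge_bubble_def verts_segment)

section \<open>The boundary of a triangulated polygon\<close>

text \<open>In a chart at \<open>x\<close> the points above the graph lie outside the closure. This excludes slits.\<close>
lemma frontier_exterior: assumes "x \<in> frontier \<Omega>" shows "x \<in> closure (- closure \<Omega>)"
proof -
  obtain e r h \<gamma> L where e: "norm e = 1" "r > 0" "h > 0" "L-lipschitz_on {-r<..<r} \<gamma>"
    and h: "\<forall>s\<in>{-r<..<r}. \<bar>\<gamma> s\<bar> < h"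
    and ch: "\<forall>s\<in>{-r<..<r}. \<forall>t\<in>{-h<..<h}.
          (x + s *\<^sub>R e + t *\<^sub>R (rot90 *v e) \<in> \<Omega> \<longleftrightarrow> t < \<gamma> s) \<and>
          (x + s *\<^sub>R e + t *\<^sub>R (rot90 *v e) \<in> frontier \<Omega> \<longleftrightarrow> t = \<gamma> s)"
    using lipschitz_\<Omega> assms unfolding lipschitz_boundary_def by blast
  have ch0: "t \<in> {-h<..<h} \<Longrightarrow> (x + t *\<^sub>R (rot90 *v e) \<in> \<Omega> \<longleftrightarrow> t < \<gamma> 0) \<and> (x + t *\<^sub>R (rot90 *v e) \<in> frontier \<Omega> \<longleftrightarrow> t = \<gamma> 0)" for t
    using ch[rule_format, of 0 t] e(2) by simp
  have "\<gamma> 0 = 0" using ch0[of 0] assms e(3) by simp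
  then have ext: "x + t *\<^sub>R (rot90 *v e) \<in> - closure \<Omega>" if "0 < t" "t < h" for t
    using ch0[of t] that closure_Un_frontier[of \<Omega>] by auto
  have "((\<lambda>t. x + t *\<^sub>R (rot90 *v e)) \<longlongrightarrow> x) (at_right 0)"
    by (auto intro!: tendsto_eq_intros)
  moreover have "\<forall>\<^sub>F t in at_right 0. x + t *\<^sub>R (rot90 *v e) \<in> closure (- closure \<Omega>)"
    using eventually_at_right_real[OF e(3)] by eventually_elim (rule subsetD[OF closure_subset ext], auto)
  ultimately show ?thesis
    by (rule Lim_in_closed_set[OF closed_closure _ trivial_limit_at_right_real, rotated 1])
qed

lemma interior_closure: "interior (closure \<Omega>) = \<Omega>"
proof
  show "\<Omega> \<subseteq> interior (closure \<Omega>)" by (rule interior_maximal[OF closure_subset open_\<Omega>])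
  show "interior (closure \<Omega>) \<subseteq> \<Omega>"
  proof
    fix x assume x: "x \<in> interior (closure \<Omega>)"
    show "x \<in> \<Omega>"
    proof (rule ccontr)
      assume "x \<notin> \<Omega>"
      then have "x \<in> frontier \<Omega>" using x interior_subset open_\<Omega> by (auto simp: frontier_def interior_open)
      from frontier_exterior[OF this] show False using x by (simp add: closure_complement)
    qed
  qed
qed

lemma interior_subset_\<Omega>: "T \<in> \<T> \<Longrightarrow> interior T \<subseteq> \<Omega>"
  using interior_mono[of T "closure \<Omega>"] cover interior_closure by blast

lemma tri_interior_mem:
  assumes t: "tri a b c T" and "nodal T a y > 0" "nodal T b y > 0" "nodal T c y > 0"
  shows "y \<in> interior T"
proof -
  have o: "open {x. nodal T z x > 0}" for z
  proof -
    obtain \<alpha> \<beta> where n: "\<And>x. nodal T z x = \<alpha> + \<beta> \<bullet> x" using nodal_affine[OF t] by blast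
    show ?thesis unfolding n by (intro open_Collect_less continuous_intros)
  qed
  show ?thesis
    by (rule interiorI[of "{x. nodal T a x > 0} \<inter> {x. nodal T b x > 0} \<inter> {x. nodal T c x > 0}"])
       (use assms o in \<open>auto simp: tri_mem_iff[OF t]\<close>)
qed

lemma open_segment_nodal:
  assumes t: "tri a b c T"
  shows "y \<in> open_segment a b \<longleftrightarrow> nodal T a y > 0 \<and> nodal T b y > 0 \<and> nodal T c y = 0"
proof
  assume "y \<in> open_segment a b"
  then obtain s where s: "0 < s" "s < 1" "y = (1 - s) *\<^sub>R a + s *\<^sub>R b" by (auto simp: in_segment)
  then show "nodal T a y > 0 \<and> nodal T b y > 0 \<and> nodal T c y = 0"
    using nodal_unique3[OF t, of "1 - s" s 0] nodal_unique3[OF tri_perms(1)[OF t], of s 0 "1 - s"]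
      nodal_unique3[OF tri_perms(2)[OF t], of 0 "1 - s" s] by (simp add: add.commute)
next
  assume n: "nodal T a y > 0 \<and> nodal T b y > 0 \<and> nodal T c y = 0"
  then have 1: "nodal T a y = 1 - nodal T b y" "nodal T b y < 1" using nodal_sum3(1)[OF t, of y] by auto
  have "y = nodal T a y *\<^sub>R a + nodal T b y *\<^sub>R b" using nodal_sum3(2)[OF t, of y] n by simp
  then have "y = (1 - nodal T b y) *\<^sub>R a + nodal T b y *\<^sub>R b" "nodal T b y < 1" using 1 by auto
  then show "y \<in> open_segment a b" using n tri_distinct[OF t] by (auto simp: in_segment)
qed

lemma on_open_edge:
  assumes T: "T \<in> \<T>" and y: "y \<in> T" "y \<notin> verts T" "y \<notin> interior T"
  obtains a b c where "tri a b c T" "y \<in> open_segment a b"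
proof -
  note goal = that
  obtain a b c where t: "tri a b c T" using tri_\<T>[OF T] .
  have key: "thesis" if t: "tri a b c T" and z: "nodal T c y = 0" for a b c
  proof -
    have s: "nodal T a y + nodal T b y = 1" "nodal T a y *\<^sub>R a + nodal T b y *\<^sub>R b = y"
      using nodal_sum3[OF t, of y] z by simp_all
    have ny: "y \<noteq> a" "y \<noteq> b" using y(2) tri_verts[OF t] by auto
    have "nodal T a y \<noteq> 0"
    proof
      assume 0: "nodal T a y = 0"
      with s(1) have "nodal T b y = 1" by simp
      with 0 s(2) ny show False by simp
    qed
    moreover have "nodal T b y \<noteq> 0"
    proof
      assume 0: "nodal T b y = 0"
      with s(1) have "nodal T a y = 1" by simp
      with 0 s(2) ny show False by simp
    qed
    ultimately have "y \<in> open_segment a b"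
      using z y(1) unfolding tri_mem_iff[OF t] open_segment_nodal[OF t] by auto
    with t show thesis by (rule goal)
  qed
  have "nodal T a y = 0 \<or> nodal T b y = 0 \<or> nodal T c y = 0"
    using tri_interior_mem[OF t, of y] y unfolding tri_mem_iff[OF t] by force
  then show thesis using key[OF t] key[OF tri_perms(1)[OF t]] key[OF tri_perms(2)[OF t]] by blast
qed

lemma opposite_side_sign:
  assumes t: "tri a b c T"
  shows "nodal T c x = cross2 (b - a) (x - a) / cross2 (b - a) (c - a)"
proof -
  have "cross2 (a - x) (b - x) = cross2 (b - a) (x - a)" "cross2 (a - c) (b - c) = cross2 (b - a) (c - a)"
    by (simp_all add: cross2_def algebra_simps)
  then show ?thesis by (simp add: nodal_bary_all[OF t] bary_def)
qed

lemma edge_point_third: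
  assumes T: "T \<in> \<T>" "tri a b c T" and T': "T' \<in> \<T>" and y: "y \<in> open_segment a b" "y \<in> T'"
  obtains c' where "tri a b c' T'"
proof -
  have yT: "y \<in> T" using y(1) open_segment_nodal[OF T(2)] by (auto simp: tri_mem_iff[OF T(2)])
  have "nodal T' a y > 0" "nodal T' b y > 0"
    using nodal_compat[OF T(1) T' yT y(2)] y(1) open_segment_nodal[OF T(2)] by auto
  then have "a \<in> verts T'" "b \<in> verts T'" using nodal_not_vert[of _ T' y] by (metis less_irrefl)+
  moreover obtain p q r where t: "tri p q r T'" using tri_\<T>[OF T'] .
  ultimately show thesis using that tri_distinct[OF T(2)] tri_verts[OF t] tri_perms[OF t] t by auto
qed

text \<open>Near \<open>y\<close> every triangle that contains the edge \<open>[a, b]\<close> fills the half disc on its side of the edge,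
  and no other triangle is present. Hence \<open>y\<close> is interior exactly if some triangle lies on the side
  opposite to \<open>T\<close>, a condition that does not depend on the position of \<open>y\<close> on the edge.\<close>
lemma open_edge_interior_iff:
  assumes T: "T \<in> \<T>" "tri a b c T" and y: "y \<in> open_segment a b"
  shows "y \<in> \<Omega> \<longleftrightarrow> (\<exists>T'\<in>\<T>. \<exists>c'. tri a b c' T' \<and> cross2 (b - a) (c' - a) * cross2 (b - a) (c - a) < 0)"
proof
  let ?s = "\<lambda>x. cross2 (b - a) (x - a)"
  assume "\<exists>T'\<in>\<T>. \<exists>c'. tri a b c' T' \<and> ?s c' * ?s c < 0"
  then obtain T' c' where T': "T' \<in> \<T>" "tri a b c' T'" "?s c' * ?s c < 0" by blast
  have near: "\<forall>\<^sub>F x in nhds y. 0 \<le> nodal T c x \<longrightarrow> x \<in> T" if T: "tri a b c T" for T c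
  proof -
    have o: "\<forall>\<^sub>F x in nhds y. nodal T z x > 0" if z: "nodal T z y > 0" for z
    proof -
      obtain \<alpha> \<beta> where n: "\<And>x. nodal T z x = \<alpha> + \<beta> \<bullet> x" using nodal_affine[OF T] by blast
      have "open {x. nodal T z x > 0}" unfolding n by (intro open_Collect_less continuous_intros)
      from eventually_nhds_in_open[OF this, of y] z show ?thesis by simp
    qed
    have "\<forall>\<^sub>F x in nhds y. nodal T a x > 0" "\<forall>\<^sub>F x in nhds y. nodal T b x > 0"
      using o y open_segment_nodal[OF T] by auto
    then show ?thesis by eventually_elim (auto simp: tri_mem_iff[OF T])
  qed
  have "\<forall>\<^sub>F x in nhds y. x \<in> T \<union> T'"
    using near[OF T(2)] near[OF T'(2)]
  proof eventually_elim
    case (elim x)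
    have "0 \<le> nodal T c x \<or> 0 \<le> nodal T' c' x"
      using T'(3) unfolding opposite_side_sign[OF T(2)] opposite_side_sign[OF T'(2)]
      by (auto simp: zero_le_divide_iff mult_less_0_iff)
    then show ?case using elim by blast
  qed
  then have "y \<in> interior (closure \<Omega>)"
    using T(1) T'(1) cover unfolding eventually_nhds interior_def by blast
  then show "y \<in> \<Omega>" by (simp add: interior_closure)
next
  let ?s = "\<lambda>x. cross2 (b - a) (x - a)"
  assume "y \<in> \<Omega>"
  have lim: "filterlim (\<lambda>t. y - t *\<^sub>R (c - y)) (nhds y) (at_right 0)"
    by (auto intro!: tendsto_eq_intros)
  have e1: "\<forall>\<^sub>F x in nhds y. x \<in> \<Omega>" using open_\<Omega> \<open>y \<in> \<Omega>\<close> by (rule eventually_nhds_in_open)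
  have e2: "\<forall>\<^sub>F x in nhds y. \<forall>T\<in>\<T>. x \<in> T \<longrightarrow> y \<in> T"
    by (rule eventually_closed_family[OF finite_\<T> closed_\<T>])
  have "\<forall>\<^sub>F t in at_right 0. y - t *\<^sub>R (c - y) \<in> \<Omega> \<and> (\<forall>T\<in>\<T>. y - t *\<^sub>R (c - y) \<in> T \<longrightarrow> y \<in> T)"
    by (rule filterlim_iff[THEN iffD1, rule_format, OF lim eventually_conj[OF e1 e2]])
  then have "\<forall>\<^sub>F t in at_right 0. t > 0 \<and> y - t *\<^sub>R (c - y) \<in> \<Omega> \<and> (\<forall>T\<in>\<T>. y - t *\<^sub>R (c - y) \<in> T \<longrightarrow> y \<in> T)"
    using eventually_at_right_less[of 0] by eventually_elim auto
  then obtain t where t: "t > 0" "y - t *\<^sub>R (c - y) \<in> \<Omega>" "\<forall>T\<in>\<T>. y - t *\<^sub>R (c - y) \<in> T \<longrightarrow> y \<in> T"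
    using eventually_happens'[OF trivial_limit_at_right_real] by blast
  define x where "x = y - t *\<^sub>R (c - y)"
  have "x \<in> \<Union>\<T>" using t(2) closure_subset[of \<Omega>] cover by (auto simp: x_def)
  then obtain T' where T': "T' \<in> \<T>" "x \<in> T'" by blast
  then have "y \<in> T'" using t(3) by (simp add: x_def)
  then obtain c' where c': "tri a b c' T'" using edge_point_third[OF T T'(1) y] by blast
  have D: "?s c \<noteq> 0" "?s c' \<noteq> 0" using tri_cross2[OF T(2)] tri_cross2[OF c'] by auto
  have "?s y = 0"
    using y open_segment_nodal[OF T(2)] D(1) by (simp add: opposite_side_sign[OF T(2)])
  moreover have "?s (y - t *\<^sub>R (c - y)) = (1 + t) * ?s y - t * ?s c"
    by (simp add: cross2_def algebra_simps)
  ultimately have sx: "?s x = - t * ?s c" by (simp add: x_def)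
  have "0 \<le> ?s x / ?s c'" using T'(2) by (simp add: tri_mem_iff[OF c'] opposite_side_sign[OF c'])
  then have "0 \<le> ?s x / ?s c' * (?s c' * ?s c')" by (rule mult_nonneg_nonneg) simp
  also have "\<dots> = - t * (?s c' * ?s c)" using D by (simp add: sx)
  finally have "?s c' * ?s c \<le> 0" using t(1) by (simp add: mult_le_0_iff)
  then have "?s c' * ?s c < 0" using D by (simp add: less_le)
  then show "\<exists>T'\<in>\<T>. \<exists>c'. tri a b c' T' \<and> ?s c' * ?s c < 0" using T'(1) c' by blast
qed

lemma boundary_edge:
  assumes T: "T \<in> \<T>" "tri a b c T" and y: "y \<in> open_segment a b" "y \<in> frontier \<Omega>"
  shows "closed_segment a b \<subseteq> frontier \<Omega>"
proof -
  have "y \<notin> \<Omega>" using y(2) open_\<Omega> by (simp add: frontier_def interior_open)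
  then have "open_segment a b \<subseteq> - \<Omega>"
    using open_edge_interior_iff[OF T] y(1) by blast
  then have "closure (open_segment a b) \<subseteq> - \<Omega>"
    by (rule closure_minimal) (use open_\<Omega> in \<open>simp add: closed_def\<close>)
  moreover have "closed_segment a b \<subseteq> closure \<Omega>"
    using edge_of_imp_subset[OF tri_edge[OF T(2)]] T(1) cover by blast
  ultimately show ?thesis
    using tri_distinct[OF T(2)] open_\<Omega> by (auto simp: frontier_def interior_open)
qed

text \<open>A boundary point that is not a vertex lies on an open edge. For a vertex \<open>y\<close>, a small punctured disc
  about \<open>y\<close> is connected and meets \<open>\<Omega>\<close> and its complement, so it contains a boundary point off the
  vertices; the edge through that point contains \<open>y\<close>.\<close>
lemma frontier_edges: "frontier \<Omega> \<subseteq> \<Union>{F \<in> edges \<T>. F \<subseteq> frontier \<Omega>}"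
proof
  have case1: "\<exists>F\<in>edges \<T>. F \<subseteq> frontier \<Omega> \<and> y \<in> F" if y: "y \<in> frontier \<Omega>" "y \<notin> vertices \<T>" for y
  proof -
    have "y \<in> closure \<Omega>" using y(1) by (simp add: frontier_def)
    then obtain T where T: "T \<in> \<T>" "y \<in> T" using cover by blast
    have "y \<notin> interior T" using interior_subset_\<Omega>[OF T(1)] y(1) open_\<Omega> by (auto simp: frontier_def interior_open)
    moreover have "y \<notin> verts T" using y(2) T by (auto simp: vertices_def)
    ultimately obtain a b c where t: "tri a b c T" "y \<in> open_segment a b" using on_open_edge[OF T] by blast
    then have "closed_segment a b \<subseteq> frontier \<Omega>" using boundary_edge[OF T(1)] y(1) by blast
    moreover have "closed_segment a b \<in> edges \<T>" using edges_iff T(1) t(1) by blast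
    moreover have "y \<in> closed_segment a b" using t(2) by (simp add: open_segment_def)
    ultimately show ?thesis by blast
  qed
  fix y assume y: "y \<in> frontier \<Omega>"
  show "y \<in> \<Union>{F \<in> edges \<T>. F \<subseteq> frontier \<Omega>}"
  proof (cases "y \<in> vertices \<T>")
    case False then show ?thesis using case1[OF y] by blast
  next
    case True
    have "\<forall>\<^sub>F x in nhds y. \<forall>A\<in>edges \<T> \<union> (\<lambda>z. {z}) ` vertices \<T>. x \<in> A \<longrightarrow> y \<in> A"
      by (rule eventually_closed_family) (use finite_edges finite_vertices edges_iff in auto)
    then obtain e where e: "e > 0" and E: "\<And>x A. dist x y < e \<Longrightarrow> A \<in> edges \<T> \<union> (\<lambda>z. {z}) ` vertices \<T> \<Longrightarrow> x \<in> A \<Longrightarrow> y \<in> A"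
      by (auto simp: eventually_nhds_metric)
    let ?B = "ball y e - {y}"
    have con: "connected ?B" by (rule connected_punctured_ball) simp
    have yO: "y \<notin> \<Omega>" using y open_\<Omega> by (simp add: frontier_def interior_open)
    have "y \<in> closure \<Omega>" using y by (simp add: frontier_def)
    then obtain p where "p \<in> \<Omega>" "dist p y < e" using e by (auto simp: closure_approachable)
    then have "p \<in> ?B \<inter> \<Omega>" using yO by (auto simp: dist_commute)
    then have 1: "?B \<inter> \<Omega> \<noteq> {}" by blast
    obtain q where "q \<in> - closure \<Omega>" "dist q y < e"
      using frontier_exterior[OF y] e unfolding closure_approachable by blast
    then have "q \<in> ?B - \<Omega>" using \<open>y \<in> closure \<Omega>\<close> closure_subset[of \<Omega>] by (auto simp: dist_commute)
    then have 2: "?B - \<Omega> \<noteq> {}" by blast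
    obtain x where x: "x \<in> ?B" "x \<in> frontier \<Omega>" using connected_Int_frontier[OF con 1 2] by blast
    have "x \<notin> vertices \<T>" using E[of x "{x}"] x by (auto simp: dist_commute)
    from case1[OF x(2) this] obtain F where F: "F \<in> edges \<T>" "F \<subseteq> frontier \<Omega>" "x \<in> F" by blast
    then have "y \<in> F" using E[of x F] x by (auto simp: dist_commute)
    then show ?thesis using F by blast
  qed
qed

section \<open>Boundary values of piecewise polynomials\<close>

lemma piecewise_continuous:
  assumes "v \<in> piecewise \<T> (P k)" shows "continuous_on (closure \<Omega>) v"
proof -
  have "continuous_on T v" if T: "T \<in> \<T>" for T
  proof -
    have "v \<in> P k T" using assms T by (auto simp: piecewise_def)
    then obtain p where p: "p \<in> P k UNIV" "\<And>x. x \<in> T \<Longrightarrow> v x = p x" using P_extend by blast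
    then show ?thesis using smooth_continuous[OF P_smooth[OF p(1)], of T] by (simp cong: continuous_on_cong)
  qed
  then have "continuous_on (\<Union>T\<in>\<T>. T) v"
    by (intro continuous_on_closed_Union finite_\<T> closed_\<T>)
  then show ?thesis using cover by simp
qed

lemma piecewise_lipschitz_on:
  assumes "v \<in> piecewise \<T> (P k)" "T \<in> \<T>" shows "\<exists>L. L-lipschitz_on T v"
proof -
  have "v \<in> P k T" using assms by (auto simp: piecewise_def)
  then obtain p where p: "p \<in> P k UNIV" "\<And>x. x \<in> T \<Longrightarrow> v x = p x" using P_extend by blast
  have sm: "smooth p" using p(1) by (rule P_smooth)
  have "bounded (grad_on UNIV p ` T)"
    by (intro compact_imp_bounded compact_continuous_image smooth_continuous_grad sm compact_\<T> assms)
  then obtain B where B: "B > 0" "\<And>x. x \<in> T \<Longrightarrow> norm (grad_on UNIV p x) \<le> B" unfolding bounded_pos by blast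
  have "norm (p x - p y) \<le> B * norm (x - y)" if "x \<in> T" "y \<in> T" for x y
  proof (rule differentiable_bound[OF convex_\<T>[OF assms(2)]])
    fix z assume z: "z \<in> T"
    show "(p has_derivative (\<bullet>) (grad_on UNIV p z)) (at z within T)"
      by (rule has_derivative_at_withinI[OF smooth_has_derivative[OF sm]])
    show "onorm ((\<bullet>) (grad_on UNIV p z)) \<le> B"
    proof (rule onorm_bound)
      show "norm (grad_on UNIV p z \<bullet> h) \<le> B * norm h" for h
        using Cauchy_Schwarz_ineq2[of "grad_on UNIV p z" h] mult_right_mono[OF B(2)[OF z], of "norm h"] by simp
    qed (use B(1) in simp)
  qed (use that in auto)
  then have "B-lipschitz_on T v" using B(1) p(2) by (intro lipschitz_onI) (auto simp: dist_norm)
  then show ?thesis by blast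
qed

text \<open>Together with the complement of \<open>\<Omega>\<close> the triangles form a finite closed cover of the plane, so that a
  Lipschitz bound on each piece extends along segments.\<close>
lemma piecewise_lipschitz:
  assumes v: "v \<in> piecewise \<T> (P k)" and z: "\<And>x. x \<in> frontier \<Omega> \<Longrightarrow> v x = 0"
  obtains L where "L-lipschitz_on UNIV v"
proof -
  have "\<forall>T\<in>\<T>. \<exists>L. L-lipschitz_on T v" using piecewise_lipschitz_on[OF v] by blast
  then obtain l where l: "\<And>T. T \<in> \<T> \<Longrightarrow> (l T)-lipschitz_on T v" by metis
  define L where "L = Max (insert 0 (l ` \<T>))"
  have L0: "L \<ge> 0" unfolding L_def using finite_\<T> by (intro Max_ge) auto
  have LT: "L-lipschitz_on T v" if "T \<in> \<T>" for T
    by (rule lipschitz_on_le[OF l[OF that]]) (use finite_\<T> that in \<open>auto simp: L_def\<close>)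
  have out: "v x = 0" if "x \<notin> \<Omega>" for x
  proof (cases "x \<in> closure \<Omega>")
    case True then show ?thesis using that z open_\<Omega> by (auto simp: frontier_def interior_open)
  next
    case False then show ?thesis using v cover by (auto simp: piecewise_def)
  qed
  have LO: "L-lipschitz_on (- \<Omega>) v" using L0 out by (intro lipschitz_onI) auto
  have "dist (v x) (v y) \<le> L * dist x y" for x y
  proof -
    define g where "g t = x + t *\<^sub>R (y - x)" for t :: real
    define M where "M = L * dist x y"
    have M: "M \<ge> 0" using L0 by (simp add: M_def)
    have "M-lipschitz_on {0..1} (v \<circ> g)"
    proof (rule lipschitz_on_closed_Union[where I = "insert (- \<Omega>) \<T>" and U = "\<lambda>A. g -` A"])
      fix A assume A: "A \<in> insert (- \<Omega>) \<T>"
      then have LA: "L-lipschitz_on A v" using LT LO by auto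
      show "M-lipschitz_on (g -` A) (v \<circ> g)"
      proof (rule lipschitz_onI[OF _ M])
        fix s t assume "s \<in> g -` A" "t \<in> g -` A"
        then have "dist ((v \<circ> g) s) ((v \<circ> g) t) \<le> L * dist (g s) (g t)" using lipschitz_onD[OF LA] by simp
        also have "dist (g s) (g t) = \<bar>s - t\<bar> * dist x y"
          by (simp add: g_def dist_norm norm_minus_commute flip: scaleR_left_diff_distrib)
        finally show "dist ((v \<circ> g) s) ((v \<circ> g) t) \<le> M * dist s t" by (simp add: M_def dist_real_def mult_ac)
      qed
      have "closed A" using A closed_\<T> open_\<Omega> by auto
      then show "closed (g -` A)" by (rule closed_vimage) (auto simp: g_def intro!: continuous_intros)
    next
      have "\<Omega> \<subseteq> \<Union>\<T>" using cover closure_subset by blast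
      then show "{0..1} \<subseteq> (\<Union>A\<in>insert (- \<Omega>) \<T>. g -` A)" by auto
    qed (use finite_\<T> M in auto)
    then have "dist ((v \<circ> g) 0) ((v \<circ> g) 1) \<le> M * dist (0::real) 1" by (rule lipschitz_onD) auto
    then show ?thesis by (simp add: g_def M_def)
  qed
  then show thesis using that[of L] L0 by (intro that[of L] lipschitz_onI) auto
qed

theorem piecewise_H10_iff:
  assumes v: "v \<in> piecewise \<T> (P k)"
  shows "v \<in> H10 \<Omega> \<longleftrightarrow> (\<forall>x\<in>frontier \<Omega>. v x = 0)"
proof
  assume "v \<in> H10 \<Omega>"
  then show "\<forall>x\<in>frontier \<Omega>. v x = 0"
    using H10_zero_on_frontier[OF open_\<Omega> bounded_\<Omega> _ piecewise_continuous[OF v]] frontier_exterior by blast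
next
  assume z: "\<forall>x\<in>frontier \<Omega>. v x = 0"
  obtain L where L: "L-lipschitz_on UNIV v" using piecewise_lipschitz[OF v] z by blast
  interpret zero_trace_lipschitz \<Omega> v L
  proof
    fix x assume "x \<notin> \<Omega>"
    then show "v x = 0"
      using z v cover open_\<Omega> by (cases "x \<in> closure \<Omega>") (auto simp: frontier_def interior_open piecewise_def)
  qed (use open_\<Omega> bounded_\<Omega> L in auto)
  define U where "U = (\<Union>T\<in>\<T>. interior T)"
  have poly: "\<exists>p. smooth p \<and> (\<forall>\<^sub>F y in nhds x. v y = p y)" if xU: "x \<in> U" for x
  proof -
    obtain T where T: "T \<in> \<T>" "x \<in> interior T" using xU by (auto simp: U_def)
    have "v \<in> P k T" using v T by (auto simp: piecewise_def)
    then obtain p where p: "p \<in> P k UNIV" "\<And>x. x \<in> T \<Longrightarrow> v x = p x" using P_extend by blast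
    have "\<forall>\<^sub>F y in nhds x. y \<in> interior T" by (rule eventually_nhds_in_open) (use T in auto)
    then have "\<forall>\<^sub>F y in nhds x. v y = p y" by eventually_elim (use p(2) interior_subset in blast)
    then show ?thesis using P_smooth[OF p(1)] by blast
  qed
  have der: "(v has_derivative (\<bullet>) (grad_on UNIV p x)) (at x)" if "smooth p" "\<forall>\<^sub>F y in nhds x. v y = p y" for x p
  proof (rule has_derivative_transform_eventually[OF smooth_has_derivative[OF that(1)]])
    show "\<forall>\<^sub>F y in at x. p y = v y" using that(2) by (auto simp: eventually_at_filter elim: eventually_mono)
    show "p x = v x" using eventually_nhds_x_imp_x[OF that(2)] by simp
  qed simp
  show "v \<in> H10 \<Omega>"
  proof (rule in_H10[of U "grad_on UNIV v"])
    show "open U" by (auto simp: U_def)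
    show "U \<subseteq> \<Omega>" using interior_subset_\<Omega> by (auto simp: U_def)
    have "\<Omega> - U \<subseteq> (\<Union>T\<in>\<T>. frontier T)"
      using cover closure_subset[of \<Omega>] closed_\<T> by (fastforce simp: U_def frontier_def)
    moreover have "negligible (\<Union>T\<in>\<T>. frontier T)"
      by (rule negligible_Union) (use finite_\<T> negligible_convex_frontier convex_\<T> in auto)
    ultimately show "negligible (\<Omega> - U)" using negligible_subset by blast
    fix x assume "x \<in> U"
    then show "(v has_derivative (\<bullet>) (grad_on UNIV v x)) (at x)"
      using poly[of x] der grad_on_UNIV_eq by metis
  next
    have "isCont (grad_on UNIV v) x" if xU: "x \<in> U" for x
    proof -
      obtain p where p: "smooth p" "\<forall>\<^sub>F y in nhds x. v y = p y" using poly[OF xU] by blast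
      from p(2) have "\<forall>\<^sub>F y in nhds x. \<forall>\<^sub>F z in nhds y. v z = p z" by (simp add: eventually_eventually)
      then have eq: "\<forall>\<^sub>F y in nhds x. grad_on UNIV v y = grad_on UNIV p y"
        by eventually_elim (use der[OF p(1)] grad_on_UNIV_eq in blast)
      have "isCont (grad_on UNIV p) x"
        using smooth_continuous_grad[OF p(1), of UNIV] by (simp add: continuous_on_eq_continuous_at)
      then show ?thesis using isCont_cong[OF eq] by simp
    qed
    then show "continuous_on U (grad_on UNIV v)" by (simp add: continuous_at_imp_continuous_on)
  qed
qed

end

section \<open>Quadratic fields with tangential edge bubbles\<close>

lemma rot90_component: "(rot90 *v x) $ 1 = - x $ 2" "(rot90 *v x) $ 2 = x $ 1"
  by (simp_all add: rot90_def matrix_vector_mult_def sum_2)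

lemma linear_rot90: "linear ((*v) rot90)"
  by (rule matrix_vector_mul_linear)

lemma rot90_rot90: "rot90 *v (rot90 *v x) = - x"
  by (simp add: vec_eq_iff forall_2 rot90_component)

lemma plane_orthogonal_basis:
  fixes e x :: "real^2"
  assumes "e \<noteq> 0" "x \<bullet> e = 0" "x \<bullet> (rot90 *v e) = 0"
  shows "x = 0"
proof -
  have 1: "x$1 * e$1 + x$2 * e$2 = 0" "x$2 * e$1 - x$1 * e$2 = 0"
    using assms(2,3) by (simp_all add: inner_vec_def sum_2 rot90_component)
  have "(e$1)\<^sup>2 + (e$2)\<^sup>2 \<noteq> 0" using assms(1) by (simp add: vec_eq_iff forall_2 sum_power2_eq_zero_iff)
  moreover have "x$1 * ((e$1)\<^sup>2 + (e$2)\<^sup>2) = e$1 * (x$1 * e$1 + x$2 * e$2) - e$2 * (x$2 * e$1 - x$1 * e$2)"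
    "x$2 * ((e$1)\<^sup>2 + (e$2)\<^sup>2) = e$2 * (x$1 * e$1 + x$2 * e$2) + e$1 * (x$2 * e$1 - x$1 * e$2)"
    by (simp_all add: power2_eq_square algebra_simps)
  ultimately have "x$1 = 0" "x$2 = 0" unfolding 1 by auto
  then show ?thesis by (simp add: vec_eq_iff forall_2)
qed

lemma orthogonal_rot90:
  fixes e n :: "real^2"
  assumes "e \<noteq> 0" "n \<bullet> e = 0"
  obtains s where "rot90 *v n = s *\<^sub>R e"
proof -
  define s where "s = ((rot90 *v n) \<bullet> e) / (e \<bullet> e)"
  have ee: "e \<bullet> e \<noteq> 0" using assms(1) by simp
  have "rot90 *v n - s *\<^sub>R e = 0"
  proof (rule plane_orthogonal_basis[OF assms(1)])
    show "(rot90 *v n - s *\<^sub>R e) \<bullet> e = 0" using ee by (simp add: s_def inner_diff_left)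
    show "(rot90 *v n - s *\<^sub>R e) \<bullet> (rot90 *v e) = 0"
      using assms(2) by (simp add: inner_diff_left inner_vec_def sum_2 rot90_component algebra_simps)
  qed
  then show thesis using that[of s] by simp
qed

lemma unit_tangent_segment:
  assumes "a \<noteq> b" shows "unit_tangent (closed_segment a b) ((1 / norm (b - a)) *\<^sub>R (b - a))"
  unfolding unit_tangent_def
proof (intro conjI bexI exI)
  show "norm ((1 / norm (b - a)) *\<^sub>R (b - a)) = 1" using assms by simp
  show "(1 / norm (b - a)) *\<^sub>R (b - a) = (1 / norm (b - a)) *\<^sub>R (b - a)" ..
qed auto

lemma closed_segment_eq_verts:
  fixes a b c d :: "real^2"
  assumes "closed_segment a b = closed_segment c d" shows "{a, b} = {c, d}"
proof -
  have "verts (closed_segment x y) = {x, y}" for x y :: "real^2"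
    by (auto simp: verts_def extreme_point_of_segment)
  then show ?thesis using assms by metis
qed

context triangulated_polygon
begin

text \<open>The common shape of rotated Bernardi--Raugel fields and of discrete gradients: vertex values \<open>g\<close> and
  bubble coefficients \<open>\<gamma>\<close> on the edges.\<close>
definition quadratic_field :: "(real^2 \<Rightarrow> real^2) \<Rightarrow> ((real^2) set \<Rightarrow> real^2) \<Rightarrow> real^2 \<Rightarrow> real^2" where
  "quadratic_field g \<gamma> x = (\<Sum>z\<in>vertices \<T>. hat \<T> z x *\<^sub>R g z) + (\<Sum>F\<in>edges \<T>. edge_bubble \<T> F x *\<^sub>R \<gamma> F)"

lemma tri_vertices: "T \<in> \<T> \<Longrightarrow> tri a b c T \<Longrightarrow> a \<in> vertices \<T> \<and> b \<in> vertices \<T> \<and> c \<in> vertices \<T>"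
  using tri_verts[of a b c T] unfolding vertices_def by blast

lemma tri_edges: assumes "T \<in> \<T>" "tri a b c T"
  shows "closed_segment a b \<in> edges \<T>" "closed_segment b c \<in> edges \<T>" "closed_segment c a \<in> edges \<T>"
  using edges_iff assms tri_perms[OF assms(2)] by blast+

lemma quadratic_field_on:
  assumes T: "T \<in> \<T>" and t: "tri a b c T" and x: "x \<in> T"
  shows "quadratic_field g \<gamma> x = nodal T a x *\<^sub>R g a + nodal T b x *\<^sub>R g b + nodal T c x *\<^sub>R g c
    + (nodal T a x * nodal T b x) *\<^sub>R \<gamma> (closed_segment a b)
    + (nodal T b x * nodal T c x) *\<^sub>R \<gamma> (closed_segment b c)
    + (nodal T c x * nodal T a x) *\<^sub>R \<gamma> (closed_segment c a)"
proof -
  note d = tri_distinct[OF t]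
  have 1: "(\<Sum>z\<in>vertices \<T>. hat \<T> z x *\<^sub>R g z) = (\<Sum>z\<in>{a,b,c}. hat \<T> z x *\<^sub>R g z)"
    by (rule sum.mono_neutral_right[OF finite_vertices])
       (use tri_vertices[OF T t] hat_nodal[OF T x] nodal_not_vert tri_verts[OF t] in auto)
  have z: "edge_bubble \<T> F x = 0"
    if F: "F \<in> edges \<T>" "F \<notin> {closed_segment a b, closed_segment b c, closed_segment c a}" for F
  proof -
    obtain T' p q r where F': "T' \<in> \<T>" "tri p q r T'" "F = closed_segment p q" using edgesE[OF F(1)] .
    have pq: "p \<noteq> q" using tri_distinct[OF F'(2)] by simp
    have "p \<notin> {a,b,c} \<or> q \<notin> {a,b,c}"
      using F(2) pq F'(3) by (auto simp: closed_segment_commute)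
    then show ?thesis
      using pq hat_nodal[OF T x] nodal_not_vert tri_verts[OF t] by (auto simp: F'(3) edge_bubble_segment)
  qed
  have ne: "closed_segment a b \<noteq> closed_segment b c" "closed_segment a b \<noteq> closed_segment c a" "closed_segment b c \<noteq> closed_segment c a"
    using d by (auto dest!: closed_segment_eq_verts simp: doubleton_eq_iff)
  have "(\<Sum>F\<in>edges \<T>. edge_bubble \<T> F x *\<^sub>R \<gamma> F) =
      (\<Sum>F\<in>{closed_segment a b, closed_segment b c, closed_segment c a}. edge_bubble \<T> F x *\<^sub>R \<gamma> F)"
    by (rule sum.mono_neutral_right[OF finite_edges]) (use tri_edges[OF T t] z in auto)
  then show ?thesis
    using 1 d ne by (simp add: quadratic_field_def edge_bubble_segment hat_nodal[OF T x])
qed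

lemma quadratic_field_outside: assumes "x \<notin> \<Union>\<T>" shows "quadratic_field g \<gamma> x = 0"
proof -
  have "edge_bubble \<T> F x = 0" if "F \<in> edges \<T>" for F
    using that by (rule edgesE) (use tri_distinct hat_outside[OF assms] in \<open>auto simp: edge_bubble_segment\<close>)
  then show ?thesis using hat_outside[OF assms] by (simp add: quadratic_field_def)
qed

lemma quadratic_field_vertex:
  assumes T: "T \<in> \<T>" "z \<in> verts T" shows "quadratic_field g \<gamma> z = g z"
proof -
  obtain a b c where t: "tri a b c T" using tri_\<T>[OF T(1)] .
  obtain b' c' where t': "tri z b' c' T" using T(2) t tri_verts[OF t] tri_perms[OF t] by auto
  have "z \<in> T" using T verts_subset by blast
  then show ?thesis
    using tri_verts[OF t'] tri_distinct[OF t']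
    by (subst quadratic_field_on[OF T(1) t']) (simp_all add: nodal_verts[OF T])
qed

lemma nodal_midpoint:
  assumes t: "tri a b c T"
  shows "nodal T a ((1/2) *\<^sub>R (a + b)) = 1/2" "nodal T b ((1/2) *\<^sub>R (a + b)) = 1/2" "nodal T c ((1/2) *\<^sub>R (a + b)) = 0"
  using nodal_unique3[OF t, of "1/2" "1/2" 0] nodal_unique3[OF tri_perms(1)[OF t], of "1/2" 0 "1/2"]
    nodal_unique3[OF tri_perms(2)[OF t], of 0 "1/2" "1/2"] by (simp_all add: scaleR_add_right add_ac)

lemma midpoint_in: assumes "T \<in> \<T>" "tri a b c T" shows "(1/2) *\<^sub>R (a + b) \<in> T"
  using nodal_midpoint[OF assms(2)] by (simp add: tri_mem_iff[OF assms(2)])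

lemma quadratic_field_midpoint:
  assumes T: "T \<in> \<T>" and t: "tri a b c T"
  shows "quadratic_field g \<gamma> ((1/2) *\<^sub>R (a + b)) = (1/2) *\<^sub>R (g a + g b) + (1/4) *\<^sub>R \<gamma> (closed_segment a b)"
  unfolding quadratic_field_on[OF T t midpoint_in[OF T t]] nodal_midpoint[OF t] by (simp add: scaleR_add_right)

lemma nodal_closed_segment:
  assumes t: "tri a b c T" and x: "x \<in> closed_segment a b"
  shows "nodal T c x = 0" "nodal T a x + nodal T b x = 1" "x \<in> T"
proof -
  obtain s where s: "0 \<le> s" "s \<le> 1" "x = (1 - s) *\<^sub>R a + s *\<^sub>R b" using x by (auto simp: in_segment)
  then show 0: "nodal T c x = 0" using nodal_unique3[OF tri_perms(2)[OF t], of 0 "1 - s" s] by simp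
  then show "nodal T a x + nodal T b x = 1" using nodal_sum3(1)[OF t, of x] by simp
  show "x \<in> T" using edge_of_imp_subset[OF tri_edge[OF t]] x by blast
qed

lemma quadratic_field_edge:
  assumes T: "T \<in> \<T>" and t: "tri a b c T" and x: "x \<in> closed_segment a b"
  shows "quadratic_field g \<gamma> x = nodal T a x *\<^sub>R g a + nodal T b x *\<^sub>R g b + (nodal T a x * nodal T b x) *\<^sub>R \<gamma> (closed_segment a b)"
  using nodal_closed_segment[OF t x] by (simp add: quadratic_field_on[OF T t])

definition vanishing :: "(real^2 \<Rightarrow> real^2) \<Rightarrow> ((real^2) set \<Rightarrow> real^2) \<Rightarrow> bool" where
  "vanishing g \<gamma> \<longleftrightarrow> (\<forall>z\<in>vertices \<T>. z \<in> frontier \<Omega> \<longrightarrow> g z = 0) \<and> (\<forall>F\<in>edges \<T>. F \<subseteq> frontier \<Omega> \<longrightarrow> \<gamma> F = 0)"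

lemma quadratic_field_frontier:
  assumes v: "vanishing g \<gamma>" and x: "x \<in> frontier \<Omega>" shows "quadratic_field g \<gamma> x = 0"
proof -
  obtain F where F: "F \<in> edges \<T>" "F \<subseteq> frontier \<Omega>" "x \<in> F" using frontier_edges x by blast
  obtain T a b c where T: "T \<in> \<T>" "tri a b c T" "F = closed_segment a b" using edgesE[OF F(1)] .
  have "a \<in> frontier \<Omega>" "b \<in> frontier \<Omega>" using F(2) T(3) by auto
  then have "g a = 0" "g b = 0" "\<gamma> F = 0"
    using v F(1,2) tri_vertices[OF T(1,2)] by (auto simp: vanishing_def)
  then show ?thesis using quadratic_field_edge[OF T(1,2), of x] F(3) by (simp add: T(3))
qed

lemma quadratic_field_piecewise: "quadratic_field g \<gamma> \<in> piecewise_vec \<T> (P 2)"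
proof -
  have "(\<lambda>x. quadratic_field g \<gamma> x $ i) \<in> P 2 T" if T: "T \<in> \<T>" for T i
  proof -
    obtain a b c where t: "tri a b c T" using tri_\<T>[OF T] .
    have n2: "(\<lambda>x. nodal T z x * nodal T w x) \<in> P 2 T" for z w
    proof -
      obtain \<alpha> \<beta> \<alpha>' \<beta>' where "\<And>x. nodal T z x = \<alpha> + \<beta> \<bullet> x" "\<And>x. nodal T w x = \<alpha>' + \<beta>' \<bullet> x"
        using nodal_affine[OF t] by metis
      then show ?thesis using P_mult_affine[OF P_affine[of \<alpha>' \<beta>' 0], of \<alpha> \<beta>] by (simp add: numeral_2_eq_2)
    qed
    have n1: "(\<lambda>x. nodal T z x) \<in> P 2 T" for z
    proof -
      obtain \<alpha> \<beta> where "\<And>x. nodal T z x = \<alpha> + \<beta> \<bullet> x" using nodal_affine[OF t] by metis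
      then show ?thesis using P_affine[of \<alpha> \<beta> 1] by (simp add: numeral_2_eq_2)
    qed
    have "(\<lambda>x. g a $ i * nodal T a x + g b $ i * nodal T b x + g c $ i * nodal T c x
        + \<gamma> (closed_segment a b) $ i * (nodal T a x * nodal T b x)
        + \<gamma> (closed_segment b c) $ i * (nodal T b x * nodal T c x)
        + \<gamma> (closed_segment c a) $ i * (nodal T c x * nodal T a x)) \<in> P 2 T"
      by (intro P_add P_cmult n1 n2)
    then show ?thesis by (rule P_cong) (simp add: quadratic_field_on[OF T t] mult_ac)
  qed
  then show ?thesis
    using quadratic_field_outside by (auto simp: piecewise_vec_def piecewise_def)
qed

lemma quadratic_field_H10: "vanishing g \<gamma> \<Longrightarrow> quadratic_field g \<gamma> \<in> H10_vec \<Omega>"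
proof -
  assume v: "vanishing g \<gamma>"
  have "(\<lambda>x. quadratic_field g \<gamma> x $ i) \<in> H10 \<Omega>" for i
  proof -
    have "(\<lambda>x. quadratic_field g \<gamma> x $ i) \<in> piecewise \<T> (P 2)" using quadratic_field_piecewise by (auto simp: piecewise_vec_def)
    from piecewise_H10_iff[OF this] show ?thesis using quadratic_field_frontier[OF v] by simp
  qed
  then show ?thesis by (simp add: H10_vec_def)
qed

lemma rot90_quadratic_field: "rot90 *v quadratic_field g \<gamma> x = quadratic_field (\<lambda>z. rot90 *v g z) (\<lambda>F. rot90 *v \<gamma> F) x"
  by (simp add: quadratic_field_def linear_add[OF linear_rot90] linear_sum[OF linear_rot90] linear_scale[OF linear_rot90])

section \<open>Discrete gradients\<close>

text \<open>A bubble coefficient along the edge leaves the normal component affine. Its size is such that the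
  tangential value at the midpoint is the derivative of the cubic \<open>v\<close> on the edge, which is determined by the
  values and derivatives at the end points.\<close>
lemma is_disc_gradI:
  assumes v: "v \<in> piecewise \<T> (P 3)" and van: "vanishing g \<gamma>"
    and g: "\<And>T z. T \<in> \<T> \<Longrightarrow> z \<in> verts T \<Longrightarrow> g z = grad_on T v z"
    and tang: "\<And>T a b c. T \<in> \<T> \<Longrightarrow> tri a b c T \<Longrightarrow> \<exists>s. \<gamma> (closed_segment a b) = s *\<^sub>R (b - a)"
    and \<gamma>: "\<And>T a b c. T \<in> \<T> \<Longrightarrow> tri a b c T \<Longrightarrow>
        \<gamma> (closed_segment a b) \<bullet> (b - a) = 6 * (v b - v a) - 3 * ((g a + g b) \<bullet> (b - a))"
  shows "is_disc_grad \<Omega> \<T> v (quadratic_field g \<gamma>)"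
  unfolding is_disc_grad_def
proof (intro conjI ballI allI impI; (elim conjE)?)
  show "quadratic_field g \<gamma> \<in> H10_vec \<Omega>" by (rule quadratic_field_H10[OF van])
  show "quadratic_field g \<gamma> \<in> piecewise_vec \<T> (P 2)" by (rule quadratic_field_piecewise)
next
  fix T z assume "T \<in> \<T>" "z \<in> verts T"
  then show "quadratic_field g \<gamma> z = grad_on T v z" using quadratic_field_vertex g by simp
next
  fix T E n assume T: "T \<in> \<T>" and E: "E edge_of T" and n: "unit_normal E n"
  obtain a b c where t: "tri a b c T" and E': "E = closed_segment a b" using edge_tri[OF T E] .
  obtain s where s: "\<gamma> (closed_segment a b) = s *\<^sub>R (b - a)" using tang[OF T t] by blast
  have "n \<bullet> (b - a) = 0" using n by (simp add: unit_normal_def E')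
  then have \<gamma>n: "\<gamma> E \<bullet> n = 0" by (simp add: E' s inner_commute)
  obtain \<alpha> \<beta> \<alpha>' \<beta>' where na: "\<And>x. nodal T a x = \<alpha> + \<beta> \<bullet> x" "\<And>x. nodal T b x = \<alpha>' + \<beta>' \<bullet> x"
    using nodal_affine[OF t] by metis
  have "(\<lambda>x. (g a \<bullet> n) * (\<alpha> + \<beta> \<bullet> x) + (g b \<bullet> n) * (\<alpha>' + \<beta>' \<bullet> x)) \<in> P 1 E"
  proof -
    have aff: "(\<lambda>x. \<alpha> + \<beta> \<bullet> x) \<in> P 1 E" for \<alpha> \<beta> using P_affine[of \<alpha> \<beta> 0 E] by simp
    show ?thesis by (rule P_add; rule P_cmult; rule aff)
  qed
  then show "(\<lambda>x. quadratic_field g \<gamma> x \<bullet> n) \<in> P 1 E"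
  proof (rule P_cong)
    fix x assume "x \<in> E"
    then show "(g a \<bullet> n) * (\<alpha> + \<beta> \<bullet> x) + (g b \<bullet> n) * (\<alpha>' + \<beta>' \<bullet> x) = quadratic_field g \<gamma> x \<bullet> n"
      using quadratic_field_edge[OF T t, of x] \<gamma>n by (simp add: E' na inner_add_left mult_ac)
  qed
next
  fix T E tt assume T: "T \<in> \<T>" and E: "E edge_of T" and n: "unit_tangent E tt"
  obtain a b c where t: "tri a b c T" and E': "E = closed_segment a b" using edge_tri[OF T E] .
  have ab: "a \<noteq> b" using tri_distinct[OF t] by simp
  obtain x y k where xy: "x \<in> E" "y \<in> E" "tt = k *\<^sub>R (x - y)" using n by (auto simp: unit_tangent_def)
  obtain p q where pq: "x = (1 - p) *\<^sub>R a + p *\<^sub>R b" "y = (1 - q) *\<^sub>R a + q *\<^sub>R b"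
    using xy by (auto simp: E' in_segment)
  have tt: "tt = (k * (p - q)) *\<^sub>R (b - a)" unfolding xy(3) pq by (simp add: algebra_simps)
  have abT: "a \<in> verts T" "b \<in> verts T" "a \<in> T" "b \<in> T" using tri_verts[OF t] verts_subset by auto
  have vT: "v \<in> P 3 T" using v T by (auto simp: piecewise_def)
  have "grad_on T v ((1/2) *\<^sub>R (a + b)) \<bullet> (b - a) = 3/2 * (v b - v a) - 1/4 * ((grad_on T v a + grad_on T v b) \<bullet> (b - a))"
    by (rule P3_edge_midpoint[OF convex_\<T>[OF T] interior_\<T>[OF T] vT abT(3,4)])
  also have "\<dots> = quadratic_field g \<gamma> ((1/2) *\<^sub>R (a + b)) \<bullet> (b - a)"
    using \<gamma>[OF T t] by (simp add: quadratic_field_midpoint[OF T t] g[OF T abT(1), symmetric] g[OF T abT(2), symmetric] inner_add_left) (simp add: field_simps)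
  finally show "quadratic_field g \<gamma> (barycentre E) \<bullet> tt = grad_on T v (barycentre E) \<bullet> tt"
    by (simp add: E' barycentre_segment[OF ab] tt)
qed

text \<open>The values at the vertices and the tangential components at the midpoints are prescribed. The normal
  component at a midpoint is the mean of the end point values, because it is affine on the edge. A
  quadratic field is determined by its values at these six points.\<close>
lemma is_disc_grad_unique:
  assumes G: "is_disc_grad \<Omega> \<T> v G" and H: "is_disc_grad \<Omega> \<T> v H"
  shows "G = H"
proof
  fix x
  show "G x = H x"
  proof (cases "x \<in> \<Union>\<T>")
    case False
    then have "G x $ i = 0" "H x $ i = 0" for i
      using G H by (auto simp: is_disc_grad_def piecewise_vec_def piecewise_def)
    then show ?thesis by (simp add: vec_eq_iff)
  next
    case True
    then obtain T where T: "T \<in> \<T>" "x \<in> T" by blast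
    obtain a b c where t: "tri a b c T" using tri_\<T>[OF T(1)] .
    have ver: "G z = H z" if "z \<in> verts T" for z
      using G H T(1) that by (auto simp: is_disc_grad_def)
    have mid: "G ((1/2) *\<^sub>R (a + b)) = H ((1/2) *\<^sub>R (a + b))" if t: "tri a b c T" for a b c
    proof -
      let ?m = "(1/2) *\<^sub>R (a + b)" and ?E = "closed_segment a b"
      have ab: "a \<noteq> b" "b - a \<noteq> 0" using tri_distinct[OF t] by auto
      have abT: "a \<in> verts T" "b \<in> verts T" using tri_verts[OF t] by auto
      have bc: "barycentre ?E = ?m" by (rule barycentre_segment[OF ab(1)])
      have E: "?E edge_of T" by (rule tri_edge[OF t])
      define tt where "tt = (1 / norm (b - a)) *\<^sub>R (b - a)"
      have "unit_tangent ?E tt" unfolding tt_def by (rule unit_tangent_segment[OF ab(1)])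
      then have "G ?m \<bullet> tt = H ?m \<bullet> tt"
        using G H T(1) E bc unfolding is_disc_grad_def by metis
      then have 1: "(G ?m - H ?m) \<bullet> (b - a) = 0" using ab by (simp add: tt_def inner_diff_left)
      define n where "n = (1 / norm (b - a)) *\<^sub>R (rot90 *v (b - a))"
      have nr: "norm (rot90 *v e) = norm e" for e
        by (simp add: norm_eq_sqrt_inner inner_vec_def sum_2 rot90_component)
      have "unit_normal ?E n"
        unfolding unit_normal_def
      proof (intro conjI ballI)
        show "norm n = 1" using ab by (simp add: n_def nr)
        fix x y assume "x \<in> ?E" "y \<in> ?E"
        then obtain p q where pq: "x = (1 - p) *\<^sub>R a + p *\<^sub>R b" "y = (1 - q) *\<^sub>R a + q *\<^sub>R b" by (auto simp: in_segment)
        have "x - y = (p - q) *\<^sub>R (b - a)" unfolding pq by (simp add: algebra_simps)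
        moreover have "(rot90 *v e) \<bullet> e = 0" for e by (simp add: inner_vec_def sum_2 rot90_component)
        ultimately show "n \<bullet> (x - y) = 0" by (simp add: n_def)
      qed
      then have P1: "(\<lambda>x. G x \<bullet> n) \<in> P 1 ?E" "(\<lambda>x. H x \<bullet> n) \<in> P 1 ?E"
        using G H T(1) E unfolding is_disc_grad_def by blast+
      have mid1: "f ?m = (f a + f b) / 2" if f: "f \<in> P 1 ?E" for f
      proof -
        obtain \<alpha> \<beta> where "\<And>x. x \<in> ?E \<Longrightarrow> f x = \<alpha> + \<beta> \<bullet> x" using P1_affine[OF f] by blast
        moreover have "?m \<in> ?E" unfolding in_segment by (intro exI[of _ "1/2"]) (simp add: scaleR_add_right)
        ultimately show ?thesis by (simp add: inner_add_right field_simps)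
      qed
      have "G ?m \<bullet> n = H ?m \<bullet> n" using mid1[OF P1(1)] mid1[OF P1(2)] ver[OF abT(1)] ver[OF abT(2)] by simp
      then have "(G ?m - H ?m) \<bullet> (rot90 *v (b - a)) = 0" using ab by (simp add: n_def inner_diff_left)
      from plane_orthogonal_basis[OF ab(2) 1 this] show ?thesis by simp
    qed
    have "G x $ i - H x $ i = 0" for i
    proof (rule P2_zero[OF t, of "\<lambda>x. G x $ i - H x $ i"])
      show "(\<lambda>x. G x $ i - H x $ i) \<in> P 2 T"
        using G H T(1) by (intro P_diff) (auto simp: is_disc_grad_def piecewise_vec_def piecewise_def)
      show "x \<in> T" by fact
    qed (use ver tri_verts[OF t] mid[OF t] mid[OF tri_perms(1)[OF t]] mid[OF tri_perms(4)[OF t]] in auto)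
    then show ?thesis by (simp add: vec_eq_iff)
  qed
qed

lemma disc_grad_eq: "is_disc_grad \<Omega> \<T> v G \<Longrightarrow> disc_grad \<Omega> \<T> v = G"
  unfolding disc_grad_def using is_disc_grad_unique by blast

lemma DKT_piecewise: "v \<in> DKT_space \<Omega> \<T> \<Longrightarrow> v \<in> piecewise \<T> (P 3)"
  by (auto simp: DKT_space_def piecewise_def P3_minus_def)

lemma disc_grad_exists:
  assumes v: "v \<in> DKT_space \<Omega> \<T>" shows "\<exists>G. is_disc_grad \<Omega> \<T> v G"
proof -
  have "\<forall>z\<in>vertices \<T>. \<exists>g. (\<forall>T\<in>\<T>. z \<in> T \<longrightarrow> grad_on T v z = g) \<and> (z \<in> frontier \<Omega> \<longrightarrow> g = 0)"
    using v by (simp add: DKT_space_def)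
  then obtain g where g: "\<And>z T. z \<in> vertices \<T> \<Longrightarrow> T \<in> \<T> \<Longrightarrow> z \<in> T \<Longrightarrow> grad_on T v z = g z"
    and g0: "\<And>z. z \<in> vertices \<T> \<Longrightarrow> z \<in> frontier \<Omega> \<Longrightarrow> g z = 0" by metis
  have v0: "v x = 0" if "x \<in> frontier \<Omega>" for x
    using v that piecewise_H10_iff[OF DKT_piecewise[OF v]] by (auto simp: DKT_space_def)
  define r where "r a b = ((6 * (v b - v a) - 3 * ((g a + g b) \<bullet> (b - a))) / (norm (b - a))\<^sup>2) *\<^sub>R (b - a)" for a b
  have r_sym: "r b a = r a b" for a b
  proof -
    have 1: "6 * (v a - v b) - 3 * ((g b + g a) \<bullet> (a - b)) = - (6 * (v b - v a) - 3 * ((g a + g b) \<bullet> (b - a)))"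
      by (simp add: inner_diff_right inner_add_left)
    have 2: "norm (a - b) = norm (b - a)" by (rule norm_minus_commute)
    have 3: "(- N / n) *\<^sub>R (a - b) = (N / n) *\<^sub>R (b - a)" for N n :: real
      by (simp add: scaleR_diff_right)
    show ?thesis unfolding r_def 1 2 by (rule 3)
  qed
  \<comment> \<open>By \<open>r_sym\<close> both orientations of the edge give the same value.\<close>
  define \<gamma> where "\<gamma> F = (let (a, b) = SOME (a, b). F = closed_segment a b in r a b)" for F
  have \<gamma>r: "\<gamma> (closed_segment a b) = r a b" for a b
  proof -
    define ab where "ab = (SOME (a', b'). closed_segment a b = closed_segment a' b')"
    have "case ab of (a', b') \<Rightarrow> closed_segment a b = closed_segment a' b'"
      unfolding ab_def by (rule someI_ex) auto
    then obtain a' b' where ab: "ab = (a', b')" "closed_segment a b = closed_segment a' b'" by (cases ab) auto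
    have "\<gamma> (closed_segment a b) = r a' b'" using ab(1) by (simp add: \<gamma>_def ab_def)
    moreover have "a' = a \<and> b' = b \<or> a' = b \<and> b' = a"
      using closed_segment_eq_verts[OF ab(2)] by (auto simp: doubleton_eq_iff)
    ultimately show ?thesis using r_sym by auto
  qed
  have "is_disc_grad \<Omega> \<T> v (quadratic_field g \<gamma>)"
  proof (rule is_disc_gradI[OF DKT_piecewise[OF v]])
    show "vanishing g \<gamma>"
      unfolding vanishing_def
    proof (intro conjI ballI impI)
      fix F assume F: "F \<in> edges \<T>" "F \<subseteq> frontier \<Omega>"
      obtain T a b c where T: "T \<in> \<T>" "tri a b c T" "F = closed_segment a b" using edgesE[OF F(1)] .
      have "a \<in> frontier \<Omega>" "b \<in> frontier \<Omega>" using F(2) T(3) by auto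
      then have "r a b = 0" using g0 v0 tri_vertices[OF T(1,2)] by (simp add: r_def)
      then show "\<gamma> F = 0" by (simp add: T(3) \<gamma>r)
    qed (use g0 in auto)
  next
    fix T z assume "T \<in> \<T>" "z \<in> verts T"
    then have "z \<in> vertices \<T>" "z \<in> T" using verts_subset by (auto simp: vertices_def)
    then show "g z = grad_on T v z" using g[of z T] \<open>T \<in> \<T>\<close> by simp
  next
    fix T a b c assume T: "T \<in> \<T>" "tri a b c T"
    show "\<exists>s. \<gamma> (closed_segment a b) = s *\<^sub>R (b - a)" unfolding \<gamma>r r_def by blast
    have "(norm (b - a))\<^sup>2 \<noteq> 0" using tri_distinct[OF T(2)] by simp
    then show "\<gamma> (closed_segment a b) \<bullet> (b - a) = 6 * (v b - v a) - 3 * ((g a + g b) \<bullet> (b - a))"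
      unfolding \<gamma>r r_def inner_scaleR_left power2_norm_eq_inner by simp
  qed
  then show ?thesis by blast
qed

text \<open>Rotating the normal edge bubbles makes them tangential. The boundary values vanish because the affine
  part lies in \<open>H\<^sup>1\<^sub>0\<close> and only interior edges carry bubbles.\<close>
lemma BR_space_quadratic_field:
  assumes \<nu>: "\<forall>F\<in>edges \<T>. unit_normal F (\<nu> F)" and \<psi>: "\<psi> \<in> BR_space \<Omega> \<T> \<nu>"
  obtains g \<gamma> where "\<psi> = (\<lambda>x. rot90 *v quadratic_field g \<gamma> x)" "vanishing g \<gamma>"
    "\<And>T a b c. T \<in> \<T> \<Longrightarrow> tri a b c T \<Longrightarrow> \<exists>s. \<gamma> (closed_segment a b) = s *\<^sub>R (b - a)"
proof -
  obtain v c where \<psi>': "\<psi> = (\<lambda>x. v x + (\<Sum>F\<in>interior_edges \<Omega> \<T>. c F *\<^sub>R (edge_bubble \<T> F x *\<^sub>R \<nu> F)))"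
    and v: "v \<in> H10_vec \<Omega>" "v \<in> piecewise_vec \<T> (P 1)"
    using \<psi> unfolding BR_space_def by blast
  have vi: "(\<lambda>x. v x $ i) \<in> piecewise \<T> (P 1)" "(\<lambda>x. v x $ i) \<in> H10 \<Omega>" for i
    using v by (auto simp: piecewise_vec_def H10_vec_def)
  define \<delta> where "\<delta> F = (if F \<in> interior_edges \<Omega> \<T> then c F *\<^sub>R \<nu> F else 0)" for F
  have sub: "interior_edges \<Omega> \<T> \<subseteq> edges \<T>" by (auto simp: interior_edges_def)
  have sum: "(\<Sum>F\<in>interior_edges \<Omega> \<T>. c F *\<^sub>R (edge_bubble \<T> F x *\<^sub>R \<nu> F)) = (\<Sum>F\<in>edges \<T>. edge_bubble \<T> F x *\<^sub>R \<delta> F)" for x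
  proof -
    have "(\<Sum>F\<in>edges \<T>. edge_bubble \<T> F x *\<^sub>R \<delta> F) = (\<Sum>F\<in>interior_edges \<Omega> \<T>. edge_bubble \<T> F x *\<^sub>R \<delta> F)"
      by (rule sum.mono_neutral_right[OF finite_edges sub]) (auto simp: \<delta>_def)
    also have "\<dots> = (\<Sum>F\<in>interior_edges \<Omega> \<T>. c F *\<^sub>R (edge_bubble \<T> F x *\<^sub>R \<nu> F))"
      by (rule sum.cong) (auto simp: \<delta>_def mult_ac)
    finally show ?thesis by simp
  qed
  have vh: "v x = (\<Sum>z\<in>vertices \<T>. hat \<T> z x *\<^sub>R v z)" for x
  proof (cases "x \<in> \<Union>\<T>")
    case True
    then obtain T where T: "T \<in> \<T>" "x \<in> T" by blast
    obtain p q r where t: "tri p q r T" using tri_\<T>[OF T(1)] .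
    have "(\<Sum>z\<in>vertices \<T>. hat \<T> z x *\<^sub>R v z) = (\<Sum>z\<in>{p,q,r}. hat \<T> z x *\<^sub>R v z)"
      by (rule sum.mono_neutral_right[OF finite_vertices])
         (use tri_vertices[OF T(1) t] hat_nodal[OF T] nodal_not_vert tri_verts[OF t] in auto)
    also have "\<dots> = nodal T p x *\<^sub>R v p + nodal T q x *\<^sub>R v q + nodal T r x *\<^sub>R v r"
      using tri_distinct[OF t] by (simp add: hat_nodal[OF T])
    also have "\<dots> = v x"
    proof -
      have "v x $ i = v p $ i * nodal T p x + v q $ i * nodal T q x + v r $ i * nodal T r x" for i
        by (rule P1_interpolation[OF t _ T(2)]) (use vi(1) T(1) in \<open>auto simp: piecewise_def\<close>)
      then show ?thesis by (simp add: vec_eq_iff mult_ac)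
    qed
    finally show ?thesis by simp
  next
    case False
    have "v x $ i = 0" for i using vi(1) False by (auto simp: piecewise_def)
    then show ?thesis using hat_outside[OF False] by (simp add: vec_eq_iff)
  qed
  define g where "g z = - (rot90 *v v z)" for z
  define \<gamma> where "\<gamma> F = - (rot90 *v \<delta> F)" for F
  show thesis
  proof (rule that[of g \<gamma>])
    have neg: "rot90 *v (- y) = - (rot90 *v y)" for y by (rule linear_neg[OF linear_rot90])
    have "\<psi> x = quadratic_field v \<delta> x" for x unfolding \<psi>' sum quadratic_field_def using vh[of x] by simp
    then show "\<psi> = (\<lambda>x. rot90 *v quadratic_field g \<gamma> x)"
      by (simp add: rot90_quadratic_field g_def \<gamma>_def neg rot90_rot90 fun_eq_iff)
    have "v z = 0" if "z \<in> frontier \<Omega>" for z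
    proof -
      have "v z $ i = 0" for i using piecewise_H10_iff[OF vi(1)[of i]] vi(2)[of i] that by auto
      then show ?thesis by (simp add: vec_eq_iff)
    qed
    then show "vanishing g \<gamma>"
      by (auto simp: vanishing_def g_def \<gamma>_def \<delta>_def interior_edges_def)
    fix T a b d assume T: "T \<in> \<T>" "tri a b d T"
    let ?F = "closed_segment a b"
    have "\<nu> ?F \<bullet> (b - a) = 0" using \<nu> tri_edges(1)[OF T] by (auto simp: unit_normal_def)
    then obtain s where "rot90 *v \<nu> ?F = s *\<^sub>R (b - a)" using orthogonal_rot90[of "b - a" "\<nu> ?F"] tri_distinct[OF T(2)] by auto
    then have "\<gamma> ?F = (if ?F \<in> interior_edges \<Omega> \<T> then - (c ?F * s) else 0) *\<^sub>R (b - a)"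
      by (simp add: \<gamma>_def \<delta>_def linear_scale[OF linear_rot90])
    then show "\<exists>s. \<gamma> ?F = s *\<^sub>R (b - a)" by blast
  qed
qed

end

section \<open>Divergence and circulation\<close>

lemma lebesgue_on_integral_lborel:
  fixes f :: "'a::euclidean_space \<Rightarrow> 'b::euclidean_space"
  assumes "S \<in> sets borel" "f \<in> borel_measurable borel"
  shows "(\<integral>x. f x \<partial>lebesgue_on S) = (\<integral>x. indicator S x *\<^sub>R f x \<partial>lborel)"
proof -
  note [measurable] = assms
  have "(\<lambda>x. indicator S x *\<^sub>R f x) \<in> borel_measurable lborel" by measurable
  from integral_completion[OF this] show ?thesis
    using assms(1) by (subst integral_restrict_space) auto
qed

lemma absolutely_integrable_compact:
  fixes f :: "'a::euclidean_space \<Rightarrow> 'b::euclidean_space"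
  assumes "compact S" "continuous_on UNIV f"
  shows "f absolutely_integrable_on S"
proof -
  have [measurable]: "S \<in> sets borel" "f \<in> borel_measurable borel"
    using assms by (auto intro: borel_compact borel_measurable_continuous_onI)
  have "(\<lambda>x. indicator S x *\<^sub>R f x) \<in> borel_measurable lborel" by measurable
  from integrable_completion[OF this] show ?thesis
    using borel_integrable_compact[OF assms(1) continuous_on_subset[OF assms(2)]]
    by (simp add: set_integrable_def)
qed

lemma nodal_centroid:
  assumes "tri a b c T"
  shows "nodal T a ((1/3) *\<^sub>R (a + b + c)) = 1/3" "nodal T b ((1/3) *\<^sub>R (a + b + c)) = 1/3" "nodal T c ((1/3) *\<^sub>R (a + b + c)) = 1/3"
  using nodal_unique3[OF assms, of "1/3" "1/3" "1/3"] nodal_unique3[OF tri_perms(1)[OF assms], of "1/3" "1/3" "1/3"]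
    nodal_unique3[OF tri_perms(2)[OF assms], of "1/3" "1/3" "1/3"]
  by (simp_all add: scaleR_add_right add_ac)

lemma tri_measure_pos: assumes t: "tri a b c T" shows "measure lebesgue T > 0"
proof -
  have "\<not> negligible T" using tri_interior[OF t] open_not_negligible[OF open_interior, of T] negligible_subset interior_subset by blast
  then show ?thesis using tri_compact[OF t] by (simp add: lmeasurable_compact negligible_iff_measure0 zero_less_measure_iff less_le)
qed

text \<open>The affine map that permutes the vertices cyclically fixes the centroid and preserves the triangle,
  hence its area. The first moment \<open>J\<close> about the centroid is therefore fixed by its linear part \<open>G\<close>,
  and \<open>y + G y + G (G y) = 0\<close> for all \<open>y\<close>.\<close>
lemma tri_first_moment:
  assumes t: "tri a b c T"
  shows "integral ((\<lambda>x. x - (1/3) *\<^sub>R (a + b + c)) ` T) (\<lambda>y. y) = 0"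
proof -
  define m where "m = (1/3) *\<^sub>R (a + b + c)"
  define S where "S = (\<lambda>x. x - m) ` T"
  obtain \<alpha>a \<beta>a where na: "\<And>x. nodal T a x = \<alpha>a + \<beta>a \<bullet> x" using nodal_affine[OF t] by metis
  obtain \<alpha>b \<beta>b where nb: "\<And>x. nodal T b x = \<alpha>b + \<beta>b \<bullet> x" using nodal_affine[OF t] by metis
  obtain \<alpha>c \<beta>c where nc: "\<And>x. nodal T c x = \<alpha>c + \<beta>c \<bullet> x" using nodal_affine[OF t] by metis
  have third: "nodal T a (m + y) = 1/3 + \<beta>a \<bullet> y" "nodal T b (m + y) = 1/3 + \<beta>b \<bullet> y" "nodal T c (m + y) = 1/3 + \<beta>c \<bullet> y" for y
    using nodal_centroid[OF t] by (simp_all add: na nb nc inner_add_right m_def)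
  define G where "G y = (\<beta>c \<bullet> y) *\<^sub>R a + (\<beta>a \<bullet> y) *\<^sub>R b + (\<beta>b \<bullet> y) *\<^sub>R c" for y
  have lin: "linear G" by (simp add: G_def linear_iff inner_add_right algebra_simps)
  have mG: "m + G y = nodal T c (m + y) *\<^sub>R a + nodal T a (m + y) *\<^sub>R b + nodal T b (m + y) *\<^sub>R c" for y
    unfolding third by (simp add: G_def m_def algebra_simps)
  have sum1: "nodal T c x + nodal T a x + nodal T b x = 1" for x using nodal_sum3(1)[OF t, of x] by linarith
  have rot: "nodal T a (m + G y) = nodal T c (m + y)" "nodal T b (m + G y) = nodal T a (m + y)" "nodal T c (m + G y) = nodal T b (m + y)" for y
  proof -
    show "nodal T a (m + G y) = nodal T c (m + y)"
      unfolding mG by (rule nodal_unique3[OF t sum1])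
    show "nodal T b (m + G y) = nodal T a (m + y)"
      unfolding mG using nodal_unique3[OF tri_perms(1)[OF t], of "nodal T a (m + y)" "nodal T b (m + y)" "nodal T c (m + y)"] sum1[of "m + y"]
      by (simp add: add_ac)
    show "nodal T c (m + G y) = nodal T b (m + y)"
      unfolding mG using nodal_unique3[OF tri_perms(2)[OF t], of "nodal T b (m + y)" "nodal T c (m + y)" "nodal T a (m + y)"] sum1[of "m + y"]
      by (simp add: add_ac)
  qed
  have G3: "G (G (G y)) = y" for y
  proof -
    have "m + G (G (G y)) = nodal T a (m + y) *\<^sub>R a + nodal T b (m + y) *\<^sub>R b + nodal T c (m + y) *\<^sub>R c"
      unfolding mG[of "G (G y)"] rot ..
    then show ?thesis using nodal_sum3(2)[OF t, of "m + y"] by simp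
  qed
  have G0: "y + G y + G (G y) = 0" for y
  proof -
    define p q r where "p = nodal T a (m + y)" and "q = nodal T b (m + y)" and "r = nodal T c (m + y)"
    have "m + y = p *\<^sub>R a + q *\<^sub>R b + r *\<^sub>R c"
      unfolding p_def q_def r_def by (rule nodal_sum3(2)[OF t, symmetric])
    moreover have "m + G y = r *\<^sub>R a + p *\<^sub>R b + q *\<^sub>R c"
      unfolding p_def q_def r_def by (rule mG)
    moreover have "m + G (G y) = q *\<^sub>R a + r *\<^sub>R b + p *\<^sub>R c"
      unfolding mG[of "G y"] rot p_def q_def r_def ..
    ultimately have "(m + y) + (m + G y) + (m + G (G y)) = (p + q + r) *\<^sub>R (a + b + c)"
      by (simp only:) (simp add: algebra_simps)
    also have "\<dots> = 3 *\<^sub>R m" unfolding p_def q_def r_def nodal_sum3(1)[OF t] by (simp add: m_def)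
    also have "3 *\<^sub>R m = m + m + m" by (simp add: vec_eq_iff)
    finally show ?thesis by (simp add: algebra_simps)
  qed
  have memS: "y \<in> S \<longleftrightarrow> m + y \<in> T" for y by (force simp: S_def image_iff algebra_simps)
  have GS: "G ` S = S"
  proof
    show sub: "G ` S \<subseteq> S" by (auto simp: memS tri_mem_iff[OF t] rot)
    show "S \<subseteq> G ` S"
    proof
      fix y assume "y \<in> S"
      then have "G (G y) \<in> S" using sub by blast
      then show "y \<in> G ` S" using G3[of y] by (metis image_eqI)
    qed
  qed
  have cS: "compact S" unfolding S_def by (intro compact_continuous_image continuous_intros tri_compact[OF t])
  have mS: "measure lebesgue S > 0"
    unfolding S_def measure_translation_subtract by (rule tri_measure_pos[OF t])
  have "measure lebesgue (G ` S) = \<bar>det (matrix G)\<bar> * measure lebesgue S"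
    by (rule measure_linear_image[OF lin lmeasurable_compact[OF cS]])
  then have det: "\<bar>det (matrix G)\<bar> = 1" using mS by (simp add: GS)
  define J where "J = integral S (\<lambda>y. y)"
  have ai: "(\<lambda>y::real^2. y) absolutely_integrable_on S" by (rule absolutely_integrable_compact[OF cS]) (intro continuous_intros)
  have "integral (G ` S) (\<lambda>y. y) = \<bar>det (matrix G)\<bar> *\<^sub>R integral S ((\<lambda>y. y) \<circ> G)"
    by (rule integral_change_of_variables_linear[OF lin]) (use ai GS in simp)
  also have "integral S ((\<lambda>y. y) \<circ> G) = G J"
    unfolding J_def using integral_linear[OF set_lebesgue_integral_eq_integral(1)[OF ai], of G] lin
    by (simp add: o_def linear_conv_bounded_linear)
  finally have "J = G J" by (simp add: GS det J_def)
  then have "3 *\<^sub>R J = 0" using G0[of J] by (metis scaleR_left.add scaleR_one one_add_one numeral_Bit1 numeral_One add.assoc numeral_plus_one)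
  then show ?thesis by (simp add: J_def S_def m_def)
qed

lemma integral_affine_triangle:
  assumes t: "tri a b c T"
  shows "(\<integral>x. \<alpha> + \<beta> \<bullet> x \<partial>lebesgue_on T) = measure lebesgue T * (\<alpha> + \<beta> \<bullet> ((1/3) *\<^sub>R (a + b + c)))"
proof -
  define m where "m = (1/3) *\<^sub>R (a + b + c)"
  define S where "S = (\<lambda>x. x - m) ` T"
  have cS: "compact S" unfolding S_def by (intro compact_continuous_image continuous_intros tri_compact[OF t])
  have bT: "T \<in> sets borel" "S \<in> sets borel" using tri_compact[OF t] cS by (auto intro: borel_compact)
  have ind: "indicator T (m + y) = (indicator S y :: real)" for y
    by (auto simp: indicator_def S_def image_iff algebra_simps)
  have "(\<integral>x. \<alpha> + \<beta> \<bullet> x \<partial>lebesgue_on T) = (\<integral>x. indicator T x *\<^sub>R (\<alpha> + \<beta> \<bullet> x) \<partial>lborel)"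
    by (rule lebesgue_on_integral_lborel[OF bT(1)]) simp
  also have "\<dots> = (\<integral>y. (\<lambda>x. indicator T x *\<^sub>R (\<alpha> + \<beta> \<bullet> x)) (m + y) \<partial>lborel)"
    by (rule integral_lborel_translate[symmetric]) (use bT in measurable)
  also have "\<dots> = (\<integral>y. indicator S y *\<^sub>R ((\<alpha> + \<beta> \<bullet> m) + \<beta> \<bullet> y) \<partial>lborel)"
    by (simp add: ind inner_add_right add.assoc)
  also have "\<dots> = (\<integral>y. (\<alpha> + \<beta> \<bullet> m) + \<beta> \<bullet> y \<partial>lebesgue_on S)"
    by (rule lebesgue_on_integral_lborel[OF bT(2), symmetric]) simp
  also have "\<dots> = integral S (\<lambda>y. (\<alpha> + \<beta> \<bullet> m) + \<beta> \<bullet> y)"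
  proof (rule lebesgue_integral_eq_integral)
    have "(\<lambda>y. (\<alpha> + \<beta> \<bullet> m) + \<beta> \<bullet> y) absolutely_integrable_on S"
      by (rule absolutely_integrable_compact[OF cS]) (intro continuous_intros)
    then show "integrable (lebesgue_on S) (\<lambda>y. (\<alpha> + \<beta> \<bullet> m) + \<beta> \<bullet> y)"
      using bT(2) by (simp add: set_integrable_def integrable_restrict_space)
    show "S \<in> sets lebesgue" using bT(2) by simp
  qed
  also have "\<dots> = (\<alpha> + \<beta> \<bullet> m) * measure lebesgue S + \<beta> \<bullet> integral S (\<lambda>y. y)"
  proof -
    have i: "f integrable_on S" if "continuous_on UNIV f" for f :: "real^2 \<Rightarrow> 'b::euclidean_space"
      by (rule set_lebesgue_integral_eq_integral(1)[OF absolutely_integrable_compact[OF cS that]])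
    have "integral S (\<lambda>y. (\<alpha> + \<beta> \<bullet> m) + \<beta> \<bullet> y) = integral S (\<lambda>y. (\<alpha> + \<beta> \<bullet> m) * 1) + integral S (\<lambda>y. \<beta> \<bullet> y)"
      unfolding mult_1_right by (rule integral_add) (intro i continuous_intros)+
    moreover have "integral S (\<lambda>y. (\<alpha> + \<beta> \<bullet> m) * 1) = (\<alpha> + \<beta> \<bullet> m) * measure lebesgue S"
      by (simp only: integral_mult_right lmeasure_integral[OF lmeasurable_compact[OF cS]])
    moreover have "integral S (\<lambda>y. \<beta> \<bullet> y) = \<beta> \<bullet> integral S (\<lambda>y. y)"
      using integral_linear[OF i bounded_linear_inner_right, of "\<lambda>y. y" \<beta>] by (simp add: o_def continuous_on_id)
    ultimately show ?thesis by simp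
  qed
  also have "integral S (\<lambda>y. y) = 0" unfolding S_def m_def by (rule tri_first_moment[OF t])
  also have "measure lebesgue S = measure lebesgue T" unfolding S_def by (rule measure_translation_subtract)
  finally show ?thesis by (simp add: m_def mult.commute)
qed

context triangulated_polygon
begin

text \<open>The line integral of the tangential component of \<open>quadratic_field g \<gamma>\<close> along \<open>[a, b]\<close>, by Simpson's rule.\<close>
definition circulation :: "(real^2 \<Rightarrow> real^2) \<Rightarrow> ((real^2) set \<Rightarrow> real^2) \<Rightarrow> real^2 \<Rightarrow> real^2 \<Rightarrow> real" where
  "circulation g \<gamma> a b = (b - a) \<bullet> (g a + g b) / 2 + (b - a) \<bullet> \<gamma> (closed_segment a b) / 6"

lemma div_quadratic_field:
  assumes T: "T \<in> \<T>" and t: "tri a b c T" and x: "x \<in> T"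
    and na: "\<And>x. nodal T a x = \<alpha>a + \<beta>a \<bullet> x" and nb: "\<And>x. nodal T b x = \<alpha>b + \<beta>b \<bullet> x" and nc: "\<And>x. nodal T c x = \<alpha>c + \<beta>c \<bullet> x"
  shows "div_on T (quadratic_field g \<gamma>) x = g a \<bullet> \<beta>a + g b \<bullet> \<beta>b + g c \<bullet> \<beta>c
     + \<gamma> (closed_segment a b) \<bullet> (nodal T a x *\<^sub>R \<beta>b + nodal T b x *\<^sub>R \<beta>a)
     + \<gamma> (closed_segment b c) \<bullet> (nodal T b x *\<^sub>R \<beta>c + nodal T c x *\<^sub>R \<beta>b)
     + \<gamma> (closed_segment c a) \<bullet> (nodal T c x *\<^sub>R \<beta>a + nodal T a x *\<^sub>R \<beta>c)"
proof -
  have dn: "((\<lambda>x. \<alpha> + \<beta> \<bullet> x) has_derivative (\<lambda>h. \<beta> \<bullet> h)) (at x)" for \<alpha> and \<beta> :: "real^2"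
    by (auto intro!: derivative_eq_intros)
  have "grad_on T (\<lambda>y. quadratic_field g \<gamma> y $ i) x = g a $ i *\<^sub>R \<beta>a + g b $ i *\<^sub>R \<beta>b + g c $ i *\<^sub>R \<beta>c
     + \<gamma> (closed_segment a b) $ i *\<^sub>R (nodal T a x *\<^sub>R \<beta>b + nodal T b x *\<^sub>R \<beta>a)
     + \<gamma> (closed_segment b c) $ i *\<^sub>R (nodal T b x *\<^sub>R \<beta>c + nodal T c x *\<^sub>R \<beta>b)
     + \<gamma> (closed_segment c a) $ i *\<^sub>R (nodal T c x *\<^sub>R \<beta>a + nodal T a x *\<^sub>R \<beta>c)" (is "_ = ?G") for i
  proof (rule grad_on_eq[OF convex_\<T>[OF T] interior_\<T>[OF T] x])
    let ?p = "\<lambda>y. (\<alpha>a + \<beta>a \<bullet> y) * g a $ i + (\<alpha>b + \<beta>b \<bullet> y) * g b $ i + (\<alpha>c + \<beta>c \<bullet> y) * g c $ i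
      + ((\<alpha>a + \<beta>a \<bullet> y) * (\<alpha>b + \<beta>b \<bullet> y)) * \<gamma> (closed_segment a b) $ i
      + ((\<alpha>b + \<beta>b \<bullet> y) * (\<alpha>c + \<beta>c \<bullet> y)) * \<gamma> (closed_segment b c) $ i
      + ((\<alpha>c + \<beta>c \<bullet> y) * (\<alpha>a + \<beta>a \<bullet> y)) * \<gamma> (closed_segment c a) $ i"
    show "(?p has_derivative (\<bullet>) ?G) (at x)"
      by (rule has_derivative_eq_rhs, (rule has_derivative_add has_derivative_mult_left has_derivative_mult dn)+)
         (simp add: fun_eq_iff inner_add_left na nb nc algebra_simps)
    show "quadratic_field g \<gamma> y $ i = ?p y" if "y \<in> T" for y
      by (simp add: quadratic_field_on[OF T t that] na nb nc)
  qed
  then show ?thesis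
    by (simp add: div_on_def sum_2 inner_vec_def algebra_simps)
qed

text \<open>The divergence is affine on \<open>T\<close>, so its integral is the area times the value at the centroid. With the
  gradients of the barycentric coordinates written as rotated edge vectors, this value is \<open>- 2 / D\<close> times
  the sum of the circulations, where \<open>D\<close> is twice the signed area.\<close>
lemma integral_div_circulation:
  assumes T: "T \<in> \<T>" and t: "tri a b c T"
  shows "(\<integral>x. div_on T (\<lambda>x. rot90 *v quadratic_field g \<gamma> x) x \<partial>lebesgue_on T) = 0
      \<longleftrightarrow> circulation g \<gamma> a b + circulation g \<gamma> b c + circulation g \<gamma> c a = 0"
proof -
  define D where "D = cross2 (b - a) (c - a)"
  have D: "cross2 (b - a) (c - a) = D" "cross2 (c - b) (a - b) = D" "cross2 (a - c) (b - c) = D" "D \<noteq> 0"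
    using tri_cross2[OF t] cross2_cyclic by (auto simp: D_def)
  define \<beta>a \<beta>b \<beta>c where "\<beta>a = (1 / D) *\<^sub>R (rot90 *v (c - b))" and "\<beta>b = (1 / D) *\<^sub>R (rot90 *v (a - c))" and "\<beta>c = (1 / D) *\<^sub>R (rot90 *v (b - a))"
  have na: "nodal T a x = cross2 b c / D + \<beta>a \<bullet> x" for x
    unfolding nodal_bary_all[OF t] bary_affine[of a b c] D \<beta>a_def ..
  have nb: "nodal T b x = cross2 c a / D + \<beta>b \<bullet> x" for x
    unfolding nodal_bary_all[OF t] bary_affine[of b c a] D \<beta>b_def ..
  have nc: "nodal T c x = cross2 a b / D + \<beta>c \<bullet> x" for x
    unfolding nodal_bary_all[OF t] bary_affine[of c a b] D \<beta>c_def ..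
  define Q where "Q = circulation g \<gamma> a b + circulation g \<gamma> b c + circulation g \<gamma> c a"
  define g' \<gamma>' where "g' = (\<lambda>z. rot90 *v g z)" and "\<gamma>' = (\<lambda>F. rot90 *v \<gamma> F)"
  let ?ab = "closed_segment a b" and ?bc = "closed_segment b c" and ?ca = "closed_segment c a"
  define f where "f x = g' a \<bullet> \<beta>a + g' b \<bullet> \<beta>b + g' c \<bullet> \<beta>c
     + \<gamma>' ?ab \<bullet> (nodal T a x *\<^sub>R \<beta>b + nodal T b x *\<^sub>R \<beta>a)
     + \<gamma>' ?bc \<bullet> (nodal T b x *\<^sub>R \<beta>c + nodal T c x *\<^sub>R \<beta>b)
     + \<gamma>' ?ca \<bullet> (nodal T c x *\<^sub>R \<beta>a + nodal T a x *\<^sub>R \<beta>c)" for x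
  have div: "div_on T (\<lambda>x. rot90 *v quadratic_field g \<gamma> x) x = f x" if "x \<in> T" for x
    unfolding rot90_quadratic_field g'_def[symmetric] \<gamma>'_def[symmetric] f_def
    by (rule div_quadratic_field[OF T t that na nb nc])
  obtain \<alpha> \<beta> where aff: "\<And>x. f x = \<alpha> + \<beta> \<bullet> x"
  proof
    fix x
    show "f x = f 0 + ((\<gamma>' ?ab \<bullet> \<beta>b) *\<^sub>R \<beta>a + (\<gamma>' ?ab \<bullet> \<beta>a) *\<^sub>R \<beta>b + (\<gamma>' ?bc \<bullet> \<beta>c) *\<^sub>R \<beta>b + (\<gamma>' ?bc \<bullet> \<beta>b) *\<^sub>R \<beta>c
        + (\<gamma>' ?ca \<bullet> \<beta>a) *\<^sub>R \<beta>c + (\<gamma>' ?ca \<bullet> \<beta>c) *\<^sub>R \<beta>a) \<bullet> x"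
      by (simp add: f_def na nb nc inner_add_right inner_add_left algebra_simps)
  qed
  have "(\<integral>x. div_on T (\<lambda>x. rot90 *v quadratic_field g \<gamma> x) x \<partial>lebesgue_on T) = (\<integral>x. \<alpha> + \<beta> \<bullet> x \<partial>lebesgue_on T)"
    by (rule Bochner_Integration.integral_cong) (auto simp: div aff)
  also have "\<dots> = measure lebesgue T * f ((1/3) *\<^sub>R (a + b + c))"
    unfolding aff by (rule integral_affine_triangle[OF t])
  also have "f ((1/3) *\<^sub>R (a + b + c)) = - (2 / D) * Q"
  proof -
    have rr: "(rot90 *v u) \<bullet> (rot90 *v w) = u \<bullet> w" for u w
      by (simp add: inner_vec_def sum_2 rot90_component)
    have "f ((1/3) *\<^sub>R (a + b + c)) = (g a \<bullet> (c - b) + g b \<bullet> (a - c) + g c \<bullet> (b - a)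
      + (\<gamma> ?ab \<bullet> ((a - c) + (c - b)) + \<gamma> ?bc \<bullet> ((b - a) + (a - c)) + \<gamma> ?ca \<bullet> ((c - b) + (b - a))) / 3) / D"
      unfolding f_def nodal_centroid[OF t] g'_def \<gamma>'_def \<beta>a_def \<beta>b_def \<beta>c_def inner_add_right inner_scaleR_right rr
      using D(4) by (simp add: field_simps)
    also have "\<dots> = - (2 / D) * Q"
      using D(4) by (simp add: Q_def circulation_def field_simps inner_add_right inner_add_left inner_diff_left inner_diff_right inner_commute)
    finally show ?thesis .
  qed
  finally have "(\<integral>x. div_on T (\<lambda>x. rot90 *v quadratic_field g \<gamma> x) x \<partial>lebesgue_on T) = 0 \<longleftrightarrow> Q = 0"
    using tri_measure_pos[OF t] D(4) by simp
  then show ?thesis unfolding Q_def .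
qed

end

section \<open>Cubics with prescribed vertex values and gradients\<close>

lemma tri_barycentre: "tri a b c T \<Longrightarrow> barycentre T = (1/3) *\<^sub>R (a + b + c)"
  using tri_distinct[of a b c T] by (simp add: barycentre_def tri_verts add.assoc)

definition smoothstep :: "real \<Rightarrow> real" where "smoothstep s = s * (s * (3 - 2 * s))"

lemma smoothstep_simps [simp]: "smoothstep 0 = 0" "smoothstep 1 = 1"
  by (simp_all add: smoothstep_def)

lemma smoothstep_sum: "s + t = 1 \<Longrightarrow> smoothstep s + smoothstep t = 1"
proof -
  assume "s + t = 1"
  then have t: "t = 1 - s" by simp
  show ?thesis unfolding t by (simp add: smoothstep_def algebra_simps)
qed

definition hermite_sum :: "(real^2) set \<Rightarrow> (real^2 \<Rightarrow> real) \<Rightarrow> (real^2 \<Rightarrow> real^2) \<Rightarrow> real^2 \<Rightarrow> real" where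
  "hermite_sum T u g x = (\<Sum>z\<in>verts T. u z * smoothstep (nodal T z x) + (nodal T z x)\<^sup>2 * (g z \<bullet> (x - z)))"

text \<open>The coefficient of the cubic bubble enforces the defining condition of \<open>P3_minus T\<close>. The bubble has
  the value \<open>1/27\<close> at the centroid, so that \<open>6 * (9/2) / 27 = 1\<close>, and it vanishes to second order at
  the vertices.\<close>
definition hermite :: "(real^2) set \<Rightarrow> (real^2 \<Rightarrow> real) \<Rightarrow> (real^2 \<Rightarrow> real^2) \<Rightarrow> real^2 \<Rightarrow> real" where
  "hermite T u g x = hermite_sum T u g x
     - 9/2 * (6 * hermite_sum T u g (barycentre T) - (\<Sum>z\<in>verts T. 2 * u z - g z \<bullet> (z - barycentre T)))
        * (\<Prod>z\<in>verts T. nodal T z x)"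

context triangulated_polygon
begin

lemma hermite_tri:
  assumes t: "tri a b c T"
  obtains \<kappa> where "\<And>x. hermite T u g x =
      (u a * smoothstep (nodal T a x) + (nodal T a x)\<^sup>2 * (g a \<bullet> (x - a)))
    + (u b * smoothstep (nodal T b x) + (nodal T b x)\<^sup>2 * (g b \<bullet> (x - b)))
    + (u c * smoothstep (nodal T c x) + (nodal T c x)\<^sup>2 * (g c \<bullet> (x - c)))
    + \<kappa> * (nodal T a x * nodal T b x * nodal T c x)"
  by (rule that[of "- (9/2 * (6 * hermite_sum T u g (barycentre T) - (\<Sum>z\<in>verts T. 2 * u z - g z \<bullet> (z - barycentre T))))"])
     (use tri_distinct[OF t] in \<open>simp add: hermite_def hermite_sum_def tri_verts[OF t]\<close>)

lemma hermite_vertex: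
  assumes t: "tri a b c T" shows "hermite T u g a = u a"
proof -
  obtain \<kappa> where "hermite T u g a =
      (u a * smoothstep (nodal T a a) + (nodal T a a)\<^sup>2 * (g a \<bullet> (a - a)))
    + (u b * smoothstep (nodal T b a) + (nodal T b a)\<^sup>2 * (g b \<bullet> (a - b)))
    + (u c * smoothstep (nodal T c a) + (nodal T c a)\<^sup>2 * (g c \<bullet> (a - c)))
    + \<kappa> * (nodal T a a * nodal T b a * nodal T c a)" using hermite_tri[OF t] by metis
  then show ?thesis
    using nodal_vert3[OF t] nodal_vert3[OF tri_perms(1)[OF t]] nodal_vert3[OF tri_perms(2)[OF t]] by simp
qed

lemma hermite_P3: assumes t: "tri a b c T" shows "hermite T u g \<in> P 3 S"
proof -
  obtain \<kappa> where h: "\<And>x. hermite T u g x =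
      (u a * smoothstep (nodal T a x) + (nodal T a x)\<^sup>2 * (g a \<bullet> (x - a)))
    + (u b * smoothstep (nodal T b x) + (nodal T b x)\<^sup>2 * (g b \<bullet> (x - b)))
    + (u c * smoothstep (nodal T c x) + (nodal T c x)\<^sup>2 * (g c \<bullet> (x - c)))
    + \<kappa> * (nodal T a x * nodal T b x * nodal T c x)" using hermite_tri[OF t] by metis
  have nm: "(\<lambda>x. nodal T z x * f x) \<in> P (Suc k) S" if f: "f \<in> P k S" for z f k
  proof -
    obtain \<alpha> \<beta> where "\<And>x. nodal T z x = \<alpha> + \<beta> \<bullet> x" using nodal_affine[OF t] by metis
    then show ?thesis using P_mult_affine[OF f, of \<alpha> \<beta>] by simp
  qed
  have n1: "(\<lambda>x. nodal T z x) \<in> P 1 S" for z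
    using nm[OF P_const[of 1 0]] by simp
  have lin: "(\<lambda>x. w \<bullet> (x - z)) \<in> P 1 S" for w z
  proof -
    have "(\<lambda>x. - (w \<bullet> z) + w \<bullet> x) \<in> P (Suc 0) S" by (rule P_affine)
    then show ?thesis by (simp add: inner_diff_right)
  qed
  have s: "(\<lambda>x. smoothstep (nodal T z x)) \<in> P 3 S" for z
  proof -
    have "(\<lambda>x. 3 - 2 * nodal T z x) \<in> P 1 S" by (rule P_diff[OF P_const P_cmult[OF n1]])
    from nm[OF nm[OF this]] show ?thesis by (simp add: smoothstep_def numeral_3_eq_3)
  qed
  have q: "(\<lambda>x. (nodal T z x)\<^sup>2 * (w \<bullet> (x - v))) \<in> P 3 S" for z w v
    using nm[OF nm[OF lin]] by (simp add: power2_eq_square mult.assoc numeral_3_eq_3)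
  have b: "(\<lambda>x. nodal T a x * nodal T b x * nodal T c x) \<in> P 3 S"
    using nm[OF nm[OF n1]] by (simp add: mult.assoc numeral_3_eq_3)
  have "(\<lambda>x. (u a * smoothstep (nodal T a x) + (nodal T a x)\<^sup>2 * (g a \<bullet> (x - a)))
    + (u b * smoothstep (nodal T b x) + (nodal T b x)\<^sup>2 * (g b \<bullet> (x - b)))
    + (u c * smoothstep (nodal T c x) + (nodal T c x)\<^sup>2 * (g c \<bullet> (x - c)))
    + \<kappa> * (nodal T a x * nodal T b x * nodal T c x)) \<in> P 3 S"
    by (intro P_add P_cmult s q b)
  then show ?thesis by (rule P_cong) (simp add: h)
qed

lemma hermite_grad:
  assumes t: "tri a b c T" shows "(hermite T u g has_derivative (\<bullet>) (g a)) (at a)"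
proof -
  obtain \<kappa> where h: "\<And>x. hermite T u g x =
      (u a * smoothstep (nodal T a x) + (nodal T a x)\<^sup>2 * (g a \<bullet> (x - a)))
    + (u b * smoothstep (nodal T b x) + (nodal T b x)\<^sup>2 * (g b \<bullet> (x - b)))
    + (u c * smoothstep (nodal T c x) + (nodal T c x)\<^sup>2 * (g c \<bullet> (x - c)))
    + \<kappa> * (nodal T a x * nodal T b x * nodal T c x)" using hermite_tri[OF t] by metis
  obtain \<alpha>a \<beta>a where na: "\<And>x. nodal T a x = \<alpha>a + \<beta>a \<bullet> x" using nodal_affine[OF t] by metis
  obtain \<alpha>b \<beta>b where nb: "\<And>x. nodal T b x = \<alpha>b + \<beta>b \<bullet> x" using nodal_affine[OF t] by metis
  obtain \<alpha>c \<beta>c where nc: "\<And>x. nodal T c x = \<alpha>c + \<beta>c \<bullet> x" using nodal_affine[OF t] by metis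
  have dn: "((\<lambda>x. nodal T a x) has_derivative (\<lambda>h. \<beta>a \<bullet> h)) (at a)"
    "((\<lambda>x. nodal T b x) has_derivative (\<lambda>h. \<beta>b \<bullet> h)) (at a)"
    "((\<lambda>x. nodal T c x) has_derivative (\<lambda>h. \<beta>c \<bullet> h)) (at a)"
    unfolding na nb nc by (auto intro!: derivative_eq_intros)
  have v: "nodal T a a = 1" "nodal T b a = 0" "nodal T c a = 0"
    using nodal_vert3[OF t] nodal_vert3[OF tri_perms(1)[OF t]] nodal_vert3[OF tri_perms(2)[OF t]] by auto
  have di: "((\<lambda>x. w \<bullet> (x - z)) has_derivative (\<lambda>h. w \<bullet> h)) (at a)" for w z :: "real^2"
    by (auto intro!: derivative_eq_intros)
  have dc: "((\<lambda>x. k - f x) has_derivative (\<lambda>h. - f' h)) (at a)" if "(f has_derivative f') (at a)" for k and f f' :: "real^2 \<Rightarrow> real"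
    using has_derivative_diff[OF has_derivative_const that] by simp
  have h': "hermite T u g = (\<lambda>x.
      (u a * (nodal T a x * (nodal T a x * (3 - 2 * nodal T a x))) + (nodal T a x * nodal T a x) * (g a \<bullet> (x - a)))
    + (u b * (nodal T b x * (nodal T b x * (3 - 2 * nodal T b x))) + (nodal T b x * nodal T b x) * (g b \<bullet> (x - b)))
    + (u c * (nodal T c x * (nodal T c x * (3 - 2 * nodal T c x))) + (nodal T c x * nodal T c x) * (g c \<bullet> (x - c)))
    + \<kappa> * (nodal T a x * nodal T b x * nodal T c x))"
    by (simp add: fun_eq_iff h smoothstep_def power2_eq_square)
  show ?thesis unfolding h'
    by (rule has_derivative_eq_rhs, (rule has_derivative_add has_derivative_mult_right has_derivative_mult dn di dc)+)
       (simp add: fun_eq_iff v)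
qed

lemma hermite_P3_minus:
  assumes T: "T \<in> \<T>" and t: "tri a b c T" and f: "\<And>x. x \<in> T \<Longrightarrow> f x = hermite T u g x + k"
  shows "f \<in> P3_minus T" "\<And>z. z \<in> verts T \<Longrightarrow> grad_on T f z = g z"
proof -
  show gr: "grad_on T f z = g z" if z: "z \<in> verts T" for z
  proof (rule grad_on_eq[OF convex_\<T>[OF T] interior_\<T>[OF T] _ _ f])
    obtain b' c' where t': "tri z b' c' T" using z t tri_verts[OF t] tri_perms[OF t] by auto
    show "((\<lambda>x. hermite T u g x + k) has_derivative (\<bullet>) (g z)) (at z)"
      using has_derivative_add[OF hermite_grad[OF t'] has_derivative_const] by simp
    show "z \<in> T" using z verts_subset by blast
  qed
  have fP: "f \<in> P 3 T"
    by (rule P_cong[OF P_add[OF hermite_P3[OF t] P_const]]) (simp add: f)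
  let ?m = "barycentre T"
  have m: "?m = (1/3) *\<^sub>R (a + b + c)" by (rule tri_barycentre[OF t])
  have n: "nodal T a ?m = 1/3" "nodal T b ?m = 1/3" "nodal T c ?m = 1/3" unfolding m by (rule nodal_centroid[OF t])+
  have mT: "?m \<in> T" using n by (simp add: tri_mem_iff[OF t])
  have abc: "a \<in> T" "b \<in> T" "c \<in> T" using verts_subset tri_verts[OF t] by auto
  have fv: "f a = u a + k" "f b = u b + k" "f c = u c + k"
    using f abc hermite_vertex[OF t] hermite_vertex[OF tri_perms(1)[OF t]] hermite_vertex[OF tri_perms(2)[OF t]] by auto
  define E where "E = (\<Sum>z\<in>verts T. 2 * u z - g z \<bullet> (z - ?m))"
  have "(\<Prod>z\<in>verts T. nodal T z ?m) = 1/27"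
    using tri_distinct[OF t] by (simp add: tri_verts[OF t] n)
  then have "hermite T u g ?m = hermite_sum T u g ?m - 9/2 * (6 * hermite_sum T u g ?m - E) * (1/27)"
    by (simp only: hermite_def E_def)
  then have "6 * hermite T u g ?m = E" by (simp add: field_simps)
  then have "6 * f ?m = E + 6 * k" by (simp add: f[OF mT])
  moreover have "(\<Sum>z\<in>verts T. 2 * f z - grad_on T f z \<bullet> (z - ?m)) = E + 6 * k"
    using tri_distinct[OF t] gr fv by (simp add: E_def tri_verts[OF t])
  ultimately show "f \<in> P3_minus T" using fP by (simp add: P3_minus_def)
qed

lemma hermite_edge:
  assumes t: "tri a b c T" and x: "nodal T c x = 0"
  shows "hermite T u g x = u a * smoothstep (nodal T a x) + u b * smoothstep (nodal T b x)
    + (nodal T a x)\<^sup>2 * (g a \<bullet> (x - a)) + (nodal T b x)\<^sup>2 * (g b \<bullet> (x - b))"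
proof -
  obtain \<kappa> where "hermite T u g x =
      (u a * smoothstep (nodal T a x) + (nodal T a x)\<^sup>2 * (g a \<bullet> (x - a)))
    + (u b * smoothstep (nodal T b x) + (nodal T b x)\<^sup>2 * (g b \<bullet> (x - b)))
    + (u c * smoothstep (nodal T c x) + (nodal T c x)\<^sup>2 * (g c \<bullet> (x - c)))
    + \<kappa> * (nodal T a x * nodal T b x * nodal T c x)" using hermite_tri[OF t] by metis
  then show ?thesis using x by simp
qed

text \<open>On the common face of two different triangles only the shared vertices contribute: the other
  coordinates vanish there, and with them the cubic bubbles. The gradient terms agree, and the value terms
  differ by a constant times the sum of the smoothsteps, which is one.\<close>
lemma hermite_compat:
  assumes T: "T \<in> \<T>" and T': "T' \<in> \<T>"
    and d: "\<And>z w. z \<in> verts T \<inter> verts T' \<Longrightarrow> w \<in> verts T \<inter> verts T' \<Longrightarrow> u w - u z = u' w - u' z"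
    and same: "T = T' \<Longrightarrow> u = u'"
  obtains k where "\<And>x. x \<in> T \<Longrightarrow> x \<in> T' \<Longrightarrow> hermite T u g x - hermite T' u' g x = k"
proof (cases "T = T'")
  case True then show thesis using that[of 0] same by simp
next
  case False
  obtain a0 b0 c0 where t0: "tri a0 b0 c0 T" using tri_\<T>[OF T] .
  obtain a1 b1 c1 where t1: "tri a1 b1 c1 T'" using tri_\<T>[OF T'] .
  have hull: "T = convex hull (verts T)" "T' = convex hull (verts T')"
    using t0 t1 tri_verts[OF t0] tri_verts[OF t1] by (auto simp: tri_def)
  have card: "card (verts T) = 3" "card (verts T') = 3"
    using t0 t1 tri_verts[OF t0] tri_verts[OF t1] by (auto simp: tri_def)
  have neq: "verts T \<noteq> verts T'" using hull False by metis
  have "\<not> verts T \<subseteq> verts T'" using neq card card_subset_eq[OF finite_verts[OF T']] by metis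
  then obtain c where c: "c \<in> verts T" "c \<notin> verts T'" by blast
  have "\<not> verts T' \<subseteq> verts T" using neq card card_subset_eq[OF finite_verts[OF T]] by metis
  then obtain c' where c': "c' \<in> verts T'" "c' \<notin> verts T" by blast
  define Z where "Z = verts T \<inter> verts T'"
  have fZ: "finite Z" using finite_verts[OF T] by (simp add: Z_def)
  have form: "hermite S w g x = (\<Sum>z\<in>Z. w z * smoothstep (nodal S z x) + (nodal S z x)\<^sup>2 * (g z \<bullet> (x - z)))"
    if S: "S \<in> \<T>" "Z \<subseteq> verts S" and x: "\<And>z. z \<in> verts S - Z \<Longrightarrow> nodal S z x = 0" and ne: "verts S - Z \<noteq> {}" for S w x
  proof -
    have "(\<Prod>z\<in>verts S. nodal S z x) = 0"
      using ne x finite_verts[OF S(1)] by (auto simp: prod_zero_iff)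
    moreover have "hermite_sum S w g x = (\<Sum>z\<in>Z. w z * smoothstep (nodal S z x) + (nodal S z x)\<^sup>2 * (g z \<bullet> (x - z)))"
      unfolding hermite_sum_def by (rule sum.mono_neutral_right[OF finite_verts[OF S(1)] S(2)]) (use x in auto)
    ultimately show ?thesis by (simp add: hermite_def)
  qed
  define k where "k = (if Z = {} then 0 else u (SOME z. z \<in> Z) - u' (SOME z. z \<in> Z))"
  have kz: "u z - u' z = k" if z: "z \<in> Z" for z
  proof -
    have "(SOME z. z \<in> Z) \<in> Z" by (rule someI[of _ z]) (rule z)
    then show ?thesis using d[of z "SOME z. z \<in> Z"] z by (auto simp: k_def Z_def)
  qed
  have "hermite T u g x - hermite T' u' g x = k" if x: "x \<in> T" "x \<in> T'" for x
  proof -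
    have co: "nodal T z x = nodal T' z x" for z by (rule nodal_compat[OF T T' x])
    have z1: "nodal T z x = 0" if "z \<in> verts T - Z" for z
      using that co[of z] nodal_not_vert[of z T'] by (auto simp: Z_def)
    have z2: "nodal T' z x = 0" if "z \<in> verts T' - Z" for z
      using that co[of z] nodal_not_vert[of z T] by (auto simp: Z_def)
    have 1: "hermite T u g x = (\<Sum>z\<in>Z. u z * smoothstep (nodal T z x) + (nodal T z x)\<^sup>2 * (g z \<bullet> (x - z)))"
      by (rule form[OF T _ z1]) (use c in \<open>auto simp: Z_def\<close>)
    have 2: "hermite T' u' g x = (\<Sum>z\<in>Z. u' z * smoothstep (nodal T' z x) + (nodal T' z x)\<^sup>2 * (g z \<bullet> (x - z)))"
      by (rule form[OF T' _ z2]) (use c' in \<open>auto simp: Z_def\<close>)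
    have "hermite T u g x - hermite T' u' g x = (\<Sum>z\<in>Z. (u z - u' z) * smoothstep (nodal T z x))"
      unfolding 1 2 co by (simp add: sum_subtractf[symmetric] left_diff_distrib)
    also have "\<dots> = k * (\<Sum>z\<in>Z. smoothstep (nodal T z x))"
      by (simp add: kz sum_distrib_left)
    also have "(\<Sum>z\<in>Z. smoothstep (nodal T z x)) = (\<Sum>z\<in>verts T. smoothstep (nodal T z x))"
      by (rule sum.mono_neutral_left[OF finite_verts[OF T]]) (use z1 in \<open>auto simp: Z_def\<close>)
    also have "\<dots> = 1"
    proof -
      obtain a b where t: "tri a b c T" using c(1) t0 tri_verts[OF t0] tri_perms[OF t0] by auto
      have "nodal T c x = 0" using z1 c by (auto simp: Z_def)
      then have "nodal T a x + nodal T b x = 1" using nodal_sum3(1)[OF t, of x] by simp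
      then show ?thesis
        using tri_distinct[OF t] \<open>nodal T c x = 0\<close> smoothstep_sum by (simp add: tri_verts[OF t])
    qed
    finally show ?thesis by simp
  qed
  then show thesis by (rule that)
qed

end

context triangulated_polygon
begin

section \<open>The global potential\<close>

text \<open>The closest point map onto the disc fixes the points of the disc and takes all others to its
  boundary circle, which lies outside \<open>\<Omega>\<close>.\<close>
lemma connected_Compl_Int_cball:
  assumes "simply_connected \<Omega>" "\<Omega> \<subseteq> ball 0 M" "M > 0"
  shows "connected (- \<Omega> \<inter> cball 0 M)"
proof -
  let ?K = "cball 0 M :: (real^2) set"
  have K: "convex ?K" "closed ?K" "?K \<noteq> {}" using assms(3) by auto
  have con: "connected (- \<Omega>)"
    by (rule connected_Compl_simply_connected[OF open_\<Omega> bounded_\<Omega> assms(1)])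
  have "closest_point ?K ` (- \<Omega>) = - \<Omega> \<inter> ?K"
  proof
    show "- \<Omega> \<inter> ?K \<subseteq> closest_point ?K ` (- \<Omega>)"
    proof
      fix x assume "x \<in> - \<Omega> \<inter> ?K"
      then show "x \<in> closest_point ?K ` (- \<Omega>)"
        by (intro image_eqI[of _ _ x]) (auto simp: closest_point_self)
    qed
    show "closest_point ?K ` (- \<Omega>) \<subseteq> - \<Omega> \<inter> ?K"
    proof
      fix y assume "y \<in> closest_point ?K ` (- \<Omega>)"
      then obtain x where x: "x \<notin> \<Omega>" "y = closest_point ?K x" by auto
      have yK: "y \<in> ?K" unfolding x(2) by (rule closest_point_in_set[OF K(2,3)])
      show "y \<in> - \<Omega> \<inter> ?K"
      proof (cases "x \<in> ?K")
        case True then show ?thesis using x by (simp add: closest_point_self)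
      next
        case False
        have int: "interior ?K \<noteq> {}" using assms(3) by simp
        have "rel_interior ?K = ball 0 M" using int by (simp add: rel_interior_nonempty_interior)
        moreover have "x \<in> affine hull ?K" using affine_hull_nonempty_interior[OF int] by simp
        ultimately have "y \<notin> ball 0 M"
          using closest_point_in_rel_interior[OF K(2,3), of x] False x(2) by auto
        then show ?thesis using yK assms(2) by blast
      qed
    qed
  qed
  then show ?thesis
    using connected_continuous_image[OF continuous_on_closest_point[OF K] con] by simp
qed

lemma circulation_commute: "circulation g \<gamma> b a = - circulation g \<gamma> a b"
  by (simp add: circulation_def closed_segment_commute[of b a] inner_diff_left inner_add_right field_simps)

text \<open>The vertex values on a triangle are the circulations from a fixed vertex \<open>base T\<close>. The increments
  \<open>f\<close> of the resulting cubics, taken to be zero between points without a common triangle, are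
  consistent near each point. Their primitive \<open>F\<close> on a square around \<open>\<Omega>\<close> is constant off \<open>\<Omega>\<close>.\<close>
lemma potential_exists:
  assumes sc: "simply_connected \<Omega>" and van: "vanishing g \<gamma>"
    and tang: "\<And>T a b c. T \<in> \<T> \<Longrightarrow> tri a b c T \<Longrightarrow> \<exists>s. \<gamma> (closed_segment a b) = s *\<^sub>R (b - a)"
    and loop: "\<And>T a b c. T \<in> \<T> \<Longrightarrow> tri a b c T \<Longrightarrow> circulation g \<gamma> a b + circulation g \<gamma> b c + circulation g \<gamma> c a = 0"
  shows "\<exists>\<phi>\<in>DKT_space \<Omega> \<T>. is_disc_grad \<Omega> \<T> \<phi> (quadratic_field g \<gamma>)"
proof -
  define d where "d = circulation g \<gamma>"
  have d0: "d z z = 0" for z by (simp add: d_def circulation_def)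
  have d_anti: "d b a = - d a b" for a b unfolding d_def by (rule circulation_commute)
  define base where "base T = (SOME z. z \<in> verts T)" for T :: "(real^2) set"
  have base: "base T \<in> verts T" if T: "T \<in> \<T>" for T
  proof -
    obtain a b c where t: "tri a b c T" using tri_\<T>[OF T] .
    show ?thesis unfolding base_def by (rule someI[of _ a]) (simp add: tri_verts[OF t])
  qed
  define u where "u T z = d (base T) z" for T z
  have u_diff: "u T w - u T z = d z w" if T: "T \<in> \<T>" and zw: "z \<in> verts T" "w \<in> verts T" for T z w
  proof -
    consider "z = w" | "z = base T" | "w = base T" | "z \<noteq> w" "z \<noteq> base T" "w \<noteq> base T" by blast
    then show ?thesis
    proof cases
      case 1 then show ?thesis by (simp add: d0)
    next
      case 2 then show ?thesis by (simp add: u_def d0)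
    next
      case 3 then show ?thesis using d_anti[of z "base T"] by (simp add: u_def d0)
    next
      case 4
      obtain a b c where t: "tri a b c T" using tri_\<T>[OF T] .
      have "tri (base T) z w T" using 4 base[OF T] zw t tri_verts[OF t] tri_perms[OF t] by auto
      from loop[OF T this] show ?thesis using d_anti[of w "base T"] by (simp add: u_def d_def)
    qed
  qed
  define H where "H T = hermite T (u T) g" for T
  define f where "f x y = (if \<exists>T\<in>\<T>. x \<in> T \<and> y \<in> T
      then (let T = SOME T. T \<in> \<T> \<and> x \<in> T \<and> y \<in> T in H T y - H T x) else 0)" for x y
  have f_eq: "f x y = H T y - H T x" if T: "T \<in> \<T>" "x \<in> T" "y \<in> T" for T x y
  proof -
    define T' where "T' = (SOME T. T \<in> \<T> \<and> x \<in> T \<and> y \<in> T)"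
    have T': "T' \<in> \<T> \<and> x \<in> T' \<and> y \<in> T'" unfolding T'_def by (rule someI_ex) (use T in blast)
    have f': "f x y = H T' y - H T' x" using T by (auto simp: f_def Let_def T'_def)
    obtain k where k: "\<And>x. x \<in> T \<Longrightarrow> x \<in> T' \<Longrightarrow> H T x - H T' x = k"
      unfolding H_def
    proof (rule hermite_compat[of T T' "u T" "u T'" g])
      fix z w assume "z \<in> verts T \<inter> verts T'" "w \<in> verts T \<inter> verts T'"
      then show "u T w - u T z = u T' w - u T' z" using u_diff[of T z w] u_diff[of T' z w] T(1) T' by simp
    qed (use T T' in auto)
    from k[of x] k[of y] show ?thesis using T T' f' by simp
  qed
  have f_bd: "f x y = 0" if F: "F \<in> edges \<T>" "F \<subseteq> frontier \<Omega>" "x \<in> F" "y \<in> F" for F x y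
  proof -
    obtain T a b c where T: "T \<in> \<T>" "tri a b c T" "F = closed_segment a b" using edgesE[OF F(1)] .
    have "a \<in> frontier \<Omega>" "b \<in> frontier \<Omega>" using F(2) T(3) by auto
    then have g0: "g a = 0" "g b = 0" and "\<gamma> F = 0"
      using van F(1,2) tri_vertices[OF T(1,2)] by (auto simp: vanishing_def)
    then have "d a b = 0" by (simp add: d_def circulation_def T(3))
    then have ub: "u T b = u T a" using u_diff[OF T(1), of a b] tri_verts[OF T(2)] by simp
    have "H T z = u T a" if z: "z \<in> F" for z
    proof -
      note n = nodal_closed_segment[OF T(2), of z, folded T(3), OF z]
      have "H T z = u T a * (smoothstep (nodal T a z) + smoothstep (nodal T b z))"
        unfolding H_def by (subst hermite_edge[OF T(2) n(1)]) (simp add: g0 ub distrib_left)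
      then show ?thesis using smoothstep_sum[OF n(2)] by simp
    qed
    moreover have "x \<in> T" "y \<in> T" using F T(2) nodal_closed_segment(3) by (auto simp: T(3))
    ultimately show ?thesis using f_eq[OF T(1)] F by simp
  qed
  \<comment> \<open>A point \<open>y\<close> near \<open>x\<close> lies only in those of these closed sets that contain \<open>x\<close>.\<close>
  define \<A> where "\<A> = \<T> \<union> {F \<in> edges \<T>. F \<subseteq> frontier \<Omega>} \<union> {- \<Omega>}"
  have near: "\<forall>\<^sub>F y in nhds x. \<forall>A\<in>\<A>. y \<in> A \<longrightarrow> x \<in> A" for x
  proof (rule eventually_closed_family)
    show "finite \<A>" using finite_\<T> finite_edges by (simp add: \<A>_def)
    fix A assume "A \<in> \<A>"
    then show "closed A" using closed_\<T> open_\<Omega> by (auto simp: \<A>_def elim!: edgesE)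
  qed
  have f_out: "f x y = 0" if xy: "x \<notin> \<Omega>" "y \<notin> \<Omega>" and N: "\<forall>A\<in>\<A>. y \<in> A \<longrightarrow> x \<in> A" for x y
  proof (cases "\<exists>T\<in>\<T>. x \<in> T \<and> y \<in> T")
    case True
    then have "y \<in> closure \<Omega>" using cover by blast
    then have "y \<in> frontier \<Omega>" using xy open_\<Omega> by (simp add: frontier_def interior_open)
    then obtain F where "F \<in> edges \<T>" "F \<subseteq> frontier \<Omega>" "y \<in> F" using frontier_edges by blast
    moreover then have "x \<in> F" using N by (auto simp: \<A>_def)
    ultimately show ?thesis using f_bd by blast
  qed (auto simp: f_def)
  have cons: "\<forall>\<^sub>F y in nhds x. \<forall>\<^sub>F z in nhds y. f x z - f x y = f y z" for x
    using near[of x]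
  proof eventually_elim
    case (elim y)
    note xy = elim
    show ?case using near[of y]
    proof eventually_elim
      case (elim z)
      \<comment> \<open>Either one triangle contains all three points, or all three lie off \<open>\<Omega>\<close>.\<close>
      show ?case
      proof (cases "z \<in> \<Union>\<T>")
        case True
        then obtain T where T: "T \<in> \<T>" "z \<in> T" by blast
        then have "y \<in> T" using elim by (auto simp: \<A>_def)
        then have "x \<in> T" using xy T by (auto simp: \<A>_def)
        then show ?thesis using f_eq[OF T(1)] T \<open>y \<in> T\<close> by simp
      next
        case False
        then have z: "z \<in> - \<Omega>" using cover closure_subset by blast
        then have "y \<in> - \<Omega>" using elim by (auto simp: \<A>_def)
        then have "x \<in> - \<Omega>" using xy by (auto simp: \<A>_def)
        then have "f x y = 0" using f_out xy \<open>y \<in> - \<Omega>\<close> by blast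
        moreover have "f x z = 0" "f y z = 0" using False by (auto simp: f_def)
        ultimately show ?thesis by simp
      qed
    qed
  qed
  obtain M where M: "M > 0" "closure \<Omega> \<subseteq> ball 0 M"
    using bounded_subset_ballD[OF bounded_closure[OF bounded_\<Omega>], of 0] by blast
  obtain F where F: "primitive_on f (rect (- 2 * M) (2 * M) (- 2 * M) (2 * M)) F"
    using primitive_on_rect[OF cons, of "- 2 * M" "2 * M" "- 2 * M" "2 * M"] M(1) by auto
  have rect: "cball 0 M \<subseteq> rect (- 2 * M) (2 * M) (- 2 * M) (2 * M)"
  proof
    fix x :: "real^2" assume "x \<in> cball 0 M"
    then have "\<bar>x $ i\<bar> \<le> M" for i using component_le_norm_cart[of x i] by simp
    from this[of 1] this[of 2] show "x \<in> rect (- 2 * M) (2 * M) (- 2 * M) (2 * M)"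
      using M(1) by (auto simp: rect_def abs_le_iff)
  qed
  have prim: "\<forall>\<^sub>F y in nhds x. F y - F x = f x y" if "x \<in> cball 0 M" for x
    using F rect that by (auto simp: primitive_on_def)
  have O: "\<Omega> \<subseteq> ball 0 M" "closure \<Omega> \<subseteq> cball 0 M" using M(2) closure_subset[of \<Omega>] ball_subset_cball by blast+
  obtain k where k: "\<And>x. x \<in> - \<Omega> \<inter> cball 0 M \<Longrightarrow> F x = k"
  proof (rule locally_constant_within[OF connected_Compl_Int_cball[OF sc O(1) M(1)], where f = F])
    fix x assume x: "x \<in> - \<Omega> \<inter> cball 0 M"
    then have "x \<in> cball 0 M" by blast
    from prim[OF this] near[of x]
    show "\<forall>\<^sub>F y in nhds x. y \<in> - \<Omega> \<inter> cball 0 M \<longrightarrow> F y = F x"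
    proof eventually_elim
      case (elim y)
      show ?case
      proof
        assume "y \<in> - \<Omega> \<inter> cball 0 M"
        then have "f x y = 0" using f_out[of x y] x elim by blast
        then show "F y = F x" using elim by simp
      qed
    qed
  qed auto
  define \<phi> where "\<phi> x = (if x \<in> closure \<Omega> then F x - k else 0)" for x
  have \<phi>0: "\<phi> x = 0" if "x \<in> frontier \<Omega>" for x
  proof -
    have "x \<in> closure \<Omega>" "x \<notin> \<Omega>" using that open_\<Omega> by (auto simp: frontier_def interior_open)
    then have "F x = k" using O by (intro k) auto
    then show ?thesis by (simp add: \<phi>_def)
  qed
  have \<phi>T: "\<exists>C. \<forall>x\<in>T. \<phi> x = H T x + C" if T: "T \<in> \<T>" for T
  proof -
    have sub: "T \<subseteq> closure \<Omega>" using T cover by blast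
    obtain C where C: "\<And>x. x \<in> T \<Longrightarrow> F x - H T x = C"
    proof (rule locally_constant_within[OF convex_connected[OF convex_\<T>[OF T]], where f = "\<lambda>x. F x - H T x"])
      fix x assume x: "x \<in> T"
      then have "x \<in> cball 0 M" using sub O by blast
      from prim[OF this] show "\<forall>\<^sub>F y in nhds x. y \<in> T \<longrightarrow> F y - H T y = F x - H T x"
        by eventually_elim (use f_eq[OF T x] in auto)
    qed auto
    have "\<phi> x = H T x + (C - k)" if "x \<in> T" for x using C[OF that] that sub by (auto simp: \<phi>_def)
    then show ?thesis by blast
  qed
  have grad: "\<phi> \<in> P3_minus T" "\<And>z. z \<in> verts T \<Longrightarrow> grad_on T \<phi> z = g z" if T: "T \<in> \<T>" for T
  proof -
    obtain C where C: "\<And>x. x \<in> T \<Longrightarrow> \<phi> x = hermite T (u T) g x + C" using \<phi>T[OF T] by (auto simp: H_def)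
    obtain a b c where t: "tri a b c T" using tri_\<T>[OF T] .
    show "\<phi> \<in> P3_minus T" "\<And>z. z \<in> verts T \<Longrightarrow> grad_on T \<phi> z = g z"
      using hermite_P3_minus[OF T t C] by auto
  qed
  have pw: "\<phi> \<in> piecewise \<T> P3_minus"
    using grad(1) cover by (auto simp: piecewise_def \<phi>_def)
  then have pw3: "\<phi> \<in> piecewise \<T> (P 3)" by (auto simp: piecewise_def P3_minus_def)
  have "\<phi> \<in> DKT_space \<Omega> \<T>"
    unfolding DKT_space_def
  proof (intro CollectI conjI ballI pw)
    show "\<phi> \<in> H10 \<Omega>" using piecewise_H10_iff[OF pw3] \<phi>0 by blast
    fix z assume z: "z \<in> vertices \<T>"
    show "\<exists>ga. (\<forall>T\<in>\<T>. z \<in> T \<longrightarrow> grad_on T \<phi> z = ga) \<and> (z \<in> frontier \<Omega> \<longrightarrow> ga = 0)"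
      by (rule exI[of _ "g z"]) (use grad(2) vertex_in_verts z van in \<open>auto simp: vanishing_def\<close>)
  qed
  moreover have "is_disc_grad \<Omega> \<T> \<phi> (quadratic_field g \<gamma>)"
  proof (rule is_disc_gradI[OF pw3 van _ tang])
    fix T z assume "T \<in> \<T>" "z \<in> verts T" then show "g z = grad_on T \<phi> z" using grad(2) by simp
  next
    fix T a b c assume T: "T \<in> \<T>" "tri a b c T"
    obtain C where C: "\<And>x. x \<in> T \<Longrightarrow> \<phi> x = hermite T (u T) g x + C" using \<phi>T[OF T(1)] by (auto simp: H_def)
    have ab: "a \<in> verts T" "b \<in> verts T" using tri_verts[OF T(2)] by auto
    then have "a \<in> T" "b \<in> T" using verts_subset by auto
    then have "\<phi> b - \<phi> a = d a b"
      using C hermite_vertex[OF T(2)] hermite_vertex[OF tri_perms(1)[OF T(2)]] u_diff[OF T(1) ab] by simp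
    then show "\<gamma> (closed_segment a b) \<bullet> (b - a) = 6 * (\<phi> b - \<phi> a) - 3 * ((g a + g b) \<bullet> (b - a))"
      by (simp add: d_def circulation_def inner_commute field_simps)
  qed
  ultimately show ?thesis by blast
qed

text \<open>By the interpolation conditions the circulation along an edge is the difference of the end point
  values of \<open>\<phi>\<close>.\<close>
lemma disc_grad_circulation:
  assumes \<phi>: "\<phi> \<in> piecewise \<T> (P 3)" and G: "is_disc_grad \<Omega> \<T> \<phi> (quadratic_field g \<gamma>)"
    and T: "T \<in> \<T>" "tri a b c T"
  shows "circulation g \<gamma> a b + circulation g \<gamma> b c + circulation g \<gamma> c a = 0"
proof -
  have edge: "circulation g \<gamma> a b = \<phi> b - \<phi> a" if t: "tri a b c T" for a b c
  proof -
    have ab: "a \<noteq> b" "a \<in> verts T" "b \<in> verts T" "a \<in> T" "b \<in> T"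
      using tri_distinct[OF t] tri_verts[OF t] verts_subset by auto
    have \<phi>T: "\<phi> \<in> P 3 T" using \<phi> T(1) by (auto simp: piecewise_def)
    have gz: "grad_on T \<phi> z = g z" if z: "z \<in> verts T" for z
    proof -
      have "quadratic_field g \<gamma> z = grad_on T \<phi> z" using G T(1) z unfolding is_disc_grad_def by blast
      then show ?thesis using quadratic_field_vertex[OF T(1) z, of g \<gamma>] by simp
    qed
    define tt where "tt = (1 / norm (b - a)) *\<^sub>R (b - a)"
    have "unit_tangent (closed_segment a b) tt" unfolding tt_def by (rule unit_tangent_segment[OF ab(1)])
    then have "quadratic_field g \<gamma> ((1/2) *\<^sub>R (a + b)) \<bullet> tt = grad_on T \<phi> ((1/2) *\<^sub>R (a + b)) \<bullet> tt"
      using G T(1) tri_edge[OF t] barycentre_segment[OF ab(1)] unfolding is_disc_grad_def by metis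
    then have "quadratic_field g \<gamma> ((1/2) *\<^sub>R (a + b)) \<bullet> (b - a) = grad_on T \<phi> ((1/2) *\<^sub>R (a + b)) \<bullet> (b - a)"
      using ab by (simp add: tt_def)
    also have "\<dots> = 3/2 * (\<phi> b - \<phi> a) - 1/4 * ((g a + g b) \<bullet> (b - a))"
      using P3_edge_midpoint[OF convex_\<T>[OF T(1)] interior_\<T>[OF T(1)] \<phi>T ab(4,5)] gz ab by simp
    finally have "((g a + g b) \<bullet> (b - a)) / 2 + \<gamma> (closed_segment a b) \<bullet> (b - a) / 4
        = 3/2 * (\<phi> b - \<phi> a) - 1/4 * ((g a + g b) \<bullet> (b - a))"
      by (simp add: quadratic_field_midpoint[OF T(1) t] inner_add_left)
    moreover define A B where "A = (g a + g b) \<bullet> (b - a)" and "B = \<gamma> (closed_segment a b) \<bullet> (b - a)"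
    ultimately have "A / 2 + B / 6 = \<phi> b - \<phi> a" by (simp only:) (simp add: field_simps)
    then show ?thesis by (simp add: A_def B_def circulation_def inner_commute)
  qed
  show ?thesis
    using edge[OF T(2)] edge[OF tri_perms(1)[OF T(2)]] edge[OF tri_perms(2)[OF T(2)]] by simp
qed

end

theorem mainTheorem7:
  fixes \<Omega> :: "(real^2) set"
    and \<T> :: "(real^2) set set"
    and \<nu> :: "(real^2) set \<Rightarrow> real^2"
    and \<psi> :: "real^2 \<Rightarrow> real^2"
  assumes "lipschitz_polygon \<Omega>"
    and "simply_connected \<Omega>"
    and "regular_triangulation \<T> \<Omega>"
    and "\<forall>F\<in>edges \<T>. unit_normal F (\<nu> F)"
    and "\<psi> \<in> BR_space \<Omega> \<T> \<nu>"
  shows "(\<exists>\<phi>\<in>DKT_space \<Omega> \<T>. \<psi> = disc_Curl \<Omega> \<T> \<phi>) \<longleftrightarrow>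
    (\<forall>T\<in>\<T>. (\<integral>x. div_on T \<psi> x \<partial>lebesgue_on T) = 0)"
proof -
  interpret triangulated_polygon \<Omega> \<T> by unfold_locales fact+
  obtain g \<gamma> where \<psi>: "\<psi> = (\<lambda>x. rot90 *v quadratic_field g \<gamma> x)" and van: "vanishing g \<gamma>"
    and tang: "\<And>T a b c. T \<in> \<T> \<Longrightarrow> tri a b c T \<Longrightarrow> \<exists>s. \<gamma> (closed_segment a b) = s *\<^sub>R (b - a)"
    using BR_space_quadratic_field[OF assms(4,5)] by blast
  have loop: "(\<forall>T\<in>\<T>. (\<integral>x. div_on T \<psi> x \<partial>lebesgue_on T) = 0) \<longleftrightarrow>
    (\<forall>T\<in>\<T>. \<forall>a b c. tri a b c T \<longrightarrow> circulation g \<gamma> a b + circulation g \<gamma> b c + circulation g \<gamma> c a = 0)"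
  proof (rule ball_cong[OF refl])
    fix T assume T: "T \<in> \<T>"
    obtain a b c where "tri a b c T" using tri_\<T>[OF T] .
    then show "((\<integral>x. div_on T \<psi> x \<partial>lebesgue_on T) = 0) \<longleftrightarrow>
        (\<forall>a b c. tri a b c T \<longrightarrow> circulation g \<gamma> a b + circulation g \<gamma> b c + circulation g \<gamma> c a = 0)"
      using integral_div_circulation[OF T, of _ _ _ g \<gamma>] unfolding \<psi> by blast
  qed
  show ?thesis
    unfolding loop
  proof
    assume "\<exists>\<phi>\<in>DKT_space \<Omega> \<T>. \<psi> = disc_Curl \<Omega> \<T> \<phi>"
    then obtain \<phi> where \<phi>: "\<phi> \<in> DKT_space \<Omega> \<T>" "\<psi> = disc_Curl \<Omega> \<T> \<phi>" by blast
    obtain G where G: "is_disc_grad \<Omega> \<T> \<phi> G" using disc_grad_exists[OF \<phi>(1)] by blast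
    have "rot90 *v quadratic_field g \<gamma> x = rot90 *v G x" for x
      using \<phi>(2) by (simp add: \<psi> disc_Curl_def disc_grad_eq[OF G] fun_eq_iff)
    then have "quadratic_field g \<gamma> x = G x" for x by (metis rot90_rot90 neg_equal_iff_equal)
    then have "is_disc_grad \<Omega> \<T> \<phi> (quadratic_field g \<gamma>)" using G by (metis ext)
    then show "\<forall>T\<in>\<T>. \<forall>a b c. tri a b c T \<longrightarrow> circulation g \<gamma> a b + circulation g \<gamma> b c + circulation g \<gamma> c a = 0"
      using disc_grad_circulation[OF DKT_piecewise[OF \<phi>(1)]] by blast
  next
    assume "\<forall>T\<in>\<T>. \<forall>a b c. tri a b c T \<longrightarrow> circulation g \<gamma> a b + circulation g \<gamma> b c + circulation g \<gamma> c a = 0"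
    then have "\<exists>\<phi>\<in>DKT_space \<Omega> \<T>. is_disc_grad \<Omega> \<T> \<phi> (quadratic_field g \<gamma>)"
      by (intro potential_exists[OF assms(2) van tang]) blast+
    then obtain \<phi> where \<phi>: "\<phi> \<in> DKT_space \<Omega> \<T>" "is_disc_grad \<Omega> \<T> \<phi> (quadratic_field g \<gamma>)" by blast
    then have "\<psi> = disc_Curl \<Omega> \<T> \<phi>"
      by (simp add: \<psi> disc_Curl_def disc_grad_eq fun_eq_iff)
    with \<phi>(1) show "\<exists>\<phi>\<in>DKT_space \<Omega> \<T>. \<psi> = disc_Curl \<Omega> \<T> \<phi>" by blast
  qed
qed

end
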